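(* Let $\mathcal V$ be an algebra of differential functions in $u_1,\dots,u_\ell$, which is a domain. Let $S\in\mathrm{Mat}_{\ell\times\ell}\mathcal V(\partial)$ be a skewadjoint rational matrix pseudodifferential operator with coefficients in $\mathcal V$, and assume that $S$ is an invertible element of the algebra $\mathrm{Mat}_{\ell\times\ell}\mathcal V(\partial)$. Then $S$ is a non-local symplectic structure on $\mathcal V$ if and only if $S^{-1}$ is a non-local Hamiltonian structure on $\mathcal V$.
   Context: All vector spaces are over a field $\mathbb F$ of characteristic zero; $I=\{1,\dots,\ell\}$. A differential algebra is a unital commutative associative algebra with a derivation $\partial$. Let $R_\ell=\mathbb F[u_i^{(n)}\mid i\in I,n\in\mathbb Z_+]$ with $\partial u_i^{(n)}=u_i^{(n+1)}$. An algebra of differential functions is a differential algebra extension $\mathcal V$ of $R_\ell$ with commuting derivations $\frac{\partial}{\partial u_i^{(n)}}$ extending the usual partial derivatives of $R_\ell$, such that for each $f\in\mathcal V$ only finitely many $\frac{\partial f}{\partial u_i^{(n)}}$ are nonzero, and $[\frac{\partial}{\partial u_i^{(n)}},\partial]=\frac{\partial}{\partial u_i^{(n-1)}}$ (zero if $n=0$). $\mathcal K$ is the field of fractions of $\mathcal V$. $\mathcal V((\partial^{-1}))$ is the algebra of pseudodifferential operators $\sum_{n\le N}a_n\partial^n$ with product determined by $\partial^n\circ a=\sum_{j\ge0}\binom nj a^{(j)}\partial^{n-j}$; the symbol of $A=\sum a_n\partial^n$ is $A(\lambda)=\sum a_n\lambda^n$; the adjoint is $(a\partial^n)^*=(-\partial)^n\circ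 a$, $(H^* )_{ij}=(H_{ji})^*$; $H$ is skewadjoint if $H^*=-H$. $\mathcal K(\partial)$ is the smallest subskewfield of $\mathcal K((\partial^{-1}))$ containing $\mathcal V[\partial]$, and $\mathcal V(\partial)=\mathcal K(\partial)\cap\mathcal V((\partial^{-1}))$ (rational pseudodifferential operators with coefficients in $\mathcal V$). $(\lambda+\partial)^n$ is always expanded in non-negative powers of $\partial$. For $H\in\mathrm{Mat}_{\ell\times\ell}\mathcal V(\partial)$ define $\{f_\lambda g\}_H=\sum_{i,j\in I;\,m,n\in\mathbb Z_+}\frac{\partial g}{\partial u_j^{(n)}}(\lambda+\partial)^nH_{ji}(\lambda+\partial)(-\lambda-\partial)^m\frac{\partial f}{\partial u_i^{(m)}}\in\mathcal V((\lambda^{-1}))$, so $\{{u_i}_\lambda u_j\}_H=H_{ji}(\lambda)$. The Beltrami $\lambda$-bracket is $\langle f_\lambda g\rangle=\sum_{i\in I;\,m,n\in\mathbb Z_+}(-1)^m\frac{\partial g}{\partial u_i^{(n)}}(\lambda+\partial)^{m+n}\frac{\partial f}{\partial u_i^{(m)}}\in\mathcal V[\lambda]$. Brackets with Laurent series are taken coefficientwise. $\mathcal V_{\lambda,\mu}=\mathcal V[[\lambda^{-1},\mu^{-1},(\lambda+\mu)^{-1}]][\lambda,\mu]$ is the quotient of $\mathcal V[[\lambda^{-1},\mu^{-1},\nu^{-1}]][\lambda,\mu,\nu]$ by the image of multiplication by $\nu-\lambda-\mu$; it embeds in $\mathcal V((\lambda^{-1}))((\mu^{-1}))$, $\mathcal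 V((\mu^{-1}))((\lambda^{-1}))$ and $\mathcal V(((\lambda+\mu)^{-1}))((\lambda^{-1}))$ by expanding, respectively, $(\lambda+\mu)^{-1}$ for $|\mu|>|\lambda|$, $(\lambda+\mu)^{-1}$ for $|\lambda|>|\mu|$, and $\mu^{-1}=((\lambda+\mu)-\lambda)^{-1}$ for $|\lambda|>|\lambda+\mu|$. For rational operators all the terms in the identities below lie in $\mathcal V_{\lambda,\mu}$ via these embeddings. A non-local Hamiltonian structure on $\mathcal V$ is a skewadjoint $H\in\mathrm{Mat}_{\ell\times\ell}\mathcal V(\partial)$ such that in $\mathcal V_{\lambda,\mu}$, for all $i,j,k\in I$: $\{{u_i}_\lambda\{{u_j}_\mu u_k\}_H\}_H-\{{u_j}_\mu\{{u_i}_\lambda u_k\}_H\}_H-\{\{{u_i}_\lambda u_j\}_H{}_{\,\lambda+\mu}u_k\}_H=0$. A non-local symplectic structure on $\mathcal V$ is a skewadjoint $S=(S_{ij}(\partial))_{i,j\in I}\in\mathrm{Mat}_{\ell\times\ell}\mathcal V(\partial)$ such that in $\mathcal V_{\lambda,\mu}$, for all $i,j,k\in I$: $\langle{u_j}_\lambda\{{u_i}_\mu u_k\}_S\rangle-\langle{u_i}_\mu\{{u_j}_\lambda u_k\}_S\rangle+\langle\{{u_j}_\lambda u_i\}_S{}_{\,\lambda+\mu}u_k\rangle=0$, where $\{{u_j}_\lambda u_i\}_S=S_{ij}(\lambda)$; explicitly, $\sum_{n\in\mathbb Z_+}\big(\frac{\partial S_{ki}(\mu)}{\partial u_j^{(n)}}\lambda^n-\frac{\partial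 S_{kj}(\lambda)}{\partial u_i^{(n)}}\mu^n+(-\lambda-\mu-\partial)^n\frac{\partial S_{ij}(\lambda)}{\partial u_k^{(n)}}\big)=0$. *)

theory Defs
  imports
    "HOL-Analysis.Finite_Cartesian_Product"
    "HOL-Analysis.Cartesian_Space"
    "HOL-Computational_Algebra.Computational_Algebra"
    "HOL-Library.Poly_Mapping"
begin

unbundle no fps_syntax

section \<open>Algebras of differential functions\<close>

text \<open>
  The polynomial algebra \<open>R\<close> in the variables \<open>u\<^sub>i\<^sup>(\<^sup>n\<^sup>)\<close> over \<open>'f\<close>: the variable \<open>u\<^sub>i\<^sup>(\<^sup>n\<^sup>)\<close>
  has index \<open>(i, n)\<close>, and the index set \<open>I\<close> is the finite type \<open>'i\<close>, so that \<open>\<ell> = CARD('i)\<close>.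
\<close>

type_synonym ('f, 'i) diff_poly = "(('i \<times> nat) \<Rightarrow>\<^sub>0 nat) \<Rightarrow>\<^sub>0 'f"

definition dp_const :: "'f::zero \<Rightarrow> ('f, 'i) diff_poly" where
  "dp_const c = Poly_Mapping.single 0 c"

definition dp_var :: "'i \<Rightarrow> nat \<Rightarrow> ('f::zero_neq_one, 'i) diff_poly" where
  "dp_var i n = Poly_Mapping.single (Poly_Mapping.single (i, n) 1) 1"

text \<open>Derivations of an algebra whose scalars act through \<open>\<kappa>\<close>.\<close>

definition derivation_over :: "('f \<Rightarrow> 'v::comm_ring_1) \<Rightarrow> ('v \<Rightarrow> 'v) \<Rightarrow> bool" where
  "derivation_over \<kappa> D \<longleftrightarrow>
     (\<forall>f g. D (f + g) = D f + D g) \<and>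
     (\<forall>c f. D (\<kappa> c * f) = \<kappa> c * D f) \<and>
     (\<forall>f g. D (f * g) = D f * g + f * D g)"

text \<open>
  \<open>\<iota>\<close> embeds \<open>R\<close> into \<open>'v\<close>; its restriction to constants is the \<open>'f\<close>-algebra structure of \<open>'v\<close>.
  \<open>d\<close> is the derivation \<open>\<partial>\<close> and \<open>pd i n\<close> is \<open>\<partial>/\<partial>u\<^sub>i\<^sup>(\<^sup>n\<^sup>)\<close>. Derivations of \<open>R\<close> over \<open>'f\<close> are determined by
  their values on the variables, so the \<open>_var\<close> axioms say that \<open>d\<close> and \<open>pd i n\<close> extend
  the total derivative and the usual partial derivatives of \<open>R\<close>.
\<close>

locale diff_functions =
  fixes \<iota> :: "('f::field_char_0, 'i::finite) diff_poly \<Rightarrow> 'v::comm_ring_1"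
    and d :: "'v \<Rightarrow> 'v"
    and pd :: "'i \<Rightarrow> nat \<Rightarrow> 'v \<Rightarrow> 'v"
  assumes emb_one: "\<iota> 1 = 1"
    and emb_add: "\<iota> (p + q) = \<iota> p + \<iota> q"
    and emb_mult: "\<iota> (p * q) = \<iota> p * \<iota> q"
    and emb_inj: "inj \<iota>"
    and d_derivation: "derivation_over (\<lambda>c. \<iota> (dp_const c)) d"
    and d_var: "d (\<iota> (dp_var i n)) = \<iota> (dp_var i (Suc n))"
    and pd_derivation: "derivation_over (\<lambda>c. \<iota> (dp_const c)) (pd i n)"
    and pd_var: "pd i n (\<iota> (dp_var j m)) = (if i = j \<and> n = m then 1 else 0)"
    and pd_commute: "pd i n (pd j m f) = pd j m (pd i n f)"
    and pd_finite: "finite {(i, n). pd i n f \<noteq> 0}"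
    and pd_d_commutator:
      "pd i n (d f) - d (pd i n f) = (case n of 0 \<Rightarrow> 0 | Suc m \<Rightarrow> pd i m f)"


section \<open>Pseudodifferential operators\<close>

text \<open>
  \<open>\<V>((\<partial>\<^sup>-\<^sup>1))\<close> and \<open>\<V>((\<lambda>\<^sup>-\<^sup>1))\<close> are both represented by \<open>'v fls\<close>: the formal variable is \<open>\<partial>\<^sup>-\<^sup>1\<close>
  (resp. \<open>\<lambda>\<^sup>-\<^sup>1\<close>), and an operator is identified with its symbol. Thus the coefficient of \<open>\<partial>\<^sup>n\<close>
  is the Laurent coefficient of index \<open>-n\<close>. The ring multiplication of \<open>'v fls\<close> is the product of
  symbols; the composition of operators is \<open>psd_mult\<close> below.
\<close>

definition psd_coeff :: "'a::zero fls \<Rightarrow> int \<Rightarrow> 'a" where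
  "psd_coeff A n = fls_nth A (- n)"

definition Psd :: "(int \<Rightarrow> 'a::zero) \<Rightarrow> 'a fls" where
  "Psd f = Abs_fls (\<lambda>k. f (- k))"

lemma psd_coeff_Psd:
  assumes "\<And>n. n > N \<Longrightarrow> f n = 0"
  shows "psd_coeff (Psd f) n = f n"
  unfolding psd_coeff_def Psd_def
  using nth_Abs_fls_lower_bound[of "- N" "\<lambda>k. f (- k)" "- n"] assms by auto

text \<open>An upper bound for the order, exact for nonzero \<open>A\<close>.\<close>

definition psd_order :: "'a::zero fls \<Rightarrow> int" where
  "psd_order A = - fls_subdegree A"

lemma psd_coeff_above_order: "n > psd_order A \<Longrightarrow> psd_coeff A n = 0"
  by (simp add: psd_coeff_def psd_order_def)

definition psd_D :: "nat \<Rightarrow> 'a::comm_ring_1 fls" where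
  "psd_D n = fls_X_inv ^ n"

definition psd_map :: "('a::zero \<Rightarrow> 'b::zero) \<Rightarrow> 'a fls \<Rightarrow> 'b fls" where
  "psd_map h A = Psd (\<lambda>n. h (psd_coeff A n))"

lemma psd_coeff_map: "h 0 = 0 \<Longrightarrow> psd_coeff (psd_map h A) n = h (psd_coeff A n)"
  unfolding psd_map_def
  by (rule psd_coeff_Psd[of "psd_order A"]) (simp add: psd_coeff_above_order)

text \<open>
  The library's \<open>gchoose\<close> at type \<open>int\<close>, spelled out because its sort constraint does not always
  admit that type.
\<close>

definition int_binomial :: "int \<Rightarrow> nat \<Rightarrow> int" where
  "int_binomial m k = (\<Prod>i = 0..<k. m - int i) div fact k"

lemma of_int_int_binomial: "of_int (int_binomial m k) = (of_int m :: 'a::field_char_0) gchoose k"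
  unfolding int_binomial_def gbinomial_prod_rev[where 'a = int, symmetric] by (rule of_int_gbinomial)

text \<open>
  Composition determined by \<open>\<partial>\<^sup>m \<circ> a = (\<Sum>j\<ge>0. binom(m,j) a\<^sup>(\<^sup>j\<^sup>) \<partial>\<^sup>m\<^sup>-\<^sup>j)\<close>. The coefficient of \<open>\<partial>\<^sup>p\<close> collects
  the terms \<open>a\<^sub>m \<partial>\<^sup>m \<circ> b\<^sub>n \<partial>\<^sup>n\<close> with \<open>n = p - m + j\<close>; the summation bounds are those forced by
  \<open>m \<le> psd_order A\<close>, \<open>n \<le> psd_order B\<close> and \<open>j \<ge> 0\<close>. In terms of symbols,
  \<open>(A \<circ> B)(\<lambda>) = A(\<lambda>+\<partial>) B(\<lambda>)\<close> with \<open>(\<lambda>+\<partial>)\<^sup>m\<close> expanded in non-negative powers of \<open>\<partial>\<close>, so \<open>psd_mult d A P\<close>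
  is also the result of applying \<open>A(\<lambda>+\<partial>)\<close> to the Laurent series \<open>P(\<lambda>)\<close>.
\<close>

definition psd_mult :: "('a::comm_ring_1 \<Rightarrow> 'a) \<Rightarrow> 'a fls \<Rightarrow> 'a fls \<Rightarrow> 'a fls" where
  "psd_mult d A B = Psd (\<lambda>p. \<Sum>m = p - psd_order B..psd_order A. \<Sum>j = 0..nat (psd_order B - p + m).
     psd_coeff A m * of_int (int_binomial m j) * (d ^^ j) (psd_coeff B (p - m + int j)))"

lemma psd_coeff_mult:
  "psd_coeff (psd_mult d A B) p =
     (\<Sum>m = p - psd_order B..psd_order A. \<Sum>j = 0..nat (psd_order B - p + m).
        psd_coeff A m * of_int (int_binomial m j) * (d ^^ j) (psd_coeff B (p - m + int j)))"
  unfolding psd_mult_def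
  by (rule psd_coeff_Psd[of "psd_order A + psd_order B"]) simp

definition neg_one_power :: "int \<Rightarrow> 'a::ring_1" where
  "neg_one_power n = (if even n then 1 else - 1)"

text \<open>\<open>(\<Sum>n. a\<^sub>n \<partial>\<^sup>n)\<^sup>* = (\<Sum>n. (-\<partial>)\<^sup>n \<circ> a\<^sub>n)\<close>, with \<open>n = p + j\<close>.\<close>

definition psd_adjoint :: "('a::comm_ring_1 \<Rightarrow> 'a) \<Rightarrow> 'a fls \<Rightarrow> 'a fls" where
  "psd_adjoint d A = Psd (\<lambda>p. \<Sum>j = 0..nat (psd_order A - p).
     neg_one_power (p + int j) * of_int (int_binomial (p + int j) j) * (d ^^ j) (psd_coeff A (p + int j)))"

lemma psd_coeff_adjoint:
  "psd_coeff (psd_adjoint d A) p = (\<Sum>j = 0..nat (psd_order A - p).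
     neg_one_power (p + int j) * of_int (int_binomial (p + int j) j) * (d ^^ j) (psd_coeff A (p + int j)))"
  unfolding psd_adjoint_def
  by (rule psd_coeff_Psd[of "psd_order A"]) (simp add: psd_coeff_above_order)


section \<open>Rational pseudodifferential operators\<close>

text \<open>The extension of the derivation \<open>d\<close> to the field of fractions by the quotient rule.\<close>

definition fract_deriv :: "('v::idom \<Rightarrow> 'v) \<Rightarrow> 'v fract \<Rightarrow> 'v fract" where
  "fract_deriv d x = (THE y. \<exists>a b. b \<noteq> 0 \<and> x = Fract a b \<and> y = Fract (d a * b - a * d b) (b * b))"

lemma fract_deriv_Fract:
  assumes leibniz: "\<And>f g. d (f * g) = d f * g + f * d g" and "b \<noteq> 0"
  shows "fract_deriv d (Fract a b) = Fract (d a * b - a * d b) (b * b)"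
  unfolding fract_deriv_def
proof (rule the_equality)
  fix y assume "\<exists>a' b'. b' \<noteq> 0 \<and> Fract a b = Fract a' b' \<and> y = Fract (d a' * b' - a' * d b') (b' * b')"
  then obtain a' b' where *: "b' \<noteq> 0" "Fract a b = Fract a' b'"
    and y: "y = Fract (d a' * b' - a' * d b') (b' * b')" by blast
  have e: "a * b' = a' * b" using * \<open>b \<noteq> 0\<close> by (simp add: eq_fract)
  have de: "d a * b' + a * d b' = d a' * b + a' * d b" using arg_cong[OF e, of d] by (simp add: leibniz)
  have "(d a' * b' - a' * d b') * (b * b) = (d a * b - a * d b) * (b' * b')"
    using e de by algebra
  then show "y = Fract (d a * b - a * d b) (b * b)"
    unfolding y using * \<open>b \<noteq> 0\<close> by (simp add: eq_fract)
qed (use \<open>b \<noteq> 0\<close> in blast)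

text \<open>Subskewfields of \<open>\<K>((\<partial>\<^sup>-\<^sup>1))\<close>, where \<open>d\<close> is the derivation of \<open>\<K>\<close>.\<close>

definition psd_subskewfield :: "('k::field \<Rightarrow> 'k) \<Rightarrow> 'k fls set \<Rightarrow> bool" where
  "psd_subskewfield d Q \<longleftrightarrow>
     1 \<in> Q \<and> (\<forall>A\<in>Q. \<forall>B\<in>Q. A - B \<in> Q \<and> psd_mult d A B \<in> Q) \<and>
     (\<forall>A\<in>Q. A \<noteq> 0 \<longrightarrow> (\<exists>B\<in>Q. psd_mult d A B = 1 \<and> psd_mult d B A = 1))"

definition differential_operators :: "'v::zero fls set" where
  "differential_operators = {A. \<forall>n<0. psd_coeff A n = 0}"

definition rational_psd_fract :: "('v::idom \<Rightarrow> 'v) \<Rightarrow> 'v fract fls set" where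
  "rational_psd_fract d =
     \<Inter> {Q. psd_subskewfield (fract_deriv d) Q \<and> psd_map to_fract ` differential_operators \<subseteq> Q}"

definition rational_psd :: "('v::idom \<Rightarrow> 'v) \<Rightarrow> 'v fls set" where
  "rational_psd d = {A. psd_map to_fract A \<in> rational_psd_fract d}"


section \<open>Matrix pseudodifferential operators\<close>

definition psd_mat_mult ::
  "('a::comm_ring_1 \<Rightarrow> 'a) \<Rightarrow> 'a fls ^ 'i ^ 'i \<Rightarrow> 'a fls ^ 'i ^ 'i \<Rightarrow> 'a fls ^ 'i::finite ^ 'i" where
  "psd_mat_mult d A B = (\<chi> i j. \<Sum>k\<in>UNIV. psd_mult d (A $ i $ k) (B $ k $ j))"

definition psd_mat_adjoint :: "('a::comm_ring_1 \<Rightarrow> 'a) \<Rightarrow> 'a fls ^ 'i ^ 'i \<Rightarrow> 'a fls ^ 'i::finite ^ 'i" where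
  "psd_mat_adjoint d A = (\<chi> i j. psd_adjoint d (A $ j $ i))"

definition psd_mat_skewadjoint :: "('a::comm_ring_1 \<Rightarrow> 'a) \<Rightarrow> 'a fls ^ 'i ^ 'i::finite \<Rightarrow> bool" where
  "psd_mat_skewadjoint d A \<longleftrightarrow> psd_mat_adjoint d A = - A"

definition rational_psd_mat :: "('v::idom \<Rightarrow> 'v) \<Rightarrow> ('v fls ^ 'i ^ 'i::finite) set" where
  "rational_psd_mat d = {A. \<forall>i j. A $ i $ j \<in> rational_psd d}"

definition rational_mat_is_inverse ::
  "('v::idom \<Rightarrow> 'v) \<Rightarrow> 'v fls ^ 'i ^ 'i \<Rightarrow> 'v fls ^ 'i ^ 'i::finite \<Rightarrow> bool" where
  "rational_mat_is_inverse d A B \<longleftrightarrow>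
     B \<in> rational_psd_mat d \<and> psd_mat_mult d A B = mat 1 \<and> psd_mat_mult d B A = mat 1"

definition rational_mat_invertible :: "('v::idom \<Rightarrow> 'v) \<Rightarrow> 'v fls ^ 'i ^ 'i::finite \<Rightarrow> bool" where
  "rational_mat_invertible d A \<longleftrightarrow> (\<exists>B. rational_mat_is_inverse d A B)"

text \<open>Meaningful for invertible \<open>A\<close>; the inverse is then unique since composition is associative.\<close>

definition rational_mat_inverse :: "('v::idom \<Rightarrow> 'v) \<Rightarrow> 'v fls ^ 'i ^ 'i \<Rightarrow> 'v fls ^ 'i ^ 'i::finite" where
  "rational_mat_inverse d A = (SOME B. rational_mat_is_inverse d A B)"


section \<open>Lambda brackets\<close>

text \<open>
  \<open>lambda_bracket d pd H f g\<close> is \<open>{f\<^sub>\<lambda> g}\<^sub>H \<in> \<V>((\<lambda>\<^sup>-\<^sup>1))\<close>. The operators \<open>(\<lambda>+\<partial>)\<^sup>n\<close>, \<open>H\<^sub>j\<^sub>i(\<lambda>+\<partial>)\<close>,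
  \<open>(-\<lambda>-\<partial>)\<^sup>m\<close> act on everything to their right, each through \<open>psd_mult d\<close>.
\<close>

definition lambda_bracket ::
  "('v::comm_ring_1 \<Rightarrow> 'v) \<Rightarrow> ('i \<Rightarrow> nat \<Rightarrow> 'v \<Rightarrow> 'v) \<Rightarrow> 'v fls ^ 'i ^ 'i::finite \<Rightarrow> 'v \<Rightarrow> 'v \<Rightarrow> 'v fls" where
  "lambda_bracket d pd H f g =
     (\<Sum>i\<in>UNIV. \<Sum>j\<in>UNIV. \<Sum>m\<in>{m. pd i m f \<noteq> 0}. \<Sum>n\<in>{n. pd j n g \<noteq> 0}.
        fls_const (pd j n g) *
          psd_mult d (psd_D n) (psd_mult d (H $ j $ i)
            (psd_mult d ((- 1) ^ m * psd_D m) (fls_const (pd i m f)))))"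

text \<open>The Beltrami bracket \<open>\<langle>f\<^sub>\<lambda> g\<rangle>\<close>, an element of \<open>\<V>[\<lambda>] \<subseteq> \<V>((\<lambda>\<^sup>-\<^sup>1))\<close>.\<close>

definition beltrami_bracket ::
  "('v::comm_ring_1 \<Rightarrow> 'v) \<Rightarrow> ('i::finite \<Rightarrow> nat \<Rightarrow> 'v \<Rightarrow> 'v) \<Rightarrow> 'v \<Rightarrow> 'v \<Rightarrow> 'v fls" where
  "beltrami_bracket d pd f g =
     (\<Sum>i\<in>UNIV. \<Sum>m\<in>{m. pd i m f \<noteq> 0}. \<Sum>n\<in>{n. pd i n g \<noteq> 0}.
        (- 1) ^ m * fls_const (pd i n g) * psd_mult d (psd_D (m + n)) (fls_const (pd i m f)))"


section \<open>The space \<open>\<V>\<^sub>\<lambda>\<^sub>,\<^sub>\<mu>\<close>\<close>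

text \<open>
  \<open>\<V>[[\<lambda>\<^sup>-\<^sup>1,\<mu>\<^sup>-\<^sup>1,\<nu>\<^sup>-\<^sup>1]][\<lambda>,\<mu>,\<nu>]\<close>: \<open>F a b c\<close> is the coefficient of \<open>\<lambda>\<^sup>a \<mu>\<^sup>b \<nu>\<^sup>c\<close>.
\<close>

definition laurent3 :: "(int \<Rightarrow> int \<Rightarrow> int \<Rightarrow> 'v::zero) set" where
  "laurent3 = {F. \<exists>N. \<forall>a b c. F a b c \<noteq> 0 \<longrightarrow> a \<le> N \<and> b \<le> N \<and> c \<le> N}"

text \<open>
  The image of multiplication by \<open>\<nu> - \<lambda> - \<mu>\<close>. An element of \<open>\<V>\<^sub>\<lambda>\<^sub>,\<^sub>\<mu>\<close> is given by a representative
  in \<open>laurent3\<close>, and it is zero iff the representative lies in this set.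
\<close>

definition vlm_null :: "(int \<Rightarrow> int \<Rightarrow> int \<Rightarrow> 'v::comm_ring_1) set" where
  "vlm_null = (\<lambda>W a b c. W a b (c - 1) - W (a - 1) b c - W a (b - 1) c) ` laurent3"

text \<open>
  The embeddings of \<open>\<V>\<^sub>\<lambda>\<^sub>,\<^sub>\<mu>\<close>, on representatives. An element of \<open>\<V>((x\<^sup>-\<^sup>1))((y\<^sup>-\<^sup>1))\<close> has type
  \<open>'v fls fls\<close>, with the outer series in \<open>y\<^sup>-\<^sup>1\<close>. The sums below are finite for \<open>F \<in> laurent3\<close>.

  Into \<open>\<V>((\<lambda>\<^sup>-\<^sup>1))((\<mu>\<^sup>-\<^sup>1))\<close>: \<open>\<nu>\<^sup>c = (\<Sum>k\<ge>0. binom(c,k) \<lambda>\<^sup>k \<mu>\<^sup>c\<^sup>-\<^sup>k)\<close>.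
\<close>

definition vlm_expand_lambda_mu :: "(int \<Rightarrow> int \<Rightarrow> int \<Rightarrow> 'v::comm_ring_1) \<Rightarrow> 'v fls fls" where
  "vlm_expand_lambda_mu F = Psd (\<lambda>q. Psd (\<lambda>p.
     \<Sum>(c, k) \<in> {(c, k). F (p - int k) (q - c + int k) c \<noteq> 0}.
        of_int (int_binomial c k) * F (p - int k) (q - c + int k) c))"

text \<open>Into \<open>\<V>((\<mu>\<^sup>-\<^sup>1))((\<lambda>\<^sup>-\<^sup>1))\<close>: \<open>\<nu>\<^sup>c = (\<Sum>k\<ge>0. binom(c,k) \<mu>\<^sup>k \<lambda>\<^sup>c\<^sup>-\<^sup>k)\<close>.\<close>

definition vlm_expand_mu_lambda :: "(int \<Rightarrow> int \<Rightarrow> int \<Rightarrow> 'v::comm_ring_1) \<Rightarrow> 'v fls fls" where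
  "vlm_expand_mu_lambda F = Psd (\<lambda>p. Psd (\<lambda>q.
     \<Sum>(c, k) \<in> {(c, k). F (p - c + int k) (q - int k) c \<noteq> 0}.
        of_int (int_binomial c k) * F (p - c + int k) (q - int k) c))"

text \<open>
  Into \<open>\<V>((\<nu>\<^sup>-\<^sup>1))((\<lambda>\<^sup>-\<^sup>1))\<close>, \<open>\<nu> = \<lambda> + \<mu>\<close>: \<open>\<mu>\<^sup>b = (\<nu> - \<lambda>)\<^sup>b = (\<Sum>k\<ge>0. binom(b,k) \<nu>\<^sup>k (-\<lambda>)\<^sup>b\<^sup>-\<^sup>k)\<close>.
\<close>

definition vlm_expand_nu_lambda :: "(int \<Rightarrow> int \<Rightarrow> int \<Rightarrow> 'v::comm_ring_1) \<Rightarrow> 'v fls fls" where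
  "vlm_expand_nu_lambda F = Psd (\<lambda>p. Psd (\<lambda>r.
     \<Sum>(b, k) \<in> {(b, k). F (p - b + int k) b (r - int k) \<noteq> 0}.
        neg_one_power (b - int k) * of_int (int_binomial b k) * F (p - b + int k) b (r - int k)))"

lemma vlm_finite_aux:
  fixes N s :: int
  assumes "\<And>c k. (c, k) \<in> A \<Longrightarrow> c \<le> N \<and> s - c + int k \<le> N"
  shows "finite A"
proof (rule finite_subset)
  show "A \<subseteq> {s - N..N} \<times> {0..nat (2 * N - s)}"
    using assms by force
qed simp

lemma psd_coeff_Psd_Psd:
  fixes f :: "int \<Rightarrow> int \<Rightarrow> 'a::zero"
  assumes "\<And>s t. s > 2 * N \<Longrightarrow> f s t = 0" and "\<And>s t. t > 3 * N - s \<Longrightarrow> f s t = 0"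
  shows "psd_coeff (psd_coeff (Psd (\<lambda>s. Psd (f s))) s) t = f s t"
proof -
  have inner: "psd_coeff (Psd (f s)) t = f s t" for s t
    by (rule psd_coeff_Psd[of "3 * N - s"]) (rule assms(2))
  have "psd_coeff (Psd (\<lambda>s. Psd (f s))) s = Psd (f s)"
  proof (rule psd_coeff_Psd[of "2 * N"])
    fix s assume "s > 2 * N"
    then have "f s = (\<lambda>_. 0)" using assms(1) by blast
    then show "Psd (f s) = 0" by (simp add: Psd_def zero_fls_def)
  qed
  with inner show ?thesis by simp
qed

lemma psd_coeff_vlm_expand:
  assumes "F \<in> laurent3"
  shows "psd_coeff (psd_coeff (vlm_expand_lambda_mu F) q) p =
      (\<Sum>(c, k) \<in> {(c, k). F (p - int k) (q - c + int k) c \<noteq> 0}.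
         of_int (int_binomial c k) * F (p - int k) (q - c + int k) c)" (is ?A)
    and "psd_coeff (psd_coeff (vlm_expand_mu_lambda F) p) q =
      (\<Sum>(c, k) \<in> {(c, k). F (p - c + int k) (q - int k) c \<noteq> 0}.
         of_int (int_binomial c k) * F (p - c + int k) (q - int k) c)" (is ?B)
    and "psd_coeff (psd_coeff (vlm_expand_nu_lambda F) p) r =
      (\<Sum>(b, k) \<in> {(b, k). F (p - b + int k) b (r - int k) \<noteq> 0}.
         neg_one_power (b - int k) * of_int (int_binomial b k) * F (p - b + int k) b (r - int k))" (is ?C)
    and "finite {(c, k). F (p - int k) (q - c + int k) c \<noteq> 0}"
    and "finite {(c, k). F (p - c + int k) (q - int k) c \<noteq> 0}"
    and "finite {(b, k). F (p - b + int k) b (r - int k) \<noteq> 0}"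
proof -
  obtain N where N: "\<And>a b c. F a b c \<noteq> 0 \<Longrightarrow> a \<le> N \<and> b \<le> N \<and> c \<le> N"
    using assms by (auto simp: laurent3_def)
  show ?A unfolding vlm_expand_lambda_mu_def
    by (rule psd_coeff_Psd_Psd[of N]) (fastforce intro!: sum.neutral dest!: N)+
  show ?B unfolding vlm_expand_mu_lambda_def
    by (rule psd_coeff_Psd_Psd[of N]) (fastforce intro!: sum.neutral dest!: N)+
  show ?C unfolding vlm_expand_nu_lambda_def
    by (rule psd_coeff_Psd_Psd[of N]) (fastforce intro!: sum.neutral dest!: N)+
  show "finite {(c, k). F (p - int k) (q - c + int k) c \<noteq> 0}"
    by (rule vlm_finite_aux[of _ N q]) (use N in auto)
  show "finite {(c, k). F (p - c + int k) (q - int k) c \<noteq> 0}"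
    by (rule vlm_finite_aux[of _ N p]) (use N in auto)
  show "finite {(b, k). F (p - b + int k) b (r - int k) \<noteq> 0}"
    by (rule vlm_finite_aux[of _ N p]) (use N in auto)
qed

text \<open>
  For \<open>T\<^sub>1 \<in> \<V>((\<lambda>\<^sup>-\<^sup>1))((\<mu>\<^sup>-\<^sup>1))\<close>, \<open>T\<^sub>2 \<in> \<V>((\<mu>\<^sup>-\<^sup>1))((\<lambda>\<^sup>-\<^sup>1))\<close> and \<open>T\<^sub>3 \<in> \<V>((\<nu>\<^sup>-\<^sup>1))((\<lambda>\<^sup>-\<^sup>1))\<close>, the identity
  \<open>T\<^sub>1 - T\<^sub>2 + T\<^sub>3 = 0\<close> in \<open>\<V>\<^sub>\<lambda>\<^sub>,\<^sub>\<mu>\<close>: the three series are the expansions of elements of \<open>\<V>\<^sub>\<lambda>\<^sub>,\<^sub>\<mu>\<close>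
  with representatives \<open>X\<close>, \<open>Y\<close>, \<open>Z\<close>, whose signed sum is zero in \<open>\<V>\<^sub>\<lambda>\<^sub>,\<^sub>\<mu>\<close>.
\<close>

definition vlm_identity :: "'v::comm_ring_1 fls fls \<Rightarrow> 'v fls fls \<Rightarrow> 'v fls fls \<Rightarrow> bool" where
  "vlm_identity T1 T2 T3 \<longleftrightarrow>
     (\<exists>X\<in>laurent3. \<exists>Y\<in>laurent3. \<exists>Z\<in>laurent3.
        vlm_expand_lambda_mu X = T1 \<and> vlm_expand_mu_lambda Y = T2 \<and> vlm_expand_nu_lambda Z = T3 \<and>
        (\<lambda>a b c. X a b c - Y a b c + Z a b c) \<in> vlm_null)"


section \<open>Non-local Hamiltonian and symplectic structures\<close>

text \<open>
  \<open>u i\<close> is the generator \<open>u\<^sub>i\<close>. A bracket with a Laurent series is taken coefficientwise by \<open>psd_map\<close>.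
  In the third term of each identity the inner bracket is a series in \<open>\<lambda>\<close> and the outer bracket of
  each of its coefficients is a series in \<open>\<nu> = \<lambda> + \<mu>\<close>.
\<close>

definition nonlocal_hamiltonian ::
  "('v::idom \<Rightarrow> 'v) \<Rightarrow> ('i \<Rightarrow> nat \<Rightarrow> 'v \<Rightarrow> 'v) \<Rightarrow> ('i \<Rightarrow> 'v) \<Rightarrow> 'v fls ^ 'i ^ 'i::finite \<Rightarrow> bool" where
  "nonlocal_hamiltonian d pd u H \<longleftrightarrow>
     H \<in> rational_psd_mat d \<and> psd_mat_skewadjoint d H \<and>
     (\<forall>i j k. vlm_identity
        (psd_map (\<lambda>g. lambda_bracket d pd H (u i) g) (lambda_bracket d pd H (u j) (u k)))
        (psd_map (\<lambda>g. lambda_bracket d pd H (u j) g) (lambda_bracket d pd H (u i) (u k)))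
        (- psd_map (\<lambda>f. lambda_bracket d pd H f (u k)) (lambda_bracket d pd H (u i) (u j))))"

definition nonlocal_symplectic ::
  "('v::idom \<Rightarrow> 'v) \<Rightarrow> ('i \<Rightarrow> nat \<Rightarrow> 'v \<Rightarrow> 'v) \<Rightarrow> ('i \<Rightarrow> 'v) \<Rightarrow> 'v fls ^ 'i ^ 'i::finite \<Rightarrow> bool" where
  "nonlocal_symplectic d pd u S \<longleftrightarrow>
     S \<in> rational_psd_mat d \<and> psd_mat_skewadjoint d S \<and>
     (\<forall>i j k. vlm_identity
        (psd_map (\<lambda>g. beltrami_bracket d pd (u j) g) (lambda_bracket d pd S (u i) (u k)))
        (psd_map (\<lambda>g. beltrami_bracket d pd (u i) g) (lambda_bracket d pd S (u j) (u k)))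
        (psd_map (\<lambda>f. beltrami_bracket d pd f (u k)) (lambda_bracket d pd S (u j) (u i))))"

end

theory Submission
  imports Defs "HOL-Library.Function_Algebras"
begin

text \<open>
  Let \<open>H = S\<^sup>-\<^sup>1\<close>. Applying the Beltrami bracket with \<open>u\<^sub>l\<close> to \<open>S \<circ> H = 1\<close> gives
  \<open>\<langle>u\<^sub>l \<^sub>\<lambda> H(\<mu>)\<rangle> = - H(\<lambda>+\<mu>+\<partial>) \<langle>u\<^sub>l \<^sub>\<lambda> S(\<mu>+\<partial>)\<rangle> H(\<mu>)\<close>. Hence, up to sign, each term of the Jacobi
  identity for \<open>H\<close> arises from the corresponding term of the symplectic identity for \<open>S\<close> by letting
  \<open>H\<close> act on the three slots \<open>\<lambda>\<close>, \<open>\<mu>\<close> and \<open>\<nu> = \<lambda>+\<mu>\<close>. These three actions commute, are inverted by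
  the actions of \<open>S\<close>, and lift to the representatives in \<open>\<V>\<^sub>\<lambda>\<^sub>,\<^sub>\<mu>\<close> compatibly with all three
  expansions, so that each identity can be transported to the other. The third term is the adjoint,
  in \<open>\<nu>\<close>, of the second one with permuted indices.

  The underlying operator identities need to be checked on constants only, since they persist under
  multiplication by the (invertible) variables and under limits.
\<close>

section \<open>Composition and adjoint of pseudodifferential operators\<close>

text \<open>The three terms of an identity live in different rings of iterated series, so the action
  of a non-local operator on a slot has to be defined on representatives and then recognised in
  every expansion. Only the action on the \<nu>-slot can be written down directly: there the
  operator stands on the left and \<partial> differentiates everything. In the other slots
  \<partial> sees the operator but not the representative. The substitution \<open>theta\<close>
  reverses the order of composition, so it turns the \<nu>-action into the \<mu>-action; exchanging
  \<lambda> and \<mu> then gives the last one. Over series in \<lambda>, two maps play the role of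
  \<partial>: the coefficientwise derivation, and \<lambda>+\<partial>, which obeys a Leibniz rule
  mixed with the former. Associativity and the rule for adjoints are therefore proved for several
  additive maps linked by such a rule. That the \<mu>- and \<nu>-slots commute is then an instance
  of associativity, and passing between them an instance of the rule for adjoints.\<close>

lemma int_binomial_0 [simp]: "int_binomial m 0 = 1"
  by (simp add: int_binomial_def)

lemma int_binomial_0_Suc [simp]: "int_binomial 0 (Suc k) = 0"
proof -
  have "(of_int (int_binomial 0 (Suc k)) :: rat) = 0"
    by (simp add: of_int_int_binomial)
  then show ?thesis by simp
qed

lemma int_binomial_zero: "int_binomial 0 k = (if k = 0 then 1 else 0)"
  by (cases k) auto

text \<open>Derived over the rationals, since \<open>int_binomial\<close> is an integer division.
  Together with the values at 0, Pascal's rule is all that the coefficient computations below use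
  about binomials.\<close>

lemma int_binomial_Suc: "int_binomial (m + 1) (Suc k) = int_binomial m (Suc k) + int_binomial m k"
proof -
  have "(of_int (int_binomial (m + 1) (Suc k)) :: rat)
      = of_int (int_binomial m (Suc k) + int_binomial m k)"
    by (simp add: of_int_int_binomial gbinomial_Suc_Suc)
  then show ?thesis by (simp only: of_int_eq_iff)
qed

lemma psd_coeff_simps [simp]:
  "psd_coeff 0 n = 0"
  "psd_coeff (A + B) n = psd_coeff A n + psd_coeff B n"
  "psd_coeff (fls_const a) n = (if n = 0 then a else 0)"
  "psd_coeff (1 :: 'a::comm_ring_1 fls) n = (if n = 0 then 1 else 0)"
  for A B :: "'b::monoid_add fls"
  by (simp_all add: psd_coeff_def)

lemma psd_coeff_ring_simps [simp]:
  fixes A B :: "'a::comm_ring_1 fls"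
  shows "psd_coeff (- A) n = - psd_coeff A n"
    and "psd_coeff (A - B) n = psd_coeff A n - psd_coeff B n"
    and "psd_coeff (fls_const a * A) n = a * psd_coeff A n"
    and "psd_coeff (fls_X_inv * A) n = psd_coeff A (n - 1)"
    and "psd_coeff (fls_X * A) n = psd_coeff A (n + 1)"
  by (simp_all add: psd_coeff_def fls_X_inv_times_conv_shift fls_X_times_conv_shift algebra_simps)

lemma psd_coeff_sum: "psd_coeff (\<Sum>x\<in>I. f x) n = (\<Sum>x\<in>I. psd_coeff (f x) n)"
  by (induction I rule: infinite_finite_induct) auto

lemma psd_coeff_of_int_mult [simp]:
  "psd_coeff (of_int k * A) n = of_int k * psd_coeff A n" for A :: "'a::comm_ring_1 fls"
  by (metis fls_of_int psd_coeff_ring_simps(3))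

lemma psd_eqI: "(\<And>n. psd_coeff A n = psd_coeff B n) \<Longrightarrow> A = B"
  unfolding psd_coeff_def by (metis fls_eqI minus_minus)

lemma Psd_psd_coeff [simp]: "Psd (psd_coeff A) = A"
  by (rule psd_eqI, rule psd_coeff_Psd[of "psd_order A"]) (simp add: psd_coeff_above_order)

section \<open>Order bounds and composition over a common summation range\<close>

definition psd_le :: "int \<Rightarrow> 'a::zero fls \<Rightarrow> bool" where
  "psd_le s A \<longleftrightarrow> (\<forall>n>s. psd_coeff A n = 0)"

lemma psd_leD: "psd_le s A \<Longrightarrow> n > s \<Longrightarrow> psd_coeff A n = 0"
  by (simp add: psd_le_def)

lemma psd_le_mono: "psd_le s A \<Longrightarrow> s \<le> t \<Longrightarrow> psd_le t A"
  by (simp add: psd_le_def)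

lemma psd_le_order: "psd_le (psd_order A) A"
  by (simp add: psd_le_def psd_coeff_above_order)

lemma psd_order_le: "psd_le s A \<Longrightarrow> A \<noteq> 0 \<Longrightarrow> psd_order A \<le> s"
  unfolding psd_le_def psd_order_def psd_coeff_def
  by (metis fls_subdegree_ge0I neg_le_iff_le nth_fls_subdegree_nonzero minus_minus not_le)

lemma additive_funpow: "additive \<delta> \<Longrightarrow> additive (\<delta> ^^ j)" for \<delta> :: "'a::ab_group_add \<Rightarrow> 'a"
  by (induction j) (simp_all add: additive_def)

lemma additive_of_int:
  fixes \<delta> :: "'a::comm_ring_1 \<Rightarrow> 'b::comm_ring_1"
  assumes "additive \<delta>"
  shows "\<delta> (of_int k * x) = of_int k * \<delta> x"
proof -
  interpret additive \<delta> by fact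
  have nat: "\<delta> (of_nat n * x) = of_nat n * \<delta> x" for n
    by (induction n) (simp_all add: zero add algebra_simps)
  show ?thesis
    by (cases k) (auto simp: nat minus simp del: of_nat_Suc)
qed

text \<open>The defining sums run up to the exact orders of the factors, which differ from one
  product to the next. Over any larger range the extra terms vanish, so products sharing a box can
  be compared term by term.\<close>

lemma psd_coeff_mult_box:
  fixes A B :: "'a::comm_ring_1 fls"
  assumes \<delta>: "additive \<delta>" and A: "psd_le h A" and B: "psd_le s B"
    and l: "l \<le> p - s" and K: "int K \<ge> s - p + h"
  shows "psd_coeff (psd_mult \<delta> A B) p =
    (\<Sum>m = l..h. \<Sum>j\<le>K. psd_coeff A m * of_int (int_binomial m j) * (\<delta> ^^ j) (psd_coeff B (p - m + int j)))"
    (is "_ = (\<Sum>m = l..h. \<Sum>j\<le>K. ?t m j)")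
proof (cases "A = 0 \<or> B = 0")
  \<comment> \<open>The order of 0 is 0 by default and need not respect the given bounds, so a zero
    factor is treated apart.\<close>
  case True
  have "?t m j = 0" for m j
    using True additive.zero[OF additive_funpow[OF \<delta>]] by auto
  then show ?thesis unfolding psd_coeff_mult by simp
next
  case False
  then have A': "psd_order A \<le> h" and B': "psd_order B \<le> s" using A B psd_order_le by auto
  have z: "?t m j = 0" if "m > psd_order A \<or> p - m + int j > psd_order B" for m j
    using that additive.zero[OF additive_funpow[OF \<delta>]] by (auto simp: psd_coeff_above_order)
  have "psd_coeff (psd_mult \<delta> A B) p =
    (\<Sum>m = p - psd_order B..psd_order A. \<Sum>j = 0..nat (psd_order B - p + m). ?t m j)"
    by (rule psd_coeff_mult)
  also have "\<dots> = (\<Sum>m = p - psd_order B..psd_order A. \<Sum>j\<le>K. ?t m j)"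
    using A' B' K by (intro sum.cong sum.mono_neutral_left refl) (auto intro!: z)
  also have "\<dots> = (\<Sum>m = l..h. \<Sum>j\<le>K. ?t m j)"
    using A' B' l by (intro sum.mono_neutral_left) (auto intro!: sum.neutral z)
  finally show ?thesis .
qed

lemma psd_mult_le:
  assumes "additive \<delta>" "psd_le h A" "psd_le s B"
  shows "psd_le (h + s) (psd_mult \<delta> A B)"
  unfolding psd_le_def
proof (intro allI impI)
  fix p assume "p > h + s"
  then show "psd_coeff (psd_mult \<delta> A B) p = 0"
    \<comment> \<open>For \<open>l = p - s\<close>, which exceeds \<open>h\<close>, the range of
      \<open>m\<close> is empty.\<close>
    by (subst psd_coeff_mult_box[OF assms, of "p - s" p 0]) auto
qed

lemma psd_le_add: "psd_le s A \<Longrightarrow> psd_le s B \<Longrightarrow> psd_le s (A + B)" for A :: "'a::monoid_add fls"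
  by (simp add: psd_le_def)

lemma psd_le_bound2:
  fixes A B :: "'a::zero fls"
  obtains s where "psd_le s A" "psd_le s B"
  using psd_le_mono[OF psd_le_order, of A "max (psd_order A) (psd_order B)"]
    psd_le_mono[OF psd_le_order, of B "max (psd_order A) (psd_order B)"] by auto

lemma psd_mult_additive_right: "additive \<delta> \<Longrightarrow> additive (psd_mult \<delta> A)" for \<delta> :: "'a::comm_ring_1 \<Rightarrow> 'a"
proof (unfold_locales, rule psd_eqI)
  fix B C :: "'a fls" and n assume \<delta>: "additive \<delta>"
  obtain s where s: "psd_le s B" "psd_le s C" by (rule psd_le_bound2[of B C])
  let ?h = "psd_order A" let ?K = "nat (s - n + ?h)"
  note * = psd_coeff_mult_box[OF \<delta> psd_le_order[of A] _ order_refl, of s _ n ?K]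
  show "psd_coeff (psd_mult \<delta> A (B + C)) n = psd_coeff (psd_mult \<delta> A B + psd_mult \<delta> A C) n"
    using s psd_le_add[OF s] additive.add[OF additive_funpow[OF \<delta>]]
    by (simp add: * algebra_simps sum.distrib)
qed

lemma psd_mult_additive_left: "additive \<delta> \<Longrightarrow> additive (\<lambda>A. psd_mult \<delta> A B)" for \<delta> :: "'a::comm_ring_1 \<Rightarrow> 'a"
proof (unfold_locales, rule psd_eqI)
  fix A C :: "'a fls" and n assume \<delta>: "additive \<delta>"
  obtain h where h: "psd_le h A" "psd_le h C" by (rule psd_le_bound2[of A C])
  let ?s = "psd_order B" let ?K = "nat (?s - n + h)"
  note * = psd_coeff_mult_box[OF \<delta> _ psd_le_order[of B] order_refl, of h _ n ?K]
  show "psd_coeff (psd_mult \<delta> (A + C) B) n = psd_coeff (psd_mult \<delta> A B + psd_mult \<delta> C B) n"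
    using h psd_le_add[OF h]
    by (simp add: * algebra_simps sum.distrib)
qed

lemma psd_le_const: "psd_le 0 (fls_const a)"
  by (simp add: psd_le_def)

lemma psd_mult_const_mult:
  assumes \<delta>: "additive \<delta>"
  shows "psd_mult \<delta> (fls_const a * A) B = fls_const a * psd_mult \<delta> A B"
proof (rule psd_eqI)
  fix n
  have h: "psd_le (psd_order A) A" "psd_le (psd_order A) (fls_const a * A)"
    by (auto simp: psd_le_def psd_coeff_above_order)
  let ?s = "psd_order B" let ?K = "nat (?s - n + psd_order A)"
  note * = psd_coeff_mult_box[OF \<delta> _ psd_le_order[of B] order_refl, of "psd_order A" _ n ?K]
  show "psd_coeff (psd_mult \<delta> (fls_const a * A) B) n = psd_coeff (fls_const a * psd_mult \<delta> A B) n"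
    using h by (simp add: * sum_distrib_left mult.assoc)
qed

lemma psd_mult_one [simp]:
  assumes \<delta>: "additive \<delta>"
  shows "psd_mult \<delta> 1 B = B"
proof (rule psd_eqI)
  fix n
  have 1: "psd_le 0 (1 :: 'a fls)" by (simp add: psd_le_def)
  let ?l = "min (n - psd_order B) 0" let ?K = "nat (psd_order B - n)"
  have "psd_coeff (psd_mult \<delta> 1 B) n =
    (\<Sum>m = ?l..0. \<Sum>j\<le>?K. psd_coeff 1 m * of_int (int_binomial m j) * (\<delta> ^^ j) (psd_coeff B (n - m + int j)))"
    by (rule psd_coeff_mult_box[OF \<delta> 1 psd_le_order]) auto
  also have "\<dots> = (\<Sum>m \<in> {0}. \<Sum>j\<le>?K. psd_coeff 1 m * of_int (int_binomial m j) * (\<delta> ^^ j) (psd_coeff B (n - m + int j)))"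
    by (rule sum.mono_neutral_right) auto
  also have "\<dots> = (\<Sum>j\<le>?K. of_int (int_binomial 0 j) * (\<delta> ^^ j) (psd_coeff B (n + int j)))"
    by simp
  also have "\<dots> = (\<Sum>j\<in>{0}. of_int (int_binomial 0 j) * (\<delta> ^^ j) (psd_coeff B (n + int j)))"
  proof (rule sum.mono_neutral_right)
    show "\<forall>i\<in>{..?K} - {0}. of_int (int_binomial 0 i) * (\<delta> ^^ i) (psd_coeff B (n + int i)) = 0"
      by (auto simp: int_binomial_zero)
  qed auto
  finally show "psd_coeff (psd_mult \<delta> 1 B) n = psd_coeff B n" by simp
qed

lemma psd_mult_const [simp]:
  "additive \<delta> \<Longrightarrow> psd_mult \<delta> (fls_const a) B = fls_const a * B"
  using psd_mult_const_mult[of \<delta> a 1 B] by simp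

section \<open>Left composition with \<partial>, its inverse, and induction on operators\<close>

definition psd_up :: "('a::comm_ring_1 \<Rightarrow> 'a) \<Rightarrow> 'a fls \<Rightarrow> 'a fls" where
  "psd_up \<delta> B = fls_X_inv * B + psd_map \<delta> B"

lemma psd_coeff_map_additive [simp]: "additive h \<Longrightarrow> psd_coeff (psd_map h A) n = h (psd_coeff A n)"
  by (intro psd_coeff_map additive.zero)

lemma psd_map_additive: "additive h \<Longrightarrow> additive (psd_map h)"
  by unfold_locales (auto intro!: psd_eqI simp: additive.add)

lemma psd_le_map: "additive h \<Longrightarrow> psd_le s A \<Longrightarrow> psd_le s (psd_map h A)"
  by (simp add: psd_le_def additive.zero)

lemma psd_le_X_inv: "psd_le s A \<Longrightarrow> psd_le (s + 1) (fls_X_inv * A)" for A :: "'a::comm_ring_1 fls"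
  by (simp add: psd_le_def)

lemma psd_up_additive: "additive \<delta> \<Longrightarrow> additive (psd_up \<delta>)"
  using psd_map_additive[of \<delta>] by (simp add: additive_def psd_up_def algebra_simps)

lemma psd_le_up: "additive \<delta> \<Longrightarrow> psd_le s A \<Longrightarrow> psd_le (s + 1) (psd_up \<delta> A)"
  unfolding psd_up_def by (intro psd_le_add psd_le_X_inv psd_le_mono[OF psd_le_map]) auto

lemma psd_mult_X_inv_right:
  assumes \<delta>: "additive \<delta>"
  shows "psd_mult \<delta> A (fls_X_inv * B) = fls_X_inv * psd_mult \<delta> A B"
proof (rule psd_eqI)
  fix n
  let ?s = "psd_order B" let ?h = "psd_order A"
  let ?K = "nat (?s + 1 - n + ?h)"
  have "psd_coeff (psd_mult \<delta> A (fls_X_inv * B)) n =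
    (\<Sum>m = n - ?s - 1..?h. \<Sum>j\<le>?K. psd_coeff A m * of_int (int_binomial m j) * (\<delta> ^^ j) (psd_coeff (fls_X_inv * B) (n - m + int j)))"
    by (rule psd_coeff_mult_box[OF \<delta> psd_le_order psd_le_X_inv[OF psd_le_order]]) auto
  also have "\<dots> = (\<Sum>m = n - ?s - 1..?h. \<Sum>j\<le>?K. psd_coeff A m * of_int (int_binomial m j) * (\<delta> ^^ j) (psd_coeff B ((n - 1) - m + int j)))"
    by (simp only: psd_coeff_ring_simps) (simp add: algebra_simps)
  also have "\<dots> = psd_coeff (psd_mult \<delta> A B) (n - 1)"
    by (rule psd_coeff_mult_box[OF \<delta> psd_le_order psd_le_order, symmetric]) auto
  finally show "psd_coeff (psd_mult \<delta> A (fls_X_inv * B)) n = psd_coeff (fls_X_inv * psd_mult \<delta> A B) n"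
    by simp
qed

text \<open>Multiplying the symbol by \<open>fls_X_inv\<close> composes \<open>A\<close> with
  \<partial> on the right, so this is associativity with \<partial> in the middle. After an index
  shift, Pascal's rule splits each coefficient into a part with \<open>j\<close> derivatives and one
  with \<open>j + 1\<close>, which are the two summands of \<open>psd_up\<close>.\<close>

lemma psd_mult_X_inv_left:
  assumes \<delta>: "additive \<delta>"
  shows "psd_mult \<delta> (fls_X_inv * A) B = psd_mult \<delta> A (psd_up \<delta> B)"
proof (rule psd_eqI)
  fix p
  let ?s = "psd_order B" let ?h = "psd_order A"
  let ?K = "nat (?s + 1 - p + ?h)" let ?l = "p - ?s - 1"
  let ?b = "\<lambda>m j. (\<delta> ^^ j) (psd_coeff B (p - 1 - m + int j))"
  interpret \<delta>j: additive "\<delta> ^^ j" for j by (rule additive_funpow[OF \<delta>])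
  \<comment> \<open>This term lies above the order of \<open>B\<close>; dropping it gives both sums
    from Pascal's rule the same range.\<close>
  have b0: "?b m (Suc ?K) = 0" if "m \<in> {?l..?h}" for m
    using that by (subst psd_coeff_above_order) (auto simp: \<delta>j.zero simp del: funpow.simps)
  have \<delta>_pow: "(\<delta> ^^ j) (\<delta> (psd_coeff B (p - m + int j))) = ?b m (Suc j)" for m j
    by (simp add: funpow_swap1 algebra_simps)
  have idx: "p - m + int j - 1 = p - 1 - m + int j" for m j
    by simp
  have split: "(\<Sum>j\<le>Suc ?K. of_int (int_binomial (m + 1) j) * ?b m j)
      = (\<Sum>j\<le>Suc ?K. of_int (int_binomial m j) * ?b m j) + (\<Sum>j\<le>?K. of_int (int_binomial m j) * ?b m (Suc j))" for m
    unfolding sum.atMost_Suc_shift int_binomial_Suc int_binomial_0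
    by (simp add: distrib_right sum.distrib add.assoc del: funpow.simps)
  have trunc: "(\<Sum>j\<le>Suc ?K. of_int (int_binomial m j) * ?b m j) = (\<Sum>j\<le>?K. of_int (int_binomial m j) * ?b m j)"
    if "m \<in> {?l..?h}" for m
    by (simp only: sum.atMost_Suc b0[OF that] mult_zero_right add_0_right)
  have "psd_coeff (psd_mult \<delta> (fls_X_inv * A) B) p =
    (\<Sum>m = ?l + 1..?h + 1. \<Sum>j\<le>Suc ?K. psd_coeff (fls_X_inv * A) m * of_int (int_binomial m j) * (\<delta> ^^ j) (psd_coeff B (p - m + int j)))"
    by (rule psd_coeff_mult_box[OF \<delta> psd_le_X_inv[OF psd_le_order] psd_le_order]) auto
  also have "\<dots> = (\<Sum>m = ?l..?h. \<Sum>j\<le>Suc ?K. psd_coeff A m * of_int (int_binomial (m + 1) j) * ?b m j)"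
    unfolding psd_coeff_ring_simps
    by (rule sum.reindex_bij_witness[of _ "\<lambda>m. m + 1" "\<lambda>m. m - 1"]) (auto simp: algebra_simps)
  also have "\<dots> = (\<Sum>m = ?l..?h. psd_coeff A m * (\<Sum>j\<le>Suc ?K. of_int (int_binomial (m + 1) j) * ?b m j))"
    by (simp add: sum_distrib_left mult.assoc del: sum.atMost_Suc)
  also have "\<dots> = (\<Sum>m = ?l..?h. psd_coeff A m * ((\<Sum>j\<le>?K. of_int (int_binomial m j) * ?b m j) + (\<Sum>j\<le>?K. of_int (int_binomial m j) * ?b m (Suc j))))"
    by (intro sum.cong refl) (simp only: split trunc)
  also have "\<dots> = (\<Sum>m = ?l..?h. \<Sum>j\<le>?K. psd_coeff A m * of_int (int_binomial m j) * (\<delta> ^^ j) (psd_coeff (psd_up \<delta> B) (p - m + int j)))"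
    unfolding psd_up_def psd_coeff_simps psd_coeff_map_additive[OF \<delta>] psd_coeff_ring_simps \<delta>j.add
    unfolding idx \<delta>_pow
    by (intro sum.cong refl) (simp add: sum_distrib_left distrib_left sum.distrib mult.assoc del: funpow.simps of_nat_Suc)
  also have "\<dots> = psd_coeff (psd_mult \<delta> A (psd_up \<delta> B)) p"
    by (rule psd_coeff_mult_box[OF \<delta> psd_le_order psd_le_up[OF \<delta> psd_le_order], symmetric]) auto
  finally show "psd_coeff (psd_mult \<delta> (fls_X_inv * A) B) p = psd_coeff (psd_mult \<delta> A (psd_up \<delta> B)) p" .
qed

text \<open>A Laurent series is approximated by its truncations, which are finite sums of monomials,
  and a monomial comes from a constant by repeated multiplication with \<lambda> or its inverse. For
  an identity additive in \<open>A\<close>, the case \<open>up\<close> is a rule for \<partial>,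
  \<open>down\<close> follows by cancelling \<partial>, and \<open>limit\<close> from order
  bounds.\<close>

lemma psd_induct [case_names const add up down limit]:
  fixes A :: "'a::comm_ring_1 fls"
  assumes const: "\<And>a. P (fls_const a)"
    and add: "\<And>A B. P A \<Longrightarrow> P B \<Longrightarrow> P (A + B)"
    and up: "\<And>A. P A \<Longrightarrow> P (fls_X_inv * A)"
    and down: "\<And>A. P A \<Longrightarrow> P (fls_X * A)"
    and limit: "\<And>A. (\<And>s. \<exists>B. P B \<and> psd_le s (A - B)) \<Longrightarrow> P A"
  shows "P A"
proof (rule limit)
  fix s
  define mono where "mono n = fls_shift n (fls_const (psd_coeff A n))" for n
  have mono: "P (fls_shift n (fls_const a))" for n a
  proof (induction n rule: int_induct[where k = 0])
    case (step1 i)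
    then show ?case using up[OF step1(2)] by (simp add: fls_X_inv_times_conv_shift)
  next
    case (step2 i)
    then show ?case using down[OF step2(2)] by (simp add: fls_X_times_conv_shift)
  qed (simp add: const)
  have P0: "P 0" using const[of 0] by simp
  have "P (\<Sum>n\<in>I. mono n)" for I
    by (induction I rule: infinite_finite_induct) (auto simp: P0 mono mono_def intro: add)
  moreover have "psd_le s (A - (\<Sum>n = s..psd_order A. mono n))"
    unfolding psd_le_def
  proof (intro allI impI)
    fix n assume n: "n > s"
    have "psd_coeff (mono m) n = (if m = n then psd_coeff A n else 0)" for m
      by (simp add: mono_def psd_coeff_def)
    then have "psd_coeff (\<Sum>m = s..psd_order A. mono m) n = (if n \<le> psd_order A then psd_coeff A n else 0)"
      using n by (simp add: psd_coeff_sum)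
    then show "psd_coeff (A - (\<Sum>n = s..psd_order A. mono n)) n = 0"
      by (simp add: psd_coeff_above_order)
  qed
  ultimately show "\<exists>B. P B \<and> psd_le s (A - B)" by blast
qed

lemma psd_eq_limit:
  fixes A B :: "'a::comm_ring_1 fls"
  assumes "\<And>s. psd_le s (A - B)"
  shows "A = B"
proof (rule psd_eqI)
  fix n show "psd_coeff A n = psd_coeff B n"
    using psd_leD[OF assms[of "n - 1"], of n] by simp
qed

text \<open>The difference of the two values at \<open>A\<close> equals that at
  \<open>A - B\<close>, whose order is as small as desired because both maps raise orders by at most
  \<open>c\<close>.\<close>

lemma psd_eq_limit_additive:
  fixes L R :: "'a::comm_ring_1 fls \<Rightarrow> 'b::comm_ring_1 fls"
  assumes L: "additive L" and R: "additive R"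
    and bound: "\<And>s A. psd_le s A \<Longrightarrow> psd_le (s + c) (L A) \<and> psd_le (s + c) (R A)"
    and approx: "\<And>s. \<exists>B. L B = R B \<and> psd_le s (A - B)"
  shows "L A = R A"
proof (rule psd_eq_limit)
  fix s
  obtain B where B: "L B = R B" "psd_le (s - c) (A - B)" using approx by blast
  have "L A - R A = L (A - B) - R (A - B)"
    using B(1) by (simp add: additive.diff[OF L] additive.diff[OF R])
  moreover have "psd_le s (L (A - B))" "psd_le s (R (A - B))"
    using bound[OF B(2)] by simp_all
  ultimately show "psd_le s (L A - R A)"
    by (simp add: psd_le_def)
qed

lemma additive_map2:
  assumes "additive f" "additive g"
  shows "additive (\<lambda>x. f x + g x)" "additive (\<lambda>x. f x - g x)"
  using assms by (simp_all add: additive_def)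

lemma additive_comp: "additive f \<Longrightarrow> additive g \<Longrightarrow> additive (\<lambda>x. f (g x))"
  by (simp add: additive_def)

lemma additive_uminus: "additive f \<Longrightarrow> additive (\<lambda>x. - f x)"
  by (simp add: additive_def)

lemma additive_mult [simp]:
  "additive (\<lambda>x. a * x)" "additive (\<lambda>x. x * a)" for a :: "'a::comm_ring_1"
  by (simp_all add: additive_def algebra_simps)

lemma additive_fls_const [simp]: "additive (fls_const :: 'a::comm_ring_1 \<Rightarrow> _)"
  by (simp add: additive_def fls_plus_const)

text \<open>Serves for two kinds of \<eta>: the map \<open>\<delta>\<close> itself, and right
  composition with a fixed operator, which acts on another slot.\<close>

lemma psd_mult_map_right:
  fixes A B :: "'a::comm_ring_1 fls"
  assumes \<delta>: "additive \<delta>" and \<eta>: "additive \<eta>" and comm: "\<And>x. \<eta> (\<delta> x) = \<delta> (\<eta> x)"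
    and A: "\<And>n x. \<eta> (psd_coeff A n * x) = psd_coeff A n * \<eta> x"
  shows "psd_mult \<delta> A (psd_map \<eta> B) = psd_map \<eta> (psd_mult \<delta> A B)"
proof (rule psd_eqI)
  fix n
  let ?K = "nat (psd_order B - n + psd_order A)"
  have pow: "(\<delta> ^^ j) (\<eta> x) = \<eta> ((\<delta> ^^ j) x)" for j x
    by (induction j) (simp_all add: comm)
  have "psd_coeff (psd_mult \<delta> A (psd_map \<eta> B)) n = (\<Sum>m = n - psd_order B..psd_order A. \<Sum>j\<le>?K.
      psd_coeff A m * of_int (int_binomial m j) * (\<delta> ^^ j) (psd_coeff (psd_map \<eta> B) (n - m + int j)))"
    by (rule psd_coeff_mult_box[OF \<delta> psd_le_order psd_le_map[OF \<eta> psd_le_order]]) auto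
  also have "\<dots> = \<eta> (\<Sum>m = n - psd_order B..psd_order A. \<Sum>j\<le>?K.
      psd_coeff A m * of_int (int_binomial m j) * (\<delta> ^^ j) (psd_coeff B (n - m + int j)))"
    by (simp add: \<eta> pow additive.sum[OF \<eta>] mult.assoc A additive_of_int[OF \<eta>])
  also have "\<dots> = \<eta> (psd_coeff (psd_mult \<delta> A B) n)"
    by (subst psd_coeff_mult_box[OF \<delta> psd_le_order psd_le_order]) auto
  finally show "psd_coeff (psd_mult \<delta> A (psd_map \<eta> B)) n = psd_coeff (psd_map \<eta> (psd_mult \<delta> A B)) n"
    by (simp add: \<eta>)
qed

lemma fls_X_inv_mult_fls_X: "fls_X_inv * (fls_X * A) = A" "fls_X * (fls_X_inv * A) = A"
  for A :: "'a::comm_ring_1 fls"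
  by (auto intro!: psd_eqI)

text \<open>\<open>fls_X\<close> is the symbol of the inverse of \<partial>. Hence
  \<open>psd_up\<close> is bijective, and \<open>down\<close> steps of later inductions can write an
  argument as \<open>psd_up\<close> of something and cancel.\<close>

lemma psd_mult_X_up:
  assumes "additive \<delta>"
  shows "psd_mult \<delta> (fls_X :: 'a::comm_ring_1 fls) (psd_up \<delta> B) = B"
  using psd_mult_X_inv_left[OF assms, of fls_X B] fls_X_inv_mult_fls_X(1)[of "1 :: 'a fls"]
  by (simp only: mult_1_right psd_mult_one[OF assms])

lemma psd_up_mult_X:
  assumes "additive \<delta>"
  shows "psd_up \<delta> (psd_mult \<delta> fls_X B) = B"
proof -
  \<comment> \<open>The only nonzero coefficient of \<open>fls_X\<close> is 1, so its coefficients
    commute with \<open>\<delta>\<close>.\<close>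
  have "psd_coeff fls_X n * x = (if n = -1 then x else 0)" for n and x :: 'a
    by (simp add: psd_coeff_def)
  then have "psd_up \<delta> (psd_mult \<delta> fls_X B) = psd_mult \<delta> fls_X (psd_up \<delta> B)"
    unfolding psd_up_def using assms
    by (simp add: additive.add[OF psd_mult_additive_right] psd_mult_X_inv_right psd_mult_map_right additive.zero)
  then show ?thesis using psd_mult_X_up[OF assms] by simp
qed

lemma psd_up_inject: "additive \<delta> \<Longrightarrow> psd_up \<delta> A = psd_up \<delta> B \<longleftrightarrow> A = B"
  by (metis psd_mult_X_up)

section \<open>Associativity of composition for mixed Leibniz rules\<close>

lemma psd_map_mult:
  fixes B C :: "'a::comm_ring_1 fls"
  assumes \<delta>1: "additive \<delta>1" and \<delta>2: "additive \<delta>2" and \<delta>3: "additive \<delta>3"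
    and leibniz: "\<And>b c. \<delta>3 (b * c) = \<delta>1 b * c + b * \<delta>2 c"
  shows "psd_map \<delta>3 (psd_mult \<delta>2 B C) = psd_mult \<delta>2 (psd_map \<delta>1 B) C + psd_mult \<delta>2 B (psd_map \<delta>2 C)"
proof (rule psd_eqI)
  fix n
  let ?K = "nat (psd_order C - n + psd_order B)" let ?I = "{n - psd_order C..psd_order B}"
  let ?c = "\<lambda>m j. psd_coeff C (n - m + int j)"
  have "\<delta>3 (b * of_int k * c) = \<delta>1 b * of_int k * c + b * of_int k * \<delta>2 c" for b k c
    by (simp add: mult.assoc leibniz additive_of_int[OF \<delta>2])
  then have "psd_coeff (psd_map \<delta>3 (psd_mult \<delta>2 B C)) n =
      (\<Sum>m\<in>?I. \<Sum>j\<le>?K. \<delta>1 (psd_coeff B m) * of_int (int_binomial m j) * (\<delta>2 ^^ j) (?c m j)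
         + psd_coeff B m * of_int (int_binomial m j) * \<delta>2 ((\<delta>2 ^^ j) (?c m j)))"
    by (simp add: \<delta>3 psd_coeff_mult_box[OF \<delta>2 psd_le_order[of B] psd_le_order[of C] order_refl, of n ?K]
        additive.sum[OF \<delta>3])
  also have "\<dots> = psd_coeff (psd_mult \<delta>2 (psd_map \<delta>1 B) C + psd_mult \<delta>2 B (psd_map \<delta>2 C)) n"
    by (simp add: \<delta>1 \<delta>2 funpow_swap1 sum.distrib
        psd_coeff_mult_box[OF \<delta>2 psd_le_map[OF \<delta>1 psd_le_order[of B]] psd_le_order[of C] order_refl, of n ?K]
        psd_coeff_mult_box[OF \<delta>2 psd_le_order[of B] psd_le_map[OF \<delta>2 psd_le_order[of C]] order_refl, of n ?K])
  finally show "psd_coeff (psd_map \<delta>3 (psd_mult \<delta>2 B C)) n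
      = psd_coeff (psd_mult \<delta>2 (psd_map \<delta>1 B) C + psd_mult \<delta>2 B (psd_map \<delta>2 C)) n" .
qed

lemma psd_up_mult:
  assumes "additive \<delta>1" "additive \<delta>2" "additive \<delta>3"
    and "\<And>b c. \<delta>3 (b * c) = \<delta>1 b * c + b * \<delta>2 c"
  shows "psd_up \<delta>3 (psd_mult \<delta>2 B C) = psd_mult \<delta>2 (psd_up \<delta>1 B) C"
  unfolding psd_up_def psd_map_mult[OF assms]
  using assms by (simp add: additive.add[OF psd_mult_additive_left] psd_mult_X_inv_left psd_up_def
      additive.add[OF psd_mult_additive_right] psd_mult_X_inv_right)

text \<open>Three maps are allowed because over series in \<lambda> the coefficientwise derivation
  and \<lambda>+\<partial> occur in one product. The induction moves \<partial> from
  \<open>A\<close> to \<open>B\<close>, hence \<open>B\<close> stays arbitrary.\<close>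

theorem psd_mult_assoc:
  fixes A B C :: "'a::comm_ring_1 fls"
  assumes \<delta>: "additive \<delta>1" "additive \<delta>2" "additive \<delta>3"
    and leibniz: "\<And>b c. \<delta>3 (b * c) = \<delta>1 b * c + b * \<delta>2 c"
  shows "psd_mult \<delta>3 A (psd_mult \<delta>2 B C) = psd_mult \<delta>2 (psd_mult \<delta>1 A B) C"
proof (induction A arbitrary: B rule: psd_induct)
  case (const a)
  then show ?case using \<delta> by (simp add: psd_mult_const_mult)
next
  case (add A A')
  then show ?case using \<delta> by (simp add: additive.add[OF psd_mult_additive_left])
next
  case (up A)
  then show ?case using \<delta> by (simp add: psd_mult_X_inv_left psd_up_mult[OF \<delta> leibniz])
next
  case (down A)
  \<comment> \<open>With \<open>B\<close> in the image of \<open>psd_up\<close>, its \<partial>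
    cancels against \<open>fls_X\<close>.\<close>
  obtain B' where B': "B = psd_up \<delta>1 B'" using psd_up_mult_X[OF \<delta>(1)] by metis
  show ?case
    unfolding B' psd_up_mult[OF \<delta> leibniz, symmetric]
    using \<delta> down by (simp add: psd_mult_X_inv_left[symmetric] fls_X_inv_mult_fls_X)
next
  case (limit A)
  define c where "c = psd_order B + psd_order C"
  have "psd_le (s + c) (psd_mult \<delta>3 A (psd_mult \<delta>2 B C)) \<and>
        psd_le (s + c) (psd_mult \<delta>2 (psd_mult \<delta>1 A B) C)" if "psd_le s A" for s A
    using psd_mult_le[OF \<delta>(3) that psd_mult_le[OF \<delta>(2) psd_le_order[of B] psd_le_order[of C]]]
      psd_mult_le[OF \<delta>(2) psd_mult_le[OF \<delta>(1) that psd_le_order[of B]] psd_le_order[of C]]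
    by (simp add: c_def add.assoc)
  moreover have "\<exists>D. psd_mult \<delta>3 D (psd_mult \<delta>2 B C) = psd_mult \<delta>2 (psd_mult \<delta>1 D B) C \<and> psd_le s (A - D)" for s
    using limit[of s] by blast
  ultimately show ?case
    using \<delta>
    by (intro psd_eq_limit_additive[where A = A and L = "\<lambda>A. psd_mult \<delta>3 A (psd_mult \<delta>2 B C)"
          and R = "\<lambda>A. psd_mult \<delta>2 (psd_mult \<delta>1 A B) C" and c = c])
       (auto intro!: psd_mult_additive_left additive_comp[of "\<lambda>A. psd_mult \<delta>2 A C"])
qed

lemma psd_map_mult_hom:
  fixes h :: "'a::comm_ring_1 \<Rightarrow> 'b::comm_ring_1"
  assumes \<delta>: "additive \<delta>" and \<delta>': "additive \<delta>'" and h: "additive h"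
    and mult: "\<And>x y. h (x * y) = h x * h y" and comm: "\<And>x. h (\<delta> x) = \<delta>' (h x)"
  shows "psd_map h (psd_mult \<delta> A B) = psd_mult \<delta>' (psd_map h A) (psd_map h B)"
proof (rule psd_eqI)
  fix n
  let ?K = "nat (psd_order B - n + psd_order A)"
  have pow: "h ((\<delta> ^^ j) x) = (\<delta>' ^^ j) (h x)" for j x
    by (induction j) (simp_all add: comm)
  have "h (a * of_int k * x) = h a * of_int k * h x" for a k x
    by (simp only: mult.assoc mult[of a] additive_of_int[OF h])
  then show "psd_coeff (psd_map h (psd_mult \<delta> A B)) n = psd_coeff (psd_mult \<delta>' (psd_map h A) (psd_map h B)) n"
    by (simp add: h additive.sum[OF h] pow
        psd_coeff_mult_box[OF \<delta> psd_le_order[of A] psd_le_order[of B] order_refl, of n ?K]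
        psd_coeff_mult_box[OF \<delta>' psd_le_map[OF h psd_le_order[of A]] psd_le_map[OF h psd_le_order[of B]] order_refl, of n ?K])
qed

section \<open>Adjoints of operators\<close>

lemma psd_adjoint_box:
  fixes A :: "'a::comm_ring_1 fls"
  assumes \<delta>: "additive \<delta>" and s: "psd_le s A" and K: "int K \<ge> s - p"
  shows "psd_coeff (psd_adjoint \<delta> A) p = (\<Sum>j\<le>K.
     neg_one_power (p + int j) * of_int (int_binomial (p + int j) j) * (\<delta> ^^ j) (psd_coeff A (p + int j)))"
    (is "_ = (\<Sum>j\<le>K. ?t j)")
proof (cases "A = 0")
  case True
  then show ?thesis unfolding psd_coeff_adjoint by (simp add: additive.zero[OF additive_funpow[OF \<delta>]])
next
  case False
  then have s': "psd_order A \<le> s" using s psd_order_le by auto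
  show ?thesis unfolding psd_coeff_adjoint
    using s' K by (intro sum.mono_neutral_left)
      (auto simp: psd_coeff_above_order additive.zero[OF additive_funpow[OF \<delta>]])
qed

lemma psd_adjoint_le: "additive \<delta> \<Longrightarrow> psd_le s A \<Longrightarrow> psd_le s (psd_adjoint \<delta> A)"
  unfolding psd_le_def[of s "psd_adjoint \<delta> A"]
proof (intro allI impI)
  fix n assume "additive \<delta>" "psd_le s A" "n > s"
  then show "psd_coeff (psd_adjoint \<delta> A) n = 0"
    by (subst psd_adjoint_box[of \<delta> s A n 0]) (auto dest: psd_leD)
qed

lemma psd_adjoint_additive: "additive \<delta> \<Longrightarrow> additive (psd_adjoint \<delta>)"
  for \<delta> :: "'a::comm_ring_1 \<Rightarrow> 'a"
proof (unfold_locales, rule psd_eqI)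
  fix A B :: "'a fls" and n assume \<delta>: "additive \<delta>"
  obtain s where s: "psd_le s A" "psd_le s B" by (rule psd_le_bound2[of A B])
  note * = psd_adjoint_box[OF \<delta>, of s _ n "nat (s - n)"]
  show "psd_coeff (psd_adjoint \<delta> (A + B)) n = psd_coeff (psd_adjoint \<delta> A + psd_adjoint \<delta> B) n"
    using s psd_le_add[OF s] by (simp add: * additive.add[OF additive_funpow[OF \<delta>]] algebra_simps sum.distrib)
qed

lemma psd_adjoint_const [simp]:
  assumes \<delta>: "additive \<delta>"
  shows "psd_adjoint \<delta> (fls_const a) = fls_const a"
proof (rule psd_eqI)
  fix n
  let ?t = "\<lambda>j. neg_one_power (n + int j) * of_int (int_binomial (n + int j) j) * (\<delta> ^^ j) (psd_coeff (fls_const a) (n + int j))"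
  have "psd_coeff (psd_adjoint \<delta> (fls_const a)) n = (\<Sum>j\<le>nat (- n). ?t j)"
    by (rule psd_adjoint_box[OF \<delta> psd_le_const]) simp
  also have "\<dots> = (\<Sum>j\<in>{0}. ?t j)"
    by (rule sum.mono_neutral_right)
      (auto simp: additive.zero[OF additive_funpow[OF \<delta>]] int_binomial_zero)
  finally show "psd_coeff (psd_adjoint \<delta> (fls_const a)) n = psd_coeff (fls_const a) n"
    by (simp add: neg_one_power_def)
qed

text \<open>Right composition with \<partial> becomes left composition with -\<partial>; on
  coefficients this is again Pascal's rule.\<close>

lemma psd_adjoint_X_inv:
  assumes \<delta>: "additive \<delta>"
  shows "psd_adjoint \<delta> (fls_X_inv * A) = - psd_up \<delta> (psd_adjoint \<delta> A)"
proof (rule psd_eqI)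
  fix p
  let ?s = "psd_order A" let ?K = "nat (?s + 1 - p)"
  let ?a = "\<lambda>j. (\<delta> ^^ j) (psd_coeff A (p - 1 + int j))"
  let ?\<sigma> = "\<lambda>j. neg_one_power (p + int j) :: 'a"
  interpret \<delta>: additive \<delta> by (rule \<delta>)
  have np: "?\<sigma> (Suc j) = - ?\<sigma> j" "neg_one_power (p - 1 + int j) = - ?\<sigma> j" for j
    by (auto simp: neg_one_power_def)
  have sg: "\<delta> (?\<sigma> j * x) = ?\<sigma> j * \<delta> x" for j x
    by (auto simp: neg_one_power_def \<delta>.minus)
  have bin: "int_binomial (p + int (Suc j)) (Suc j) = int_binomial (p - 1 + int (Suc j)) (Suc j) + int_binomial (p + int j) j" for j
    using int_binomial_Suc[of "p + int j" j] by (simp add: add_ac)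
  have sumE: "x + (\<Sum>j\<le>?K. - f j * of_int (k j + l j) * g j)
      = x + (\<Sum>j\<le>?K. - f j * of_int (k j) * g j) - (\<Sum>j\<le>?K. f j * of_int (l j) * g j)"
    for x :: 'a and f k l g
    by (simp add: algebra_simps sum.distrib sum_negf sum_subtractf)
  have "psd_coeff (psd_adjoint \<delta> (fls_X_inv * A)) p =
      (\<Sum>j\<le>Suc ?K. ?\<sigma> j * of_int (int_binomial (p + int j) j) * (\<delta> ^^ j) (psd_coeff (fls_X_inv * A) (p + int j)))"
    by (rule psd_adjoint_box[OF \<delta> psd_le_X_inv[OF psd_le_order]]) auto
  also have "\<dots> = (\<Sum>j\<le>Suc ?K. ?\<sigma> j * of_int (int_binomial (p + int j) j) * ?a j)"
    by (simp only: psd_coeff_ring_simps) (simp only: add_diff_eq diff_add_eq)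
  also have "\<dots> = (\<Sum>j\<le>Suc ?K. ?\<sigma> j * of_int (int_binomial (p - 1 + int j) j) * ?a j)
     - (\<Sum>j\<le>?K. ?\<sigma> j * of_int (int_binomial (p + int j) j) * ?a (Suc j))"
    by (simp only: sum.atMost_Suc_shift bin int_binomial_0 np sumE)
  also have "(\<Sum>j\<le>Suc ?K. ?\<sigma> j * of_int (int_binomial (p - 1 + int j) j) * ?a j)
     = - psd_coeff (psd_adjoint \<delta> A) (p - 1)"
    by (subst psd_adjoint_box[OF \<delta> psd_le_order, of A "p - 1" "Suc ?K"]) (auto simp: np sum_negf simp del: sum.atMost_Suc)
  also have "(\<Sum>j\<le>?K. ?\<sigma> j * of_int (int_binomial (p + int j) j) * ?a (Suc j)) = \<delta> (psd_coeff (psd_adjoint \<delta> A) p)"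
    by (subst psd_adjoint_box[OF \<delta> psd_le_order, of A "p" ?K])
       (auto simp: \<delta>.sum mult.assoc sg additive_of_int[OF \<delta>] algebra_simps)
  finally show "psd_coeff (psd_adjoint \<delta> (fls_X_inv * A)) p = psd_coeff (- psd_up \<delta> (psd_adjoint \<delta> A)) p"
    by (simp add: psd_up_def \<delta>)
qed

lemma psd_adjoint_map:
  fixes h :: "'a::comm_ring_1 \<Rightarrow> 'b::comm_ring_1"
  assumes \<delta>: "additive \<delta>" and \<delta>': "additive \<delta>'" and h: "additive h" and comm: "\<And>x. h (\<delta> x) = \<delta>' (h x)"
  shows "psd_map h (psd_adjoint \<delta> A) = psd_adjoint \<delta>' (psd_map h A)"
proof (rule psd_eqI)
  fix n
  let ?K = "nat (psd_order A - n)"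
  have pow: "h ((\<delta> ^^ j) x) = (\<delta>' ^^ j) (h x)" for j x
    by (induction j) (simp_all add: comm)
  have "h (neg_one_power i * of_int k * x) = neg_one_power i * of_int k * h x" for i k x
    by (auto simp: neg_one_power_def additive_of_int[OF h] additive.minus[OF h])
  then show "psd_coeff (psd_map h (psd_adjoint \<delta> A)) n = psd_coeff (psd_adjoint \<delta>' (psd_map h A)) n"
    by (simp add: h additive.sum[OF h] pow
        psd_adjoint_box[OF \<delta> psd_le_order[of A], of n ?K]
        psd_adjoint_box[OF \<delta>' psd_le_map[OF h psd_le_order[of A]], of n ?K])
qed

lemma psd_adjoint_up:
  assumes \<delta>: "additive \<delta>"
  shows "psd_adjoint \<delta> (psd_up \<delta> B) = - (fls_X_inv * psd_adjoint \<delta> B)"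
  unfolding psd_up_def
  by (simp add: \<delta> additive.add[OF psd_adjoint_additive] psd_adjoint_X_inv psd_up_def psd_adjoint_map[OF \<delta> \<delta> \<delta> refl])

lemma psd_adjoint_adjoint [simp]:
  assumes \<delta>: "additive \<delta>"
  shows "psd_adjoint \<delta> (psd_adjoint \<delta> A) = A"
proof (induction A rule: psd_induct)
  case (add A B)
  then show ?case by (simp add: additive.add[OF psd_adjoint_additive[OF \<delta>]])
next
  case (up A)
  then show ?case
    by (simp add: psd_adjoint_X_inv \<delta> additive.minus[OF psd_adjoint_additive] psd_adjoint_up)
next
  case (down A)
  let ?B = "psd_adjoint \<delta> (psd_adjoint \<delta> (fls_X * A))"
  have "fls_X_inv * ?B = psd_adjoint \<delta> (psd_adjoint \<delta> (fls_X_inv * (fls_X * A)))"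
    by (simp only: psd_adjoint_X_inv[OF \<delta>] additive.minus[OF psd_adjoint_additive[OF \<delta>]] psd_adjoint_up[OF \<delta>] minus_minus)
  also have "\<dots> = A" by (simp add: fls_X_inv_mult_fls_X down)
  finally show ?case by (metis fls_X_inv_mult_fls_X(2))
next
  case (limit A)
  show ?case
    by (rule psd_eq_limit_additive[where A = A and L = "\<lambda>A. psd_adjoint \<delta> (psd_adjoint \<delta> A)" and c = 0])
       (use limit \<delta> in \<open>auto intro!: additive_comp[of "psd_adjoint \<delta>" "psd_adjoint \<delta>"] psd_adjoint_additive psd_adjoint_le additive.intro
          simp: additive.add[OF psd_adjoint_additive]\<close>)
qed (simp add: \<delta>)

text \<open>\<open>A\<close> carries \<open>\<delta>1\<close>, while \<open>B\<close> and the
  product carry \<open>\<delta>\<close>. With the coefficientwise derivation for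
  \<open>\<delta>1\<close> and \<lambda>+\<partial> for \<open>\<delta>\<close>, this trades an
  action from the left for one from the right, that is, the \<nu>-slot for the \<mu>-slot.\<close>

theorem psd_adjoint_mult:
  fixes A B :: "'a::comm_ring_1 fls"
  assumes \<delta>: "additive \<delta>1" "additive \<delta>" and leibniz: "\<And>a b. \<delta> (a * b) = \<delta>1 a * b + a * \<delta> b"
  shows "psd_adjoint \<delta> (psd_mult \<delta> A B) = psd_mult \<delta>1 (psd_adjoint \<delta> B) (psd_adjoint \<delta>1 A)"
proof (induction A arbitrary: B rule: psd_induct)
  case (const a)
  \<comment> \<open>Even for a constant left factor the adjoint involves all of \<open>B\<close>,
    hence an inner induction.\<close>
  have "psd_adjoint \<delta> (fls_const a * B) = psd_mult \<delta>1 (psd_adjoint \<delta> B) (fls_const a)"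
  proof (induction B rule: psd_induct)
    case (const b)
    then show ?case using \<delta> by (simp add: mult.commute)
  next
    case (add B C)
    then show ?case using \<delta>
      by (simp add: distrib_left additive.add[OF psd_adjoint_additive] additive.add[OF psd_mult_additive_left])
  next
    case (up B)
    have leibniz': "\<delta> (b * c) = \<delta> b * c + b * \<delta>1 c" for b c
      using leibniz[of c b] by (simp add: mult.commute)
    have "psd_adjoint \<delta> (fls_const a * (fls_X_inv * B)) = - psd_up \<delta> (psd_adjoint \<delta> (fls_const a * B))"
      using \<delta> by (simp add: mult.left_commute[of _ fls_X_inv] psd_adjoint_X_inv)
    then show ?case
      using up \<delta> by (simp add: psd_adjoint_X_inv psd_up_mult[OF \<delta>(2,1,2) leibniz'] additive.minus[OF psd_mult_additive_left])
  next
    case (down B)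
    have leibniz': "\<delta> (b * c) = \<delta> b * c + b * \<delta>1 c" for b c
      using leibniz[of c b] by (simp add: mult.commute)
    let ?D = "psd_adjoint \<delta> (fls_X * B)"
    have D: "psd_adjoint \<delta> B = - psd_up \<delta> ?D"
      using psd_adjoint_X_inv[OF \<delta>(2), of "fls_X * B"] by (simp add: fls_X_inv_mult_fls_X)
    \<comment> \<open>The two sides are compared after applying the injective map
      \<open>psd_up \<delta>\<close>, which removes \<open>fls_X\<close>.\<close>
    have "- psd_up \<delta> (psd_adjoint \<delta> (fls_const a * (fls_X * B))) = psd_adjoint \<delta> (fls_X_inv * (fls_const a * (fls_X * B)))"
      using \<delta> by (simp add: psd_adjoint_X_inv)
    also have "\<dots> = psd_adjoint \<delta> (fls_const a * B)"
      by (simp add: mult.left_commute[of fls_X_inv "fls_const a"] fls_X_inv_mult_fls_X)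
    also have "\<dots> = - psd_up \<delta> (psd_mult \<delta>1 ?D (fls_const a))"
      using \<delta> unfolding down D by (simp add: additive.minus[OF psd_mult_additive_left] psd_up_mult[OF \<delta>(2,1,2) leibniz'])
    finally show ?case using \<delta> by (simp add: psd_up_inject)
  next
    case (limit B)
    show ?case
    proof (rule psd_eq_limit_additive[where A = B and L = "\<lambda>B. psd_adjoint \<delta> (fls_const a * B)"
          and R = "\<lambda>B. psd_mult \<delta>1 (psd_adjoint \<delta> B) (fls_const a)" and c = 0])
      fix s and B :: "'a fls" assume B: "psd_le s B"
      then have "psd_le s (fls_const a * B)" by (simp add: psd_le_def)
      then show "psd_le (s + 0) (psd_adjoint \<delta> (fls_const a * B)) \<and> psd_le (s + 0) (psd_mult \<delta>1 (psd_adjoint \<delta> B) (fls_const a))"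
        using \<delta> psd_mult_le[OF \<delta>(1) psd_adjoint_le[OF \<delta>(2) B] psd_le_const[of a]] by (simp add: psd_adjoint_le)
    qed (use limit \<delta> in \<open>auto intro!: additive_comp[of "psd_adjoint \<delta>"] additive_comp[of "\<lambda>A. psd_mult \<delta>1 A (fls_const a)"]
          psd_adjoint_additive psd_mult_additive_left\<close>)
  qed
  then show ?case using \<delta> by simp
next
  case (add A C)
  then show ?case using \<delta>
    by (simp add: additive.add[OF psd_mult_additive_left] additive.add[OF psd_mult_additive_right] additive.add[OF psd_adjoint_additive])
next
  case (up A)
  then show ?case using \<delta>
    by (simp add: psd_mult_X_inv_left psd_adjoint_up psd_adjoint_X_inv additive.minus[OF psd_mult_additive_left]
        additive.minus[OF psd_mult_additive_right])
next
  case (down A)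
  obtain B' where B': "B = psd_up \<delta> B'" using psd_up_mult_X[OF \<delta>(2)] by metis
  have "psd_adjoint \<delta> (psd_mult \<delta> (fls_X * A) B) = psd_adjoint \<delta> (psd_mult \<delta> A B')"
    using \<delta> unfolding B' psd_mult_X_inv_left[symmetric, OF \<delta>(2)] by (simp add: fls_X_inv_mult_fls_X)
  also have "\<dots> = psd_mult \<delta>1 (psd_adjoint \<delta> B') (psd_adjoint \<delta>1 (fls_X_inv * (fls_X * A)))"
    by (simp add: down fls_X_inv_mult_fls_X)
  also have "\<dots> = psd_mult \<delta>1 (- (fls_X_inv * psd_adjoint \<delta> B')) (psd_adjoint \<delta>1 (fls_X * A))"
    using \<delta> by (simp only: psd_adjoint_X_inv psd_mult_X_inv_left additive.minus[OF psd_mult_additive_left]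
        additive.minus[OF psd_mult_additive_right])
  finally show ?case using \<delta> by (simp add: B' psd_adjoint_up)
next
  case (limit A)
  have "psd_le (s + psd_order B) (psd_adjoint \<delta> (psd_mult \<delta> A B)) \<and>
        psd_le (s + psd_order B) (psd_mult \<delta>1 (psd_adjoint \<delta> B) (psd_adjoint \<delta>1 A))" if "psd_le s A" for s A
    using psd_adjoint_le[OF \<delta>(2) psd_mult_le[OF \<delta>(2) that psd_le_order[of B]]]
      psd_mult_le[OF \<delta>(1) psd_adjoint_le[OF \<delta>(2) psd_le_order[of B]] psd_adjoint_le[OF \<delta>(1) that]]
    by (simp add: add.commute)
  moreover have "\<exists>D. psd_adjoint \<delta> (psd_mult \<delta> D B) = psd_mult \<delta>1 (psd_adjoint \<delta> B) (psd_adjoint \<delta>1 D) \<and> psd_le s (A - D)" for s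
    using limit[of s] by blast
  ultimately show ?case
    using \<delta>
    by (intro psd_eq_limit_additive[where A = A and L = "\<lambda>A. psd_adjoint \<delta> (psd_mult \<delta> A B)"
          and R = "\<lambda>A. psd_mult \<delta>1 (psd_adjoint \<delta> B) (psd_adjoint \<delta>1 A)" and c = "psd_order B"])
       (auto intro!: additive_comp[of "psd_adjoint \<delta>"] additive_comp[of "psd_mult \<delta>1 (psd_adjoint \<delta> B)"]
          psd_adjoint_additive psd_mult_additive_left psd_mult_additive_right)
qed

section \<open>Representatives and their expansions\<close>

definition tri_le :: "int \<Rightarrow> (int \<Rightarrow> int \<Rightarrow> int \<Rightarrow> 'v::zero) \<Rightarrow> bool" where
  "tri_le N F \<longleftrightarrow> (\<forall>a b c. F a b c \<noteq> 0 \<longrightarrow> a \<le> N \<and> b \<le> N \<and> c \<le> N)"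

text \<open>Total degree gives the filtration in which limits of representatives are taken: the
  expansions preserve it, although they raise single exponents without bound.\<close>

definition tri_deg :: "int \<Rightarrow> (int \<Rightarrow> int \<Rightarrow> int \<Rightarrow> 'v::zero) \<Rightarrow> bool" where
  "tri_deg s F \<longleftrightarrow> (\<forall>a b c. F a b c \<noteq> 0 \<longrightarrow> a + b + c \<le> s)"

definition tri_const :: "'v::zero \<Rightarrow> int \<Rightarrow> int \<Rightarrow> int \<Rightarrow> 'v" where
  "tri_const f a b c = (if a = 0 \<and> b = 0 \<and> c = 0 then f else 0)"

definition tri_shift :: "int \<Rightarrow> int \<Rightarrow> int \<Rightarrow> (int \<Rightarrow> int \<Rightarrow> int \<Rightarrow> 'v) \<Rightarrow> int \<Rightarrow> int \<Rightarrow> int \<Rightarrow> 'v" where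
  "tri_shift i j k F a b c = F (a - i) (b - j) (c - k)"

text \<open>Rows in \<nu> are read as Laurent series, so that composition and adjoint can be applied
  to representatives.\<close>

definition nu_map :: "('v::zero fls \<Rightarrow> 'v fls) \<Rightarrow> (int \<Rightarrow> int \<Rightarrow> int \<Rightarrow> 'v) \<Rightarrow> int \<Rightarrow> int \<Rightarrow> int \<Rightarrow> 'v" where
  "nu_map f F a b = psd_coeff (f (Psd (F a b)))"

definition swap_lm :: "(int \<Rightarrow> int \<Rightarrow> int \<Rightarrow> 'v) \<Rightarrow> int \<Rightarrow> int \<Rightarrow> int \<Rightarrow> 'v" where
  "swap_lm F a b c = F b a c"

definition swap_mn :: "(int \<Rightarrow> int \<Rightarrow> int \<Rightarrow> 'v) \<Rightarrow> int \<Rightarrow> int \<Rightarrow> int \<Rightarrow> 'v" where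
  "swap_mn F a b c = F a c b"

definition psd_bounded :: "int \<Rightarrow> ('v::zero fls \<Rightarrow> 'w::zero fls) \<Rightarrow> bool" where
  "psd_bounded k f \<longleftrightarrow> f 0 = 0 \<and> (\<forall>s A. psd_le s A \<longrightarrow> psd_le (s + k) (f A))"

lemma laurent3_iff: "F \<in> laurent3 \<longleftrightarrow> (\<exists>N. tri_le N F)"
  by (simp add: laurent3_def tri_le_def)

lemma tri_le_mono: "tri_le N F \<Longrightarrow> N \<le> M \<Longrightarrow> tri_le M F"
  unfolding tri_le_def by fastforce

lemma tri_le_bound2:
  fixes F G :: "int \<Rightarrow> int \<Rightarrow> int \<Rightarrow> 'v::zero"
  assumes "F \<in> laurent3" "G \<in> laurent3"
  obtains N where "tri_le N F" "tri_le N G"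
proof -
  obtain N M where "tri_le N F" "tri_le M G" using assms by (auto simp: laurent3_iff)
  then show ?thesis using that[of "max N M"] tri_le_mono by (metis max.cobounded1 max.cobounded2)
qed

lemma tri_le_add:
  fixes F G :: "int \<Rightarrow> int \<Rightarrow> int \<Rightarrow> 'v::comm_ring_1"
  assumes "tri_le N F" "tri_le N G" shows "tri_le N (F + G)"
  unfolding tri_le_def
proof (intro allI impI)
  fix a b c assume "(F + G) a b c \<noteq> 0"
  then have "F a b c \<noteq> 0 \<or> G a b c \<noteq> 0" by auto
  then show "a \<le> N \<and> b \<le> N \<and> c \<le> N" using assms unfolding tri_le_def by blast
qed

lemma laurent3_add: "F \<in> laurent3 \<Longrightarrow> G \<in> laurent3 \<Longrightarrow> F + G \<in> laurent3"
  for F G :: "int \<Rightarrow> int \<Rightarrow> int \<Rightarrow> 'v::comm_ring_1"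
  using tri_le_bound2[of F G] tri_le_add laurent3_iff by metis

lemma laurent3_uminus: "F \<in> laurent3 \<Longrightarrow> - F \<in> laurent3"
  for F :: "int \<Rightarrow> int \<Rightarrow> int \<Rightarrow> 'v::comm_ring_1"
  by (simp add: laurent3_def)

lemma laurent3_diff: "F \<in> laurent3 \<Longrightarrow> G \<in> laurent3 \<Longrightarrow> F - G \<in> laurent3"
  for F G :: "int \<Rightarrow> int \<Rightarrow> int \<Rightarrow> 'v::comm_ring_1"
  using laurent3_add[OF _ laurent3_uminus, of F G] by simp

lemma laurent3_zero: "0 \<in> laurent3" "(\<lambda>_ _ _. 0) \<in> laurent3"
  by (simp_all add: laurent3_def)

lemma laurent3_sum: "(\<And>x. x \<in> I \<Longrightarrow> F x \<in> laurent3) \<Longrightarrow> (\<Sum>x\<in>I. F x) \<in> laurent3"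
  for F :: "'i \<Rightarrow> int \<Rightarrow> int \<Rightarrow> int \<Rightarrow> 'v::comm_ring_1"
  by (induction I rule: infinite_finite_induct) (auto simp: laurent3_zero laurent3_add)

lemma laurent3_const: "tri_const f \<in> laurent3"
  unfolding laurent3_iff by (rule exI[of _ 0]) (auto simp: tri_le_def tri_const_def)

lemma laurent3_shift:
  assumes "F \<in> laurent3" shows "tri_shift i j k F \<in> laurent3"
proof -
  obtain N where N: "tri_le N F" using assms by (auto simp: laurent3_iff)
  have "tri_le (N + \<bar>i\<bar> + \<bar>j\<bar> + \<bar>k\<bar>) (tri_shift i j k F)"
    unfolding tri_le_def tri_shift_def
  proof (intro allI impI)
    fix a b c assume "F (a - i) (b - j) (c - k) \<noteq> 0"
    then have "a - i \<le> N \<and> b - j \<le> N \<and> c - k \<le> N" using N by (auto simp: tri_le_def)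
    then show "a \<le> N + \<bar>i\<bar> + \<bar>j\<bar> + \<bar>k\<bar> \<and> b \<le> N + \<bar>i\<bar> + \<bar>j\<bar> + \<bar>k\<bar> \<and> c \<le> N + \<bar>i\<bar> + \<bar>j\<bar> + \<bar>k\<bar>" by linarith
  qed
  then show ?thesis by (auto simp: laurent3_iff)
qed

lemma laurent3_swap: "F \<in> laurent3 \<Longrightarrow> swap_lm F \<in> laurent3" "F \<in> laurent3 \<Longrightarrow> swap_mn F \<in> laurent3"
  unfolding laurent3_iff tri_le_def swap_lm_def swap_mn_def by meson+

lemma psd_coeff_row: "F \<in> laurent3 \<Longrightarrow> psd_coeff (Psd (F a b)) c = F a b c"
  unfolding laurent3_iff tri_le_def
  by (elim exE, rule_tac N = N in psd_coeff_Psd) force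

lemma psd_le_row: "tri_le N F \<Longrightarrow> psd_le N (Psd (F a b))"
proof -
  assume N: "tri_le N F"
  then have "F \<in> laurent3" by (auto simp: laurent3_iff)
  then show ?thesis using N by (force simp: psd_le_def psd_coeff_row tri_le_def)
qed

lemma Psd_zero [simp]: "Psd (\<lambda>_. 0) = 0"
  by (simp add: Psd_def zero_fls_def)

lemma nu_map_nu_map [simp]: "nu_map f (nu_map g F) = nu_map (\<lambda>A. f (g A)) F"
  for F :: "int \<Rightarrow> int \<Rightarrow> int \<Rightarrow> 'v::comm_ring_1"
  by (simp add: nu_map_def fun_eq_iff)

lemma laurent3_nu_map:
  assumes f: "psd_bounded k f" and "F \<in> laurent3"
  shows "nu_map f F \<in> laurent3"
proof -
  obtain N where N: "tri_le N F" using assms by (auto simp: laurent3_iff)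
  have "tri_le (N + \<bar>k\<bar>) (nu_map f F)"
    unfolding tri_le_def
  proof (intro allI impI)
    fix a b c assume *: "nu_map f F a b c \<noteq> 0"
    have "psd_le (N + k) (f (Psd (F a b)))" using f psd_le_row[OF N] by (auto simp: psd_bounded_def)
    then have c: "c \<le> N + k" using * by (auto simp: nu_map_def psd_le_def not_less[symmetric])
    have "F a b \<noteq> (\<lambda>_. 0)" using * f by (auto simp: nu_map_def psd_bounded_def)
    then obtain c' where "F a b c' \<noteq> 0" by (auto simp: fun_eq_iff)
    then show "a \<le> N + \<bar>k\<bar> \<and> b \<le> N + \<bar>k\<bar> \<and> c \<le> N + \<bar>k\<bar>" using c N unfolding tri_le_def by force
  qed
  then show ?thesis by (auto simp: laurent3_iff)
qed

lemma tri_deg_nu_map: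
  assumes f: "psd_bounded k f" and F: "F \<in> laurent3" and s: "tri_deg s F"
  shows "tri_deg (s + k) (nu_map f F)"
  unfolding tri_deg_def
proof (intro allI impI)
  fix a b c assume *: "nu_map f F a b c \<noteq> 0"
  have "psd_le (s - a - b) (Psd (F a b))" unfolding psd_le_def psd_coeff_row[OF F]
  proof (intro allI impI)
    fix n assume "s - a - b < n"
    then have "\<not> a + b + n \<le> s" by simp
    then show "F a b n = 0" using s by (auto simp: tri_deg_def)
  qed
  then have "psd_le (s - a - b + k) (f (Psd (F a b)))" using f by (auto simp: psd_bounded_def)
  then have "c \<le> s - a - b + k" using * by (auto simp: nu_map_def psd_le_def not_less[symmetric])
  then show "a + b + c \<le> s + k" by simp
qed

lemma Psd_add_row:
  fixes F G :: "int \<Rightarrow> int \<Rightarrow> int \<Rightarrow> 'v::comm_ring_1"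
  assumes "F \<in> laurent3" "G \<in> laurent3"
  shows "Psd (F a b + G a b) = Psd (F a b) + Psd (G a b)"
  using psd_coeff_row[OF laurent3_add[OF assms], of a b] psd_coeff_row[OF assms(1)] psd_coeff_row[OF assms(2)]
  by (intro psd_eqI) simp

lemma nu_map_add:
  fixes F G :: "int \<Rightarrow> int \<Rightarrow> int \<Rightarrow> 'v::comm_ring_1"
  assumes "additive f" "F \<in> laurent3" "G \<in> laurent3"
  shows "nu_map f (F + G) = nu_map f F + nu_map f G"
  using assms by (simp add: nu_map_def fun_eq_iff Psd_add_row additive.add)

lemma nu_map_shift: "nu_map f (tri_shift i j 0 F) = tri_shift i j 0 (nu_map f F)"
proof (intro ext)
  fix a b c
  have "tri_shift i j 0 F a b = F (a - i) (b - j)" by (simp add: tri_shift_def fun_eq_iff)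
  then show "nu_map f (tri_shift i j 0 F) a b c = tri_shift i j 0 (nu_map f F) a b c"
    by (simp only: nu_map_def tri_shift_def diff_0_right)
qed

lemma nu_map_X_inv: "F \<in> laurent3 \<Longrightarrow> nu_map (\<lambda>A. fls_X_inv * A) F = tri_shift 0 0 1 F"
  for F :: "int \<Rightarrow> int \<Rightarrow> int \<Rightarrow> 'v::comm_ring_1"
  by (simp add: nu_map_def tri_shift_def fun_eq_iff psd_coeff_row)

lemma nu_map_swap_lm: "nu_map f (swap_lm F) = swap_lm (nu_map f F)"
proof (intro ext)
  fix a b c
  have "swap_lm F a b = F b a" by (simp add: swap_lm_def fun_eq_iff)
  then show "nu_map f (swap_lm F) a b c = swap_lm (nu_map f F) a b c"
    by (simp only: nu_map_def swap_lm_def)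
qed

lemma swap_swap [simp]: "swap_lm (swap_lm F) = F" "swap_mn (swap_mn F) = F"
  by (simp_all add: swap_lm_def swap_mn_def fun_eq_iff)

lemma swap_add:
  "swap_lm (F + G) = swap_lm F + swap_lm G" "swap_mn (F + G) = swap_mn F + swap_mn G"
  by (simp_all add: swap_lm_def swap_mn_def fun_eq_iff)

section \<open>Comparing maps on representatives by their behaviour under shifts\<close>

definition deg2 :: "int \<Rightarrow> 'v::zero fls fls \<Rightarrow> bool" where
  "deg2 s G \<longleftrightarrow> (\<forall>p q. p + q > s \<longrightarrow> psd_coeff (psd_coeff G q) p = 0)"

lemma psd_eqI2: "(\<And>p q. psd_coeff (psd_coeff G q) p = psd_coeff (psd_coeff H q) p) \<Longrightarrow> G = H"
  by (intro psd_eqI)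

lemma deg2_eqI:
  fixes G H :: "'v::comm_ring_1 fls fls"
  assumes "\<And>s. deg2 s (G - H)"
  shows "G = H"
proof (rule psd_eqI2)
  fix p q show "psd_coeff (psd_coeff G q) p = psd_coeff (psd_coeff H q) p"
    using assms[of "p + q - 1"] unfolding deg2_def by auto
qed

lemma deg2_diff: "deg2 s G \<Longrightarrow> deg2 s H \<Longrightarrow> deg2 s (G - H)" for G H :: "'v::comm_ring_1 fls fls"
  by (simp add: deg2_def)

text \<open>The counterpart of \<open>psd_induct\<close> for representatives. Since the shift
  hypotheses are equivalences, agreement does not depend on the exponents; it passes from constants
  to monomials, by additivity to finite sums, and by the degree bounds to all of
  \<open>laurent3\<close>.\<close>

lemma laurent3_ext:
  fixes L R :: "(int \<Rightarrow> int \<Rightarrow> int \<Rightarrow> 'v::comm_ring_1) \<Rightarrow> 'v fls fls"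
  assumes L_add: "\<And>F G. F \<in> laurent3 \<Longrightarrow> G \<in> laurent3 \<Longrightarrow> L (F + G) = L F + L G"
    and R_add: "\<And>F G. F \<in> laurent3 \<Longrightarrow> G \<in> laurent3 \<Longrightarrow> R (F + G) = R F + R G"
    and L_deg: "\<And>F s. F \<in> laurent3 \<Longrightarrow> tri_deg s F \<Longrightarrow> deg2 s (L F)"
    and R_deg: "\<And>F s. F \<in> laurent3 \<Longrightarrow> tri_deg s F \<Longrightarrow> deg2 s (R F)"
    and const: "\<And>f. L (tri_const f) = R (tri_const f)"
    and shift: "\<And>F. F \<in> laurent3 \<Longrightarrow> L (tri_shift 1 0 0 F) = R (tri_shift 1 0 0 F) \<longleftrightarrow> L F = R F"
      "\<And>F. F \<in> laurent3 \<Longrightarrow> L (tri_shift 0 1 0 F) = R (tri_shift 0 1 0 F) \<longleftrightarrow> L F = R F"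
      "\<And>F. F \<in> laurent3 \<Longrightarrow> L (tri_shift 0 0 1 F) = R (tri_shift 0 0 1 F) \<longleftrightarrow> L F = R F"
    and F: "F \<in> laurent3"
  shows "L F = R F"
proof (rule deg2_eqI)
  fix s
  have comp: "tri_shift i j k (tri_shift i' j' k' G) = tri_shift (i + i') (j + j') (k + k') G"
    for i j k i' j' k' and G :: "int \<Rightarrow> int \<Rightarrow> int \<Rightarrow> 'v"
    by (simp add: tri_shift_def fun_eq_iff algebra_simps)
  have int_iff: "P i \<longleftrightarrow> P 0" if "\<And>i. P (i + 1) \<longleftrightarrow> P i" for P and i :: int
  proof (induction i rule: int_induct[where k = 0])
    case (step1 i) then show ?case using that[of i] by blast
  next
    case (step2 i) then show ?case using that[of "i - 1"] by simp
  qed simp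
  have 1: "L (tri_shift i j k G) = R (tri_shift i j k G) \<longleftrightarrow> L (tri_shift 0 j k G) = R (tri_shift 0 j k G)"
    if "G \<in> laurent3" for i j k G
    by (rule int_iff[of "\<lambda>i. L (tri_shift i j k G) = R (tri_shift i j k G)"])
       (use shift(1)[OF laurent3_shift[OF that]] in \<open>simp add: comp add.commute\<close>)
  have 2: "L (tri_shift i j k G) = R (tri_shift i j k G) \<longleftrightarrow> L (tri_shift i 0 k G) = R (tri_shift i 0 k G)"
    if "G \<in> laurent3" for i j k G
    by (rule int_iff[of "\<lambda>j. L (tri_shift i j k G) = R (tri_shift i j k G)"])
       (use shift(2)[OF laurent3_shift[OF that]] in \<open>simp add: comp add.commute\<close>)
  have 3: "L (tri_shift i j k G) = R (tri_shift i j k G) \<longleftrightarrow> L (tri_shift i j 0 G) = R (tri_shift i j 0 G)"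
    if "G \<in> laurent3" for i j k G
    by (rule int_iff[of "\<lambda>k. L (tri_shift i j k G) = R (tri_shift i j k G)"])
       (use shift(3)[OF laurent3_shift[OF that]] in \<open>simp add: comp add.commute\<close>)
  have shift0: "tri_shift 0 0 0 G = G" for G :: "int \<Rightarrow> int \<Rightarrow> int \<Rightarrow> 'v"
    by (simp add: tri_shift_def fun_eq_iff)
  define m where "m = (\<lambda>(i, j, k). tri_shift i j k (tri_const (F i j k)))"
  have "L (m (i, j, k)) = R (m (i, j, k))" for i j k
    using const[of "F i j k"]
    by (simp only: m_def prod.case 1[OF laurent3_const, where i = i] 2[OF laurent3_const, where j = j]
        3[OF laurent3_const, where k = k] shift0)
  then have m: "m x \<in> laurent3" "L (m x) = R (m x)" for x
    by (cases x; simp add: m_def laurent3_shift laurent3_const)+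
  have m_apply: "m x a b c = (if x = (a, b, c) then F a b c else 0)" for x a b c
    by (auto simp: m_def tri_shift_def tri_const_def split: prod.split)
  have zero: "L 0 = 0" "R 0 = 0"
    using L_add[of 0 0] R_add[of 0 0] laurent3_zero by auto
  have fin: "(\<Sum>x\<in>I. m x) \<in> laurent3 \<and> L (\<Sum>x\<in>I. m x) = R (\<Sum>x\<in>I. m x)" for I
  proof (induction I rule: infinite_finite_induct)
    case (insert x I)
    then have G: "(\<Sum>x\<in>I. m x) \<in> laurent3" "L (\<Sum>x\<in>I. m x) = R (\<Sum>x\<in>I. m x)" by blast+
    show ?case
      unfolding sum.insert[OF insert(1,2)] L_add[OF m(1)[of x] G(1)] R_add[OF m(1)[of x] G(1)] m(2)[of x] G(2)
      using laurent3_add[OF m(1)[of x] G(1)] by blast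
  qed (simp_all only: sum.infinite sum.empty zero laurent3_zero not_False_eq_True)
  obtain N where N: "tri_le N F" using F by (auto simp: laurent3_iff)
  \<comment> \<open>All exponents of \<open>F\<close> are at most \<open>N\<close>, so a triple
    outside \<open>I\<close> has an exponent below \<open>s - 2 * N\<close> and hence total degree
    below \<open>s\<close>.\<close>
  define I where "I = {s - 2 * N..N} \<times> {s - 2 * N..N} \<times> {s - 2 * N..N}"
  define G where "G = (\<Sum>x\<in>I. m x)"
  have G: "G \<in> laurent3" "L G = R G" using fin by (auto simp: G_def)
  have G_apply: "G a b c = (if (a, b, c) \<in> I then F a b c else 0)" for a b c
  proof -
    have "G a b c = (\<Sum>x\<in>I. m x a b c)"
      unfolding G_def by (induction I rule: infinite_finite_induct) auto
    then show ?thesis by (simp add: m_apply I_def)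
  qed
  have FG: "F - G \<in> laurent3" using F G by (simp add: laurent3_diff)
  have "tri_deg s (F - G)"
    unfolding tri_deg_def
  proof (intro allI impI)
    fix a b c assume "(F - G) a b c \<noteq> 0"
    then have *: "(a, b, c) \<notin> I" "F a b c \<noteq> 0" by (auto simp: G_apply split: if_splits)
    then have "a \<le> N" "b \<le> N" "c \<le> N" using N by (auto simp: tri_le_def)
    then show "a + b + c \<le> s" using *(1) by (auto simp: I_def)
  qed
  then have "deg2 s (L (F - G))" "deg2 s (R (F - G))" using L_deg R_deg FG by auto
  moreover have "L F = L G + L (F - G)" "R F = R G + R (F - G)"
    using L_add[OF G(1) FG] R_add[OF G(1) FG] by simp_all
  ultimately show "deg2 s (L F - R F)" using G(2) by (simp add: deg2_def)
qed

section \<open>The first expansion\<close>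

abbreviation "E1 \<equiv> vlm_expand_lambda_mu"
abbreviation "E2 \<equiv> vlm_expand_mu_lambda"
abbreviation "E3 \<equiv> vlm_expand_nu_lambda"

text \<open>A nonzero term has \<open>c \<le> N\<close> and \<open>q - c + int k \<le> N\<close>;
  together these bound \<open>c\<close> from below and \<open>k\<close> from above.\<close>

lemma E1_box:
  fixes F :: "int \<Rightarrow> int \<Rightarrow> int \<Rightarrow> 'v::comm_ring_1"
  assumes N: "tri_le N F" and lo: "lo \<le> q - N" and hi: "N \<le> hi" and K: "2 * N - q \<le> int K"
  shows "psd_coeff (psd_coeff (E1 F) q) p =
    (\<Sum>c = lo..hi. \<Sum>k\<le>K. of_int (int_binomial c k) * F (p - int k) (q - c + int k) c)"
proof -
  have F: "F \<in> laurent3" using N by (auto simp: laurent3_iff)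
  have "psd_coeff (psd_coeff (E1 F) q) p = (\<Sum>(c, k) \<in> {lo..hi} \<times> {..K}.
      of_int (int_binomial c k) * F (p - int k) (q - c + int k) c)"
    unfolding psd_coeff_vlm_expand(1)[OF F]
  proof (rule sum.mono_neutral_left)
    show "{(c, k). F (p - int k) (q - c + int k) c \<noteq> 0} \<subseteq> {lo..hi} \<times> {..K}"
    proof clarify
      fix c k assume "F (p - int k) (q - c + int k) c \<noteq> 0"
      then have "q - c + int k \<le> N" "c \<le> N" using N by (auto simp: tri_le_def)
      then show "c \<in> {lo..hi} \<and> k \<in> {..K}" using lo hi K by auto
    qed
  qed auto
  then show ?thesis by (simp add: sum.cartesian_product)
qed

text \<open>The shifts by \<mu> and \<nu> relate coefficients at \<open>q\<close> and
  \<open>q - 1\<close>, so one box has to serve both series at both places and stay valid when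
  enlarged.\<close>

lemma E1_box2:
  fixes F G :: "int \<Rightarrow> int \<Rightarrow> int \<Rightarrow> 'v::comm_ring_1"
  assumes "F \<in> laurent3" "G \<in> laurent3"
  obtains lo hi K where "lo \<le> hi"
    "\<And>q' p lo' hi' K'. q - 1 \<le> q' \<Longrightarrow> q' \<le> q \<Longrightarrow> lo' \<le> lo \<Longrightarrow> hi \<le> hi' \<Longrightarrow> K \<le> K' \<Longrightarrow> psd_coeff (psd_coeff (E1 F) q') p =
      (\<Sum>c = lo'..hi'. \<Sum>k\<le>K'. of_int (int_binomial c k) * F (p - int k) (q' - c + int k) c)"
    "\<And>q' p lo' hi' K'. q - 1 \<le> q' \<Longrightarrow> q' \<le> q \<Longrightarrow> lo' \<le> lo \<Longrightarrow> hi \<le> hi' \<Longrightarrow> K \<le> K' \<Longrightarrow> psd_coeff (psd_coeff (E1 G) q') p =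
      (\<Sum>c = lo'..hi'. \<Sum>k\<le>K'. of_int (int_binomial c k) * G (p - int k) (q' - c + int k) c)"
proof -
  obtain N where N: "tri_le N F" "tri_le N G" using tri_le_bound2[OF assms] .
  show ?thesis
    by (rule that[of "min (q - 1 - N) N" N "nat (2 * N - q + 1)"]) (auto intro!: E1_box N)
qed

lemma E1_add:
  fixes F G :: "int \<Rightarrow> int \<Rightarrow> int \<Rightarrow> 'v::comm_ring_1"
  assumes "F \<in> laurent3" "G \<in> laurent3"
  shows "E1 (F + G) = E1 F + E1 G"
proof (rule psd_eqI2)
  fix p q
  obtain N where N: "tri_le N F" "tri_le N G" using tri_le_bound2[OF assms] .
  then have "tri_le N (F + G)" by (rule tri_le_add)
  then show "psd_coeff (psd_coeff (E1 (F + G)) q) p = psd_coeff (psd_coeff (E1 F + E1 G) q) p"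
    using N by (simp add: E1_box[where lo = "q - N" and hi = N and K = "nat (2 * N - q)"] algebra_simps sum.distrib)
qed

lemma E1_nu_psd_map:
  fixes F :: "int \<Rightarrow> int \<Rightarrow> int \<Rightarrow> 'v::comm_ring_1"
  assumes h: "additive h" and F: "F \<in> laurent3"
  shows "E1 (nu_map (psd_map h) F) = psd_map (psd_map h) (E1 F)"
proof (rule psd_eqI2)
  fix p q
  obtain N where N: "tri_le N F" using F by (auto simp: laurent3_iff)
  have eq: "nu_map (psd_map h) F a b c = h (F a b c)" for a b c
    using F by (simp add: nu_map_def h psd_coeff_row)
  have "tri_le N (nu_map (psd_map h) F)" using N additive.zero[OF h] unfolding tri_le_def eq by metis
  then show "psd_coeff (psd_coeff (E1 (nu_map (psd_map h) F)) q) p = psd_coeff (psd_coeff (psd_map (psd_map h) (E1 F)) q) p"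
    using N by (simp add: E1_box[where lo = "q - N" and hi = N and K = "nat (2 * N - q)"] eq h psd_map_additive
        additive.sum[OF h] additive_of_int[OF h])
qed

text \<open>\<lambda> is the inner variable, \<mu> the outer one, and \<nu> must act as their sum.
  Only this last clause has content: it is Pascal's rule for the expansion of a power of
  \<nu>.\<close>

lemma E1_shift:
  fixes F :: "int \<Rightarrow> int \<Rightarrow> int \<Rightarrow> 'v::comm_ring_1"
  assumes F: "F \<in> laurent3"
  shows "E1 (tri_shift 1 0 0 F) = psd_map (\<lambda>g. fls_X_inv * g) (E1 F)" (is ?A)
    and "E1 (tri_shift 0 1 0 F) = fls_X_inv * E1 F" (is ?B)
    and "E1 (tri_shift 0 0 1 F) = fls_X_inv * E1 F + psd_map (\<lambda>g. fls_X_inv * g) (E1 F)" (is ?C)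
proof -
  show ?A
  proof (rule psd_eqI2)
    fix p q
    obtain lo hi K where "lo \<le> hi" and *: "\<And>q' p lo' hi' K'. q - 1 \<le> q' \<Longrightarrow> q' \<le> q \<Longrightarrow> lo' \<le> lo \<Longrightarrow> hi \<le> hi' \<Longrightarrow> K \<le> K' \<Longrightarrow> psd_coeff (psd_coeff (E1 F) q') p =
      (\<Sum>c = lo'..hi'. \<Sum>k\<le>K'. of_int (int_binomial c k) * F (p - int k) (q' - c + int k) c)"
    "\<And>q' p lo' hi' K'. q - 1 \<le> q' \<Longrightarrow> q' \<le> q \<Longrightarrow> lo' \<le> lo \<Longrightarrow> hi \<le> hi' \<Longrightarrow> K \<le> K' \<Longrightarrow> psd_coeff (psd_coeff (E1 (tri_shift 1 0 0 F)) q') p =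
      (\<Sum>c = lo'..hi'. \<Sum>k\<le>K'. of_int (int_binomial c k) * tri_shift 1 0 0 F (p - int k) (q' - c + int k) c)"
      using E1_box2[OF F laurent3_shift[OF F, of 1 0 0], of q] by blast
    show "psd_coeff (psd_coeff (E1 (tri_shift 1 0 0 F)) q) p = psd_coeff (psd_coeff (psd_map (\<lambda>g. fls_X_inv * g) (E1 F)) q) p"
      using *(1)[of q lo hi K "p - 1"] *(2)[of q lo hi K p] by (simp add: tri_shift_def algebra_simps)
  qed
  show ?B
  proof (rule psd_eqI2)
    fix p q
    obtain lo hi K where "lo \<le> hi" and *: "\<And>q' p lo' hi' K'. q - 1 \<le> q' \<Longrightarrow> q' \<le> q \<Longrightarrow> lo' \<le> lo \<Longrightarrow> hi \<le> hi' \<Longrightarrow> K \<le> K' \<Longrightarrow> psd_coeff (psd_coeff (E1 F) q') p =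
      (\<Sum>c = lo'..hi'. \<Sum>k\<le>K'. of_int (int_binomial c k) * F (p - int k) (q' - c + int k) c)"
    "\<And>q' p lo' hi' K'. q - 1 \<le> q' \<Longrightarrow> q' \<le> q \<Longrightarrow> lo' \<le> lo \<Longrightarrow> hi \<le> hi' \<Longrightarrow> K \<le> K' \<Longrightarrow> psd_coeff (psd_coeff (E1 (tri_shift 0 1 0 F)) q') p =
      (\<Sum>c = lo'..hi'. \<Sum>k\<le>K'. of_int (int_binomial c k) * tri_shift 0 1 0 F (p - int k) (q' - c + int k) c)"
      using E1_box2[OF F laurent3_shift[OF F, of 0 1 0], of q] by blast
    show "psd_coeff (psd_coeff (E1 (tri_shift 0 1 0 F)) q) p = psd_coeff (psd_coeff (fls_X_inv * E1 F) q) p"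
      using *(1)[of "q - 1" lo hi K p] *(2)[of q lo hi K p] by (simp add: tri_shift_def algebra_simps)
  qed
  show ?C
  proof (rule psd_eqI2)
    fix p q
    obtain lo hi K where "lo \<le> hi" and *: "\<And>q' p lo' hi' K'. q - 1 \<le> q' \<Longrightarrow> q' \<le> q \<Longrightarrow> lo' \<le> lo \<Longrightarrow> hi \<le> hi' \<Longrightarrow> K \<le> K' \<Longrightarrow> psd_coeff (psd_coeff (E1 F) q') p =
      (\<Sum>c = lo'..hi'. \<Sum>k\<le>K'. of_int (int_binomial c k) * F (p - int k) (q' - c + int k) c)"
    "\<And>q' p lo' hi' K'. q - 1 \<le> q' \<Longrightarrow> q' \<le> q \<Longrightarrow> lo' \<le> lo \<Longrightarrow> hi \<le> hi' \<Longrightarrow> K \<le> K' \<Longrightarrow> psd_coeff (psd_coeff (E1 (tri_shift 0 0 1 F)) q') p =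
      (\<Sum>c = lo'..hi'. \<Sum>k\<le>K'. of_int (int_binomial c k) * tri_shift 0 0 1 F (p - int k) (q' - c + int k) c)"
      using E1_box2[OF F laurent3_shift[OF F, of 0 0 1], of q] by blast
    let ?f = "\<lambda>c k. F (p - int k) (q - 1 - c + int k) c"
    have split: "(\<Sum>k\<le>Suc K. of_int (int_binomial (c + 1) k) * ?f c k)
        = (\<Sum>k\<le>Suc K. of_int (int_binomial c k) * ?f c k) + (\<Sum>k\<le>K. of_int (int_binomial c k) * ?f c (Suc k))" for c
      unfolding sum.atMost_Suc_shift int_binomial_Suc int_binomial_0
      by (simp add: distrib_right sum.distrib add.assoc del: of_nat_Suc)
    \<comment> \<open>The box is enlarged by one in \<open>c\<close> and in \<open>k\<close>: the
      index shift lowers the range of \<open>c\<close>, and Pascal's rule produces the index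
      \<open>Suc k\<close>.\<close>
    have "psd_coeff (psd_coeff (E1 (tri_shift 0 0 1 F)) q) p
        = (\<Sum>c = lo..hi + 1. \<Sum>k\<le>Suc K. of_int (int_binomial c k) * tri_shift 0 0 1 F (p - int k) (q - c + int k) c)"
      by (rule *(2)) auto
    also have "\<dots> = (\<Sum>c = lo - 1..hi. \<Sum>k\<le>Suc K. of_int (int_binomial (c + 1) k) * ?f c k)"
      unfolding tri_shift_def
      by (rule sum.reindex_bij_witness[of _ "\<lambda>m. m + 1" "\<lambda>m. m - 1"]) (auto simp: algebra_simps)
    also have "\<dots> = (\<Sum>c = lo - 1..hi. \<Sum>k\<le>Suc K. of_int (int_binomial c k) * ?f c k)
        + (\<Sum>c = lo - 1..hi. \<Sum>k\<le>K. of_int (int_binomial c k) * F (p - 1 - int k) (q - c + int k) c)"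
      unfolding split sum.distrib by (simp add: algebra_simps)
    also have "\<dots> = psd_coeff (psd_coeff (E1 F) (q - 1)) p + psd_coeff (psd_coeff (E1 F) q) (p - 1)"
      using *(1)[of "q - 1" "lo - 1" hi "Suc K" p] *(1)[of q "lo - 1" hi K "p - 1"] by simp
    finally show "psd_coeff (psd_coeff (E1 (tri_shift 0 0 1 F)) q) p =
        psd_coeff (psd_coeff (fls_X_inv * E1 F + psd_map (\<lambda>g. fls_X_inv * g) (E1 F)) q) p"
      by simp
  qed
qed

lemma E1_const: "E1 (tri_const f) = fls_const (fls_const (f :: 'v::comm_ring_1))"
proof (rule psd_eqI2)
  fix p q
  have N: "tri_le 0 (tri_const f)" by (auto simp: tri_le_def tri_const_def)
  have *: "of_int (int_binomial c k) * tri_const f (p - int k) (q - c + int k) c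
      = (if c = 0 \<and> k = 0 then tri_const f p q 0 else 0)" for c k
    by (cases k) (auto simp: tri_const_def)
  have "psd_coeff (psd_coeff (E1 (tri_const f)) q) p = (\<Sum>c = min q 0..0. \<Sum>k\<le>nat (- q). if c = 0 \<and> k = 0 then tri_const f p q 0 else 0)"
    by (subst E1_box[OF N, of "min q 0" q 0 "nat (- q)"]) (auto simp only: *)
  also have "\<dots> = (\<Sum>c = min q 0..0. if c = 0 then tri_const f p q 0 else 0)"
    by (intro sum.cong refl) auto
  also have "\<dots> = tri_const f p q 0" by simp
  finally show "psd_coeff (psd_coeff (E1 (tri_const f)) q) p = psd_coeff (psd_coeff (fls_const (fls_const f)) q) p"
    by (auto simp: tri_const_def)
qed

lemma E1_deg:
  fixes F :: "int \<Rightarrow> int \<Rightarrow> int \<Rightarrow> 'v::comm_ring_1"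
  assumes F: "F \<in> laurent3" and s: "tri_deg s F"
  shows "deg2 s (E1 F)"
  unfolding deg2_def
proof (intro allI impI)
  fix p q assume pq: "s < p + q"
  have "F (p - int k) (q - c + int k) c = 0" for c k
    using s pq by (force simp: tri_deg_def)
  then show "psd_coeff (psd_coeff (E1 F) q) p = 0"
    unfolding psd_coeff_vlm_expand(1)[OF F] by simp
qed

text \<open>Additivity of the expansions is known on \<open>laurent3\<close> only, so the
  consequences of the locale \<open>additive\<close> are restated relative to that set.\<close>

lemma laurent3_additive:
  fixes L :: "(int \<Rightarrow> int \<Rightarrow> int \<Rightarrow> 'v::comm_ring_1) \<Rightarrow> 'b::ab_group_add"
  assumes L: "\<And>F G. F \<in> laurent3 \<Longrightarrow> G \<in> laurent3 \<Longrightarrow> L (F + G) = L F + L G"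
  shows "L 0 = 0" and "F \<in> laurent3 \<Longrightarrow> L (- F) = - L F"
    and "(\<And>x. x \<in> I \<Longrightarrow> f x \<in> laurent3) \<Longrightarrow> L (\<Sum>x\<in>I. f x) = (\<Sum>x\<in>I. L (f x))"
proof -
  show 0: "L 0 = 0"
    using L[OF laurent3_zero(1) laurent3_zero(1)] by (metis add.right_neutral add_left_imp_eq)
  show "L (- F) = - L F" if F: "F \<in> laurent3"
    using L[OF F laurent3_uminus[OF F]] 0 by (metis add.right_inverse add_eq_0_iff)
  show "L (\<Sum>x\<in>I. f x) = (\<Sum>x\<in>I. L (f x))" if "\<And>x. x \<in> I \<Longrightarrow> f x \<in> laurent3"
    using that
  proof (induction I rule: infinite_finite_induct)
    case (insert x I)
    have *: "f x \<in> laurent3" "(\<Sum>x\<in>I. f x) \<in> laurent3"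
      using insert(4) by (auto intro: laurent3_sum)
    have "L (\<Sum>x\<in>I. f x) = (\<Sum>x\<in>I. L (f x))"
      using insert(3,4) by blast
    then show ?case
      unfolding sum.insert[OF insert(1,2)] L[OF *] by (rule arg_cong)
  qed (simp_all only: sum.infinite sum.empty 0 not_False_eq_True)
qed

lemma E1_uminus: "F \<in> laurent3 \<Longrightarrow> E1 (- F) = - E1 F" for F :: "int \<Rightarrow> int \<Rightarrow> int \<Rightarrow> 'v::comm_ring_1"
  by (rule laurent3_additive(2), rule E1_add)

section \<open>The second and third expansions by symmetry\<close>

lemma E2_conv: "E2 F = E1 (swap_lm F)"
  by (simp add: vlm_expand_mu_lambda_def vlm_expand_lambda_mu_def swap_lm_def)

lemma swap_lm_shift: "swap_lm (tri_shift i j k F) = tri_shift j i k (swap_lm F)"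
  by (simp add: swap_lm_def tri_shift_def fun_eq_iff)

lemma swap_mn_shift: "swap_mn (tri_shift i j k F) = tri_shift i k j (swap_mn F)"
  by (simp add: swap_mn_def tri_shift_def fun_eq_iff)

lemma swap_const: "swap_lm (tri_const f) = tri_const f" "swap_mn (tri_const f) = tri_const f"
  by (auto simp: swap_lm_def swap_mn_def tri_const_def fun_eq_iff)

lemma tri_deg_swap: "tri_deg s F \<Longrightarrow> tri_deg s (swap_lm F)" "tri_deg s F \<Longrightarrow> tri_deg s (swap_mn F)"
  unfolding tri_deg_def swap_lm_def swap_mn_def by (metis add.commute add.left_commute)+

lemma E2_add: "F \<in> laurent3 \<Longrightarrow> G \<in> laurent3 \<Longrightarrow> E2 (F + G) = E2 F + E2 G"
  for F G :: "int \<Rightarrow> int \<Rightarrow> int \<Rightarrow> 'v::comm_ring_1"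
  by (simp add: E2_conv swap_add E1_add laurent3_swap)

lemma E2_shift:
  fixes F :: "int \<Rightarrow> int \<Rightarrow> int \<Rightarrow> 'v::comm_ring_1"
  assumes "F \<in> laurent3"
  shows "E2 (tri_shift 1 0 0 F) = fls_X_inv * E2 F"
    and "E2 (tri_shift 0 1 0 F) = psd_map (\<lambda>g. fls_X_inv * g) (E2 F)"
    and "E2 (tri_shift 0 0 1 F) = fls_X_inv * E2 F + psd_map (\<lambda>g. fls_X_inv * g) (E2 F)"
  using E1_shift[OF laurent3_swap(1)[OF assms]] by (simp_all add: E2_conv swap_lm_shift)

text \<open>The third expansion is the first one up to a rotation of the variables and \<open>\<lambda> \<mapsto> -\<lambda>\<close>.\<close>

definition rot :: "(int \<Rightarrow> int \<Rightarrow> int \<Rightarrow> 'v::comm_ring_1) \<Rightarrow> int \<Rightarrow> int \<Rightarrow> int \<Rightarrow> 'v" where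
  "rot F x y z = neg_one_power y * F y z x"

lemma neg_one_power_simps:
  "neg_one_power (p - 1) = - (neg_one_power p :: 'a::comm_ring_1)"
  "neg_one_power p * (neg_one_power p * x) = (x :: 'a)"
  by (auto simp: neg_one_power_def)

lemma laurent3_rot: "F \<in> laurent3 \<Longrightarrow> rot F \<in> laurent3"
  unfolding laurent3_iff tri_le_def rot_def by (metis mult_zero_right)

text \<open>A power of \<mu> = \<nu>+(-\<lambda>) is expanded the way a power of \<nu> =
  \<lambda>+\<mu> is in the first expansion. If \<open>a\<close> is the exponent of \<lambda> in the
  representative and \<open>p\<close> that in the result, the sign of the power of -\<lambda> splits
  into (-1)^a, which \<open>rot\<close> contains, and (-1)^p.\<close>

lemma E3_conv:
  assumes F: "F \<in> laurent3"
  shows "psd_coeff (psd_coeff (E3 F) p) r = neg_one_power p * psd_coeff (psd_coeff (E1 (rot F)) p) r"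
proof -
  have 0: "neg_one_power i * (x :: 'a) \<noteq> 0 \<longleftrightarrow> x \<noteq> 0" for i x by (auto simp: neg_one_power_def)
  have 1: "neg_one_power (b - int k) = (neg_one_power p * neg_one_power (p - b + int k) :: 'a)" for b k
    by (auto simp: neg_one_power_def)
  show ?thesis
    unfolding psd_coeff_vlm_expand(3)[OF F] psd_coeff_vlm_expand(1)[OF laurent3_rot[OF F]] sum_distrib_left
    by (rule sum.cong) (auto simp: rot_def 0 1 mult_ac)
qed

lemma E3_add:
  assumes "F \<in> laurent3" "G \<in> laurent3"
  shows "E3 (F + G) = E3 F + E3 G"
proof (rule psd_eqI2)
  fix p q
  have "rot (F + G) = rot F + rot G" by (simp add: rot_def fun_eq_iff algebra_simps)
  then show "psd_coeff (psd_coeff (E3 (F + G)) q) p = psd_coeff (psd_coeff (E3 F + E3 G) q) p"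
    using assms by (simp add: E3_conv laurent3_add E1_add laurent3_rot algebra_simps)
qed

lemma E3_shift:
  assumes F: "F \<in> laurent3"
  shows "E3 (tri_shift 1 0 0 F) = fls_X_inv * E3 F"
    and "E3 (tri_shift 0 1 0 F) = psd_map (\<lambda>g. fls_X_inv * g) (E3 F) - fls_X_inv * E3 F"
    and "E3 (tri_shift 0 0 1 F) = psd_map (\<lambda>g. fls_X_inv * g) (E3 F)"
proof -
  have "rot (tri_shift 1 0 0 F) = - tri_shift 0 1 0 (rot F)" "rot (tri_shift 0 1 0 F) = tri_shift 0 0 1 (rot F)"
    "rot (tri_shift 0 0 1 F) = tri_shift 1 0 0 (rot F)"
    by (simp_all add: rot_def tri_shift_def fun_eq_iff neg_one_power_simps)
  then show "E3 (tri_shift 1 0 0 F) = fls_X_inv * E3 F"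
    "E3 (tri_shift 0 1 0 F) = psd_map (\<lambda>g. fls_X_inv * g) (E3 F) - fls_X_inv * E3 F"
    "E3 (tri_shift 0 0 1 F) = psd_map (\<lambda>g. fls_X_inv * g) (E3 F)"
    using F by (auto intro!: psd_eqI2 simp: E3_conv laurent3_shift laurent3_rot E1_uminus E1_shift neg_one_power_simps algebra_simps)
qed

lemma E3_nu_psd_map:
  assumes h: "additive h" and F: "F \<in> laurent3"
  shows "E3 (nu_map (psd_map h) F) = psd_map (psd_map h) (E3 F)"
proof (rule psd_eqI2)
  fix p q
  have sg: "h (neg_one_power i * x) = neg_one_power i * h x" for i x
    by (auto simp: neg_one_power_def additive.minus[OF h])
  have eq: "nu_map (psd_map h) G a b c = h (G a b c)" if "G \<in> laurent3" for G a b c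
    using that by (simp add: nu_map_def h psd_coeff_row)
  have "nu_map (psd_map h) F \<in> laurent3"
    by (rule laurent3_nu_map[OF _ F, of 0]) (simp add: psd_bounded_def psd_le_map h additive.zero[OF psd_map_additive])
  moreover have "rot (nu_map (psd_map h) F) = nu_map (psd_map h) (rot F)"
    using F by (simp add: fun_eq_iff rot_def eq laurent3_rot sg)
  ultimately show "psd_coeff (psd_coeff (E3 (nu_map (psd_map h) F)) q) p = psd_coeff (psd_coeff (psd_map (psd_map h) (E3 F)) q) p"
    using F by (simp add: E3_conv E1_nu_psd_map laurent3_rot h psd_map_additive sg)
qed

lemma E3_const: "E3 (tri_const f) = fls_const (fls_const (f :: 'v::comm_ring_1))"
proof (rule psd_eqI2)
  fix p q
  have "rot (tri_const f) = tri_const f" by (auto simp: rot_def tri_const_def fun_eq_iff neg_one_power_def)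
  then show "psd_coeff (psd_coeff (E3 (tri_const f)) q) p = psd_coeff (psd_coeff (fls_const (fls_const f)) q) p"
    by (simp add: E3_conv laurent3_const E1_const neg_one_power_def)
qed

lemma E3_deg:
  assumes F: "F \<in> laurent3" and s: "tri_deg s F"
  shows "deg2 s (E3 F)"
proof -
  have "tri_deg s (rot F)"
    unfolding tri_deg_def
  proof (intro allI impI)
    fix a b c assume "rot F a b c \<noteq> 0"
    then have "F b c a \<noteq> 0" by (auto simp: rot_def)
    then have "b + c + a \<le> s" using s by (auto simp: tri_deg_def)
    then show "a + b + c \<le> s" by simp
  qed
  then have "deg2 s (E1 (rot F))" using E1_deg laurent3_rot[OF F] by blast
  then show ?thesis by (simp add: deg2_def E3_conv F)
qed

section \<open>Eliminating the quotient from the identity\<close>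

lemma E1_vlm_null:
  fixes F :: "int \<Rightarrow> int \<Rightarrow> int \<Rightarrow> 'v::comm_ring_1"
  assumes "F \<in> vlm_null"
  shows "E1 F = 0" "F \<in> laurent3"
proof -
  obtain W where W: "W \<in> laurent3" and F: "F = (\<lambda>a b c. W a b (c - 1) - W (a - 1) b c - W a (b - 1) c)"
    using assms by (auto simp: vlm_null_def)
  have F': "F + (tri_shift 1 0 0 W + tri_shift 0 1 0 W) = tri_shift 0 0 1 W"
    by (simp add: F tri_shift_def fun_eq_iff)
  have "F = tri_shift 0 0 1 W - (tri_shift 1 0 0 W + tri_shift 0 1 0 W)"
    by (simp add: F tri_shift_def fun_eq_iff)
  then show FL: "F \<in> laurent3" using W by (simp add: laurent3_diff laurent3_add laurent3_shift)
  have "E1 F + (E1 (tri_shift 1 0 0 W) + E1 (tri_shift 0 1 0 W)) = E1 (tri_shift 0 0 1 W)"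
    unfolding F'[symmetric] using FL W by (simp add: E1_add laurent3_add laurent3_shift)
  then show "E1 F = 0" using W by (simp add: E1_shift)
qed

lemma E1_diff: "G \<in> laurent3 \<Longrightarrow> H \<in> laurent3 \<Longrightarrow> E1 (G - H) = E1 G - E1 H"
  for G H :: "int \<Rightarrow> int \<Rightarrow> int \<Rightarrow> 'v::comm_ring_1"
  using E1_add[of G "- H"] by (simp add: E1_uminus laurent3_uminus)

text \<open>Modulo \<open>vlm_null\<close>, the representative of the first term is determined by the other two.\<close>

lemma vlm_identity_iff:
  fixes T1 T2 T3 :: "'v::comm_ring_1 fls fls"
  shows "vlm_identity T1 T2 T3 \<longleftrightarrow>
    (\<exists>Y\<in>laurent3. \<exists>Z\<in>laurent3. E2 Y = T2 \<and> E3 Z = T3 \<and> E1 Y - E1 Z = T1)"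
proof
  assume "vlm_identity T1 T2 T3"
  then obtain X Y Z where *: "X \<in> laurent3" "Y \<in> laurent3" "Z \<in> laurent3" "E1 X = T1" "E2 Y = T2" "E3 Z = T3"
    "(\<lambda>a b c. X a b c - Y a b c + Z a b c) \<in> vlm_null"
    unfolding vlm_identity_def by blast
  have eq: "(\<lambda>a b c. X a b c - Y a b c + Z a b c) = X - (Y - Z)" by (simp add: fun_eq_iff)
  have "E1 X - (E1 Y - E1 Z) = 0"
    using E1_vlm_null(1)[OF *(7)] *(1-3) unfolding eq by (simp add: E1_diff laurent3_diff)
  then show "\<exists>Y\<in>laurent3. \<exists>Z\<in>laurent3. E2 Y = T2 \<and> E3 Z = T3 \<and> E1 Y - E1 Z = T1"
    using * by auto
next
  assume "\<exists>Y\<in>laurent3. \<exists>Z\<in>laurent3. E2 Y = T2 \<and> E3 Z = T3 \<and> E1 Y - E1 Z = T1"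
  then obtain Y Z where *: "Y \<in> laurent3" "Z \<in> laurent3" "E2 Y = T2" "E3 Z = T3" "E1 Y - E1 Z = T1" by blast
  \<comment> \<open>For \<open>X = Y - Z\<close> the signed sum is literally zero, the image of
    zero.\<close>
  have "(\<lambda>a b c. (Y - Z) a b c - Y a b c + Z a b c) \<in> vlm_null"
    unfolding vlm_null_def by (rule image_eqI[of _ _ "\<lambda>_ _ _. 0"]) (auto simp: laurent3_zero)
  then show "vlm_identity T1 T2 T3"
    unfolding vlm_identity_def using *
    by (intro bexI[of _ "Y - Z"] bexI[of _ Y] bexI[of _ Z]) (simp_all add: E1_diff laurent3_diff)
qed

section \<open>Series of series, degree bounds and triple sums\<close>

lemma psd_le_times:
  fixes A B :: "'a::comm_ring_1 fls"
  assumes "psd_le s A" "psd_le t B"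
  shows "psd_le (s + t) (A * B)"
proof (cases "A * B = 0")
  case False
  then have "A \<noteq> 0" "B \<noteq> 0" by auto
  then have "psd_order A \<le> s" "psd_order B \<le> t" using assms psd_order_le by auto
  moreover have "psd_order (A * B) \<le> psd_order A + psd_order B"
    using fls_mult_subdegree_ge[OF False] by (simp add: psd_order_def)
  ultimately show ?thesis using psd_le_mono[OF psd_le_order[of "A * B"], of "s + t"] by linarith
qed (simp add: psd_le_def)

text \<open>This concerns the product of symbols, not composition. It makes the coefficientwise
  derivation a derivation of \<open>'v fls\<close>, the coefficient ring of operators in the outer
  variable.\<close>

lemma psd_map_leibniz:
  fixes A B :: "'a::comm_ring_1 fls"
  assumes \<delta>: "additive \<delta>1" "additive \<delta>2" "additive \<delta>"
    and leibniz: "\<And>a b. \<delta> (a * b) = \<delta>1 a * b + a * \<delta>2 b"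
  shows "psd_map \<delta> (A * B) = psd_map \<delta>1 A * B + A * psd_map \<delta>2 B"
proof -
  have X: "psd_map \<eta> (fls_X_inv * A) = fls_X_inv * psd_map \<eta> A" "psd_map \<eta> (fls_X * A) = fls_X * psd_map \<eta> A"
    if "additive \<eta>" for \<eta> :: "'a \<Rightarrow> 'a" and A :: "'a fls"
    using that by (auto intro!: psd_eqI)
  have c: "psd_map \<eta> (fls_const a) = fls_const (\<eta> a)" if "additive \<eta>" for \<eta> :: "'a \<Rightarrow> 'a" and a :: 'a
    using that by (auto intro!: psd_eqI simp: additive.zero)
  show ?thesis
  proof (induction A rule: psd_induct)
    case (const a)
    then show ?case using \<delta> by (auto intro!: psd_eqI simp: c leibniz)
  next
    case (add A C)
    then show ?case using \<delta> by (simp add: additive.add[OF psd_map_additive] algebra_simps)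
  next
    case (up A)
    then show ?case using \<delta> by (simp add: X mult.assoc distrib_left)
  next
    case (down A)
    then show ?case using \<delta> by (simp add: X mult.assoc distrib_left)
  next
    case (limit A)
    have "psd_le (s + psd_order B) (psd_map \<delta> (A * B)) \<and> psd_le (s + psd_order B) (psd_map \<delta>1 A * B + A * psd_map \<delta>2 B)"
      if "psd_le s A" for s A
      using \<delta> that by (intro conjI psd_le_map psd_le_add psd_le_times psd_le_order) auto
    then show ?case
    proof (rule psd_eq_limit_additive[where A = A and L = "\<lambda>A. psd_map \<delta> (A * B)", rotated 2])
      show "additive (\<lambda>A. psd_map \<delta> (A * B))" "additive (\<lambda>A. psd_map \<delta>1 A * B + A * psd_map \<delta>2 B)"
        using \<delta> by (auto simp: additive_def additive.add[OF psd_map_additive] algebra_simps)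
    qed (use limit in auto)
  qed
qed

lemma psd_map_psd_map: "additive f \<Longrightarrow> additive g \<Longrightarrow> psd_map f (psd_map g A) = psd_map (\<lambda>x. f (g x)) A"
  by (rule psd_eqI) (simp add: additive_comp)

lemma psd_map_plus: "additive f \<Longrightarrow> additive g \<Longrightarrow> psd_map (\<lambda>x. f x + g x) A = psd_map f A + psd_map g A"
  by (rule psd_eqI) (simp add: additive_map2)

lemma psd_map_X_inv_right: "additive f \<Longrightarrow> psd_map f (fls_X_inv * G) = fls_X_inv * psd_map f G"
  for f :: "'a::comm_ring_1 \<Rightarrow> 'b::comm_ring_1"
  by (rule psd_eqI) simp

lemma psd_map_inject:
  assumes "additive f" "\<And>x y. f x = f y \<longleftrightarrow> x = y"
  shows "psd_map f G = psd_map f H \<longleftrightarrow> G = H"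
proof
  assume eq: "psd_map f G = psd_map f H"
  show "G = H"
  proof (rule psd_eqI)
    fix n
    have "psd_coeff (psd_map f G) n = psd_coeff (psd_map f H) n" by (simp only: eq)
    then show "psd_coeff G n = psd_coeff H n" using assms by simp
  qed
qed simp

lemma X_inv_inject: "fls_X_inv * A = fls_X_inv * B \<longleftrightarrow> A = B" for A B :: "'a::comm_ring_1 fls"
  by (metis fls_X_inv_mult_fls_X(2))

lemma psd_map_sum: "(\<And>x. x \<in> I \<Longrightarrow> additive (f x)) \<Longrightarrow> psd_map (\<lambda>g. \<Sum>x\<in>I. f x g) G = (\<Sum>x\<in>I. psd_map (f x) G)"
  for f :: "'x \<Rightarrow> 'a::comm_ring_1 \<Rightarrow> 'b::comm_ring_1"
proof (rule psd_eqI)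
  fix n assume f: "\<And>x. x \<in> I \<Longrightarrow> additive (f x)"
  then have "additive (\<lambda>g. \<Sum>x\<in>I. f x g)" by (simp add: additive_def sum.distrib)
  then show "psd_coeff (psd_map (\<lambda>g. \<Sum>x\<in>I. f x g) G) n = psd_coeff (\<Sum>x\<in>I. psd_map (f x) G) n"
    using f by (simp add: psd_coeff_sum)
qed

lemma psd_le_sum: "(\<And>x. x \<in> I \<Longrightarrow> psd_le s (f x)) \<Longrightarrow> psd_le s (\<Sum>x\<in>I. f x)"
  for f :: "_ \<Rightarrow> 'v::comm_ring_1 fls"
  by (simp add: psd_le_def psd_coeff_sum)

lemma tri_deg_ex: "F \<in> laurent3 \<Longrightarrow> \<exists>s. tri_deg s F"
proof -
  assume "F \<in> laurent3"
  then obtain N where N: "tri_le N F" by (auto simp: laurent3_iff)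
  have "a + b + c \<le> 3 * N" if "F a b c \<noteq> 0" for a b c
    using N that unfolding tri_le_def by fastforce
  then show ?thesis unfolding tri_deg_def by blast
qed

lemma deg2_row: "deg2 t G \<longleftrightarrow> (\<forall>q. psd_le (t - q) (psd_coeff G q))"
  unfolding deg2_def psd_le_def by (metis add.commute less_diff_eq diff_less_eq)

lemma deg2_psd_map:
  fixes f :: "'v::comm_ring_1 fls \<Rightarrow> 'v fls"
  assumes "psd_bounded k f" "deg2 t G" shows "deg2 (t + k) (psd_map f G)"
proof -
  have "psd_coeff (psd_map f G) q = f (psd_coeff G q)" for q
    using assms(1) by (simp add: psd_bounded_def psd_coeff_map)
  moreover have "psd_le (t - q + k) (f (psd_coeff G q))" for q
    using assms by (simp add: psd_bounded_def deg2_row)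
  ultimately show ?thesis by (simp add: deg2_row add_diff_eq diff_add_eq)
qed

lemma laurent3_additive_sum3:
  fixes L :: "(int \<Rightarrow> int \<Rightarrow> int \<Rightarrow> 'v::comm_ring_1) \<Rightarrow> 'b::ab_group_add"
  assumes L: "\<And>F G. F \<in> laurent3 \<Longrightarrow> G \<in> laurent3 \<Longrightarrow> L (F + G) = L F + L G"
    and f: "\<And>l q p. f l q p \<in> laurent3"
  shows "L (- (\<Sum>l\<in>I. \<Sum>q\<in>I. \<Sum>p\<in>I. f l q p)) = - (\<Sum>l\<in>I. \<Sum>q\<in>I. \<Sum>p\<in>I. L (f l q p))"
proof -
  have 1: "(\<Sum>p\<in>I. f l q p) \<in> laurent3" for l q by (intro laurent3_sum f)
  have 2: "(\<Sum>q\<in>I. \<Sum>p\<in>I. f l q p) \<in> laurent3" for l by (intro laurent3_sum f)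
  have 3: "(\<Sum>l\<in>I. \<Sum>q\<in>I. \<Sum>p\<in>I. f l q p) \<in> laurent3" by (intro laurent3_sum f)
  have a: "L (\<Sum>p\<in>I. f l q p) = (\<Sum>p\<in>I. L (f l q p))" for l q
    by (rule laurent3_additive(3)[where L = L], rule L, assumption, assumption, rule f)
  have b: "L (\<Sum>q\<in>I. \<Sum>p\<in>I. f l q p) = (\<Sum>q\<in>I. L (\<Sum>p\<in>I. f l q p))" for l
    by (rule laurent3_additive(3)[where L = L], rule L, assumption, assumption, rule 1)
  have c: "L (\<Sum>l\<in>I. \<Sum>q\<in>I. \<Sum>p\<in>I. f l q p) = (\<Sum>l\<in>I. L (\<Sum>q\<in>I. \<Sum>p\<in>I. f l q p))"
    by (rule laurent3_additive(3)[where L = L], rule L, assumption, assumption, rule 2)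
  have "L (- (\<Sum>l\<in>I. \<Sum>q\<in>I. \<Sum>p\<in>I. f l q p)) = - L (\<Sum>l\<in>I. \<Sum>q\<in>I. \<Sum>p\<in>I. f l q p)"
    by (rule laurent3_additive(2)[where L = L], rule L, assumption, assumption, rule 3)
  then show ?thesis by (simp only: a b c)
qed

lemma E_sum3:
  fixes f :: "'i \<Rightarrow> 'i \<Rightarrow> 'i \<Rightarrow> int \<Rightarrow> int \<Rightarrow> int \<Rightarrow> 'v::comm_ring_1"
  assumes "\<And>l q p. f l q p \<in> laurent3"
  shows E1_sum3: "E1 (- (\<Sum>l\<in>I. \<Sum>q\<in>I. \<Sum>p\<in>I. f l q p)) = - (\<Sum>l\<in>I. \<Sum>q\<in>I. \<Sum>p\<in>I. E1 (f l q p))"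
    and E2_sum3: "E2 (- (\<Sum>l\<in>I. \<Sum>q\<in>I. \<Sum>p\<in>I. f l q p)) = - (\<Sum>l\<in>I. \<Sum>q\<in>I. \<Sum>p\<in>I. E2 (f l q p))"
    and E3_sum3: "E3 (- (\<Sum>l\<in>I. \<Sum>q\<in>I. \<Sum>p\<in>I. f l q p)) = - (\<Sum>l\<in>I. \<Sum>q\<in>I. \<Sum>p\<in>I. E3 (f l q p))"
  by (rule laurent3_additive_sum3, rule E1_add E2_add E3_add, assumption, assumption, rule assms)+

text \<open>Renames summation indices to match the permuted indices of the second and third
  terms.\<close>

lemma sum3_swap:
  fixes g :: "'i::finite \<Rightarrow> 'i \<Rightarrow> 'i \<Rightarrow> 'b::comm_monoid_add"
  shows "(\<Sum>l\<in>UNIV. \<Sum>q\<in>UNIV. \<Sum>p\<in>UNIV. g q l p) = (\<Sum>l\<in>UNIV. \<Sum>q\<in>UNIV. \<Sum>p\<in>UNIV. g l q p)"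
    and "(\<Sum>l\<in>UNIV. \<Sum>q\<in>UNIV. \<Sum>p\<in>UNIV. g p l q) = (\<Sum>l\<in>UNIV. \<Sum>q\<in>UNIV. \<Sum>p\<in>UNIV. g l q p)"
proof -
  show 1: "(\<Sum>l\<in>UNIV. \<Sum>q\<in>UNIV. \<Sum>p\<in>UNIV. g q l p) = (\<Sum>l\<in>UNIV. \<Sum>q\<in>UNIV. \<Sum>p\<in>UNIV. g l q p)" for g :: "'i \<Rightarrow> 'i \<Rightarrow> 'i \<Rightarrow> 'b"
    by (rule sum.swap)
  have "(\<Sum>l\<in>UNIV. \<Sum>q\<in>UNIV. \<Sum>p\<in>UNIV. g p l q) = (\<Sum>l\<in>UNIV. \<Sum>p\<in>UNIV. \<Sum>q\<in>UNIV. g p l q)"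
    by (intro sum.cong refl sum.swap)
  also have "\<dots> = (\<Sum>l\<in>UNIV. \<Sum>q\<in>UNIV. \<Sum>p\<in>UNIV. g l q p)"
    by (rule sum.swap)
  finally show "(\<Sum>l\<in>UNIV. \<Sum>q\<in>UNIV. \<Sum>p\<in>UNIV. g p l q) = (\<Sum>l\<in>UNIV. \<Sum>q\<in>UNIV. \<Sum>p\<in>UNIV. g l q p)" .
qed

lemma E3_uminus: "F \<in> laurent3 \<Longrightarrow> E3 (- F) = - E3 F" for F :: "int \<Rightarrow> int \<Rightarrow> int \<Rightarrow> 'v::comm_ring_1"
  by (rule laurent3_additive(2), rule E3_add)

section \<open>The action of operators on the three slots\<close>

locale derivation_ring =
  fixes d :: "'v::comm_ring_1 \<Rightarrow> 'v"
  assumes d_additive [simp]: "additive d"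
    and d_mult: "d (a * b) = d a * b + a * d b"
begin

abbreviation "D \<equiv> psd_map d"
abbreviation "\<delta> \<equiv> psd_up d"
abbreviation "hat \<equiv> psd_map fls_const :: 'v fls \<Rightarrow> 'v fls fls"
abbreviation "adj \<equiv> psd_adjoint d"

text \<open>
  On \<open>\<V>((\<lambda>\<^sup>-\<^sup>1))((\<mu>\<^sup>-\<^sup>1))\<close> the next three operators send \<open>G(\<lambda>,\<mu>)\<close> to \<open>G(\<lambda>+\<partial>,\<mu>) P(\<lambda>)\<close>,
  \<open>G(\<lambda>,\<mu>+\<partial>) Q(\<mu>)\<close> and \<open>A(\<lambda>+\<mu>+\<partial>) G(\<lambda>,\<mu>)\<close>, where in the first two \<open>\<partial>\<close> acts on \<open>P\<close>, \<open>Q\<close> only.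
  Here \<open>\<delta> = \<lambda>+\<partial>\<close>.
\<close>

definition phi1 :: "'v fls \<Rightarrow> 'v fls fls \<Rightarrow> 'v fls fls" where
  "phi1 P G = psd_map (\<lambda>g. psd_mult d g P) G"

definition phi2 :: "'v fls \<Rightarrow> 'v fls fls \<Rightarrow> 'v fls fls" where
  "phi2 Q G = psd_mult D G (hat Q)"

definition phi3 :: "'v fls \<Rightarrow> 'v fls fls \<Rightarrow> 'v fls fls" where
  "phi3 A G = psd_mult \<delta> (hat A) G"

text \<open>On rows in \<nu> the action is plain composition from the left, which is why this slot
  is the basis for the other two.\<close>

definition nphi3 :: "'v fls \<Rightarrow> (int \<Rightarrow> int \<Rightarrow> int \<Rightarrow> 'v) \<Rightarrow> int \<Rightarrow> int \<Rightarrow> int \<Rightarrow> 'v" where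
  "nphi3 A = nu_map (psd_mult d A)"

text \<open>
  \<open>theta\<close> substitutes \<open>\<mu> \<mapsto> -\<nu>-\<partial>\<close> and \<open>\<nu> \<mapsto> -\<mu>-\<partial>\<close>, with \<open>\<partial>\<close> acting on the coefficients. It conjugates the
  action on the \<open>\<mu>\<close>-slot into that on the \<open>\<nu>\<close>-slot, and exchanges the last two expansions.
\<close>

definition theta :: "(int \<Rightarrow> int \<Rightarrow> int \<Rightarrow> 'v) \<Rightarrow> int \<Rightarrow> int \<Rightarrow> int \<Rightarrow> 'v" where
  "theta F = nu_map adj (swap_mn (nu_map adj F))"

definition nphi2 :: "'v fls \<Rightarrow> (int \<Rightarrow> int \<Rightarrow> int \<Rightarrow> 'v) \<Rightarrow> int \<Rightarrow> int \<Rightarrow> int \<Rightarrow> 'v" where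
  "nphi2 Q F = theta (nphi3 (adj Q) (theta F))"

definition nphi1 :: "'v fls \<Rightarrow> (int \<Rightarrow> int \<Rightarrow> int \<Rightarrow> 'v) \<Rightarrow> int \<Rightarrow> int \<Rightarrow> int \<Rightarrow> 'v" where
  "nphi1 P F = swap_lm (nphi2 P (swap_lm F))"

section \<open>Boundedness and algebra of the lifted actions\<close>

lemma D_additive [simp]: "additive D"
  by (rule psd_map_additive) simp

lemma \<delta>_additive [simp]: "additive \<delta>"
  by (rule psd_up_additive) simp

lemma D_mult: "D (a * b) = D a * b + a * D b"
  by (rule psd_map_leibniz) (auto simp: d_mult)

text \<open>\<lambda> is multiplied in only once, so it may go to either factor. These are the mixed
  Leibniz rules that associativity and adjoints ask for.\<close>

lemma \<delta>_mult: "\<delta> (a * b) = D a * b + a * \<delta> b" "\<delta> (a * b) = \<delta> a * b + a * D b"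
  by (simp_all add: psd_up_def D_mult algebra_simps)

lemma D_const [simp]: "D (fls_const a) = fls_const (d a)"
  by (auto intro!: psd_eqI simp: additive.zero)

lemma hat_const [simp]: "hat (fls_const a) = fls_const (fls_const a)"
  by (auto intro!: psd_eqI)

lemma hat_X_inv: "hat (fls_X_inv * A) = fls_X_inv * hat A"
  by (auto intro!: psd_eqI)

lemma hat_additive [simp]: "additive hat"
  by (rule psd_map_additive) simp

lemma hat_mult: "hat (psd_mult d A B) = psd_mult D (hat A) (hat B)"
  by (rule psd_map_mult_hom) (auto simp: fls_const_mult_const)

lemma hat_adj: "hat (adj A) = psd_adjoint D (hat A)"
  by (rule psd_adjoint_map) auto

lemma psd_bounded_mult: "psd_bounded (psd_order A) (psd_mult d A)"
  unfolding psd_bounded_def using psd_mult_le[OF d_additive psd_le_order[of A]]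
  by (simp add: additive.zero[OF psd_mult_additive_right] add.commute)

lemma psd_bounded_adj: "psd_bounded 0 adj"
  unfolding psd_bounded_def using psd_adjoint_le[OF d_additive]
  by (simp add: additive.zero[OF psd_adjoint_additive])

lemma psd_bounded_D: "psd_bounded 0 D"
  by (simp add: psd_bounded_def psd_le_map additive.zero[OF D_additive])

lemma laurent3_nphi3 [simp]: "F \<in> laurent3 \<Longrightarrow> nphi3 A F \<in> laurent3"
  unfolding nphi3_def by (rule laurent3_nu_map[OF psd_bounded_mult])

lemma laurent3_adj [simp]: "F \<in> laurent3 \<Longrightarrow> nu_map adj F \<in> laurent3"
  by (rule laurent3_nu_map[OF psd_bounded_adj])

lemma laurent3_theta [simp]: "F \<in> laurent3 \<Longrightarrow> theta F \<in> laurent3"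
  unfolding theta_def by (simp add: laurent3_swap)

lemma laurent3_D [simp]: "F \<in> laurent3 \<Longrightarrow> nu_map D F \<in> laurent3"
  by (rule laurent3_nu_map[OF psd_bounded_D])

lemma laurent3_nphi2 [simp]: "F \<in> laurent3 \<Longrightarrow> nphi2 A F \<in> laurent3"
  by (simp add: nphi2_def)

lemma laurent3_nphi1 [simp]: "F \<in> laurent3 \<Longrightarrow> nphi1 A F \<in> laurent3"
  by (simp add: nphi1_def laurent3_swap)

lemma nu_map_id: "F \<in> laurent3 \<Longrightarrow> nu_map (\<lambda>A. A) F = F"
  by (simp add: nu_map_def fun_eq_iff psd_coeff_row)

lemma theta_theta [simp]:
  assumes "F \<in> laurent3"
  shows "theta (theta F) = F"
  using assms by (simp add: theta_def nu_map_id laurent3_swap)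

lemma theta_add: "F \<in> laurent3 \<Longrightarrow> G \<in> laurent3 \<Longrightarrow> theta (F + G) = theta F + theta G"
  by (simp add: theta_def nu_map_add psd_adjoint_additive swap_add laurent3_swap)

lemma theta_const: "theta (tri_const f) = tri_const f"
proof -
  have "nu_map adj (tri_const f) = tri_const f"
  proof (intro ext)
    fix a b c
    have "Psd (tri_const f a b) = (if a = 0 \<and> b = 0 then fls_const f else 0)"
      by (rule psd_eqI) (auto simp: psd_coeff_row laurent3_const, auto simp: tri_const_def)
    then show "nu_map adj (tri_const f) a b c = tri_const f a b c"
      by (auto simp: nu_map_def tri_const_def additive.zero[OF psd_adjoint_additive])
  qed
  then show ?thesis by (simp add: theta_def swap_const)
qed

lemma tri_deg_theta: "F \<in> laurent3 \<Longrightarrow> tri_deg s F \<Longrightarrow> tri_deg s (theta F)"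
  unfolding theta_def
  using tri_deg_nu_map[OF psd_bounded_adj] by (simp add: tri_deg_swap laurent3_swap)

lemma nu_\<delta>: "F \<in> laurent3 \<Longrightarrow> nu_map \<delta> F = tri_shift 0 0 1 F + nu_map D F"
  unfolding nu_map_X_inv[symmetric]
  by (simp add: nu_map_def fun_eq_iff psd_up_def)

lemma nu_map_minus: "nu_map (\<lambda>A. - f A) F = - nu_map f F" for f :: "'v fls \<Rightarrow> 'v fls"
  by (simp add: nu_map_def fun_eq_iff)

lemma nu_adj_shift: "F \<in> laurent3 \<Longrightarrow> nu_map adj (tri_shift 0 0 1 F) = - nu_map \<delta> (nu_map adj F)"
  unfolding nu_map_X_inv[symmetric] by (simp add: psd_adjoint_X_inv nu_map_minus)

lemma adj_D: "adj (D A) = D (adj A)"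
  by (rule psd_adjoint_map[symmetric]) auto

lemma nu_D_swap: "F \<in> laurent3 \<Longrightarrow> nu_map D (swap_mn F) = swap_mn (nu_map D F)"
proof (intro ext)
  fix a b c assume F: "F \<in> laurent3"
  show "nu_map D (swap_mn F) a b c = swap_mn (nu_map D F) a b c"
    using psd_coeff_row[OF laurent3_swap(2)[OF F]] psd_coeff_row[OF F] by (simp add: nu_map_def swap_mn_def)
qed

lemma swap_mn_uminus: "swap_mn (- F) = - swap_mn F" for F :: "int \<Rightarrow> int \<Rightarrow> int \<Rightarrow> 'v"
  by (simp add: swap_mn_def fun_eq_iff)

lemma nu_adj_uminus: "F \<in> laurent3 \<Longrightarrow> nu_map adj (- F) = - nu_map adj F"
  by (rule laurent3_additive(2), rule nu_map_add[OF psd_adjoint_additive[OF d_additive]])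

text \<open>An adjoint turns \<nu> into -(\<nu>+\<partial>), and \<open>swap_mn\<close> exchanges
  \<mu> and \<nu>. The part with \<partial> acts on coefficients and commutes with both.\<close>

lemma theta_shift:
  assumes F: "F \<in> laurent3"
  shows "theta (tri_shift 1 0 0 F) = tri_shift 1 0 0 (theta F)"
    and "theta (tri_shift 0 1 0 F) = - (tri_shift 0 0 1 (theta F) + nu_map D (theta F))"
    and "theta (tri_shift 0 0 1 F) = - (tri_shift 0 1 0 (theta F) + nu_map D (theta F))"
proof -
  show "theta (tri_shift 1 0 0 F) = tri_shift 1 0 0 (theta F)"
    by (simp add: theta_def nu_map_shift swap_mn_shift)
  have "theta (tri_shift 0 1 0 F) = - nu_map \<delta> (theta F)"
    using F by (simp only: theta_def nu_map_shift swap_mn_shift nu_adj_shift laurent3_adj laurent3_swap)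
  then show "theta (tri_shift 0 1 0 F) = - (tri_shift 0 0 1 (theta F) + nu_map D (theta F))"
    using F by (simp add: nu_\<delta>)
  let ?H = "nu_map adj F"
  have "theta (tri_shift 0 0 1 F) = nu_map adj (swap_mn (- (tri_shift 0 0 1 ?H + nu_map D ?H)))"
    using F by (simp only: theta_def nu_adj_shift nu_\<delta> laurent3_adj)
  also have "\<dots> = - (nu_map adj (tri_shift 0 1 0 (swap_mn ?H)) + nu_map adj (nu_map D (swap_mn ?H)))"
    using F by (simp only: swap_mn_uminus swap_add swap_mn_shift nu_D_swap laurent3_adj laurent3_shift laurent3_swap
        laurent3_D laurent3_add nu_adj_uminus nu_map_add psd_adjoint_additive d_additive)
  also have "\<dots> = - (tri_shift 0 1 0 (theta F) + nu_map D (theta F))"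
    by (simp add: theta_def nu_map_shift adj_D)
  finally show "theta (tri_shift 0 0 1 F) = - (tri_shift 0 1 0 (theta F) + nu_map D (theta F))" .
qed

section \<open>The \<nu>-slot in the expansions\<close>

lemma E1_\<delta>: "F \<in> laurent3 \<Longrightarrow> E1 (nu_map \<delta> F) = psd_up \<delta> (E1 F)"
  by (rule psd_eqI2) (simp add: nu_\<delta> E1_add laurent3_shift E1_shift E1_nu_psd_map psd_up_def)

text \<open>Here \<nu> is the inner variable, so \<nu>+\<partial> acts on it alone; in the first
  expansion it became \<mu>+(\<lambda>+\<partial>), which is \<open>psd_up \<delta>\<close>.\<close>

lemma E3_\<delta>: "F \<in> laurent3 \<Longrightarrow> E3 (nu_map \<delta> F) = psd_map \<delta> (E3 F)"
  by (rule psd_eqI2) (simp add: nu_\<delta> E3_add laurent3_shift E3_shift E3_nu_psd_map, simp add: psd_up_def)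

lemma nphi3_X_inv: "nphi3 (fls_X_inv * A) F = nphi3 A (nu_map \<delta> F)"
proof -
  have "psd_mult d (fls_X_inv * A) = (\<lambda>B. psd_mult d A (\<delta> B))"
    by (rule ext) (simp add: psd_mult_X_inv_left)
  then show ?thesis by (simp add: nphi3_def)
qed

lemma nphi3_X: "nphi3 (fls_X * A) (nu_map \<delta> F) = nphi3 A F"
  by (simp add: nphi3_X_inv[symmetric] fls_X_inv_mult_fls_X)

lemma nu_\<delta>_surj:
  assumes "F \<in> laurent3"
  obtains G where "G \<in> laurent3" "F = nu_map \<delta> G"
proof
  \<comment> \<open>The preimage is the inverse of \<partial> applied in the \<nu>-slot.\<close>
  show "nphi3 fls_X F \<in> laurent3" using assms by simp
  show "F = nu_map \<delta> (nphi3 fls_X F)"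
    using assms by (simp add: nphi3_def psd_up_mult_X nu_map_id)
qed

lemma nphi3_add_left:
  "nphi3 (A + B) F = nphi3 A F + nphi3 B F"
  by (simp add: nphi3_def nu_map_def fun_eq_iff additive.add[OF psd_mult_additive_left])

lemma tri_deg_nphi3:
  assumes "psd_le k A" "F \<in> laurent3" "tri_deg s F"
  shows "tri_deg (s + k) (nphi3 A F)"
  unfolding nphi3_def
proof (rule tri_deg_nu_map[OF _ assms(2,3)])
  show "psd_bounded k (psd_mult d A)"
    unfolding psd_bounded_def using psd_mult_le[OF d_additive assms(1)]
    by (simp add: additive.zero[OF psd_mult_additive_right] add.commute)
qed

text \<open>The induction on \<open>A\<close> shared by the first and third expansions: intertwining
  for constants and for \<partial> suffices. Surjectivity of \<open>nu_map \<delta>\<close> handles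
  the inverse of \<partial>, and the bounds on total degree handle limits.\<close>

lemma nphi3_transport:
  assumes const: "\<And>a F. F \<in> laurent3 \<Longrightarrow> E (nu_map (\<lambda>A. fls_const a * A) F) = \<Psi> (fls_const a) (E F)"
    and up: "\<And>A F. F \<in> laurent3 \<Longrightarrow> \<Psi> (fls_X_inv * A) (E F) = \<Psi> A (E (nu_map \<delta> F))"
    and E_add: "\<And>F G. F \<in> laurent3 \<Longrightarrow> G \<in> laurent3 \<Longrightarrow> E (F + G) = E F + E G"
    and E_deg: "\<And>F s. F \<in> laurent3 \<Longrightarrow> tri_deg s F \<Longrightarrow> deg2 s (E F)"
    and \<Psi>_add: "\<And>G. additive (\<lambda>A. \<Psi> A G)"
    and \<Psi>_deg: "\<And>A G s t. psd_le s A \<Longrightarrow> deg2 t G \<Longrightarrow> deg2 (t + s) (\<Psi> A G)"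
    and F: "F \<in> laurent3"
  shows "E (nphi3 A F) = (\<Psi> A (E F) :: 'v fls fls)"
  using F
proof (induction A arbitrary: F rule: psd_induct)
  case (const a)
  have "psd_mult d (fls_const a) = (\<lambda>B. fls_const a * B)" by (rule ext) simp
  then show ?case using assms(1)[OF const, of a] by (simp add: nphi3_def)
next
  case (add A B)
  show ?case
    unfolding nphi3_add_left E_add[OF laurent3_nphi3[OF add(3)] laurent3_nphi3[OF add(3)]]
      additive.add[OF \<Psi>_add] add(1)[OF add(3)] add(2)[OF add(3)] ..
next
  case (up A)
  have "nu_map \<delta> F \<in> laurent3" using up(2) by (simp add: nu_\<delta> laurent3_add laurent3_shift)
  then show ?case using up assms(2) by (simp add: nphi3_X_inv)
next
  case (down A)
  obtain G where G: "G \<in> laurent3" "F = nu_map \<delta> G" by (rule nu_\<delta>_surj[OF down(2)])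
  have "E (nphi3 (fls_X * A) F) = \<Psi> A (E G)" using down(1) G by (simp add: nphi3_X)
  also have "\<dots> = \<Psi> (fls_X_inv * (fls_X * A)) (E G)" by (simp add: fls_X_inv_mult_fls_X)
  also have "\<dots> = \<Psi> (fls_X * A) (E F)" unfolding G(2) by (rule up[OF G(1)])
  finally show ?case .
next
  case (limit A)
  show ?case
  proof (rule deg2_eqI)
    fix s
    obtain t where t: "tri_deg t F" using tri_deg_ex[OF limit(2)] by blast
    \<comment> \<open>As \<open>F\<close> has degree at most \<open>t\<close>, an error of order
      \<open>s - t\<close> in \<open>A\<close> becomes one of degree \<open>s\<close>.\<close>
    obtain B where B: "E (nphi3 B F) = \<Psi> B (E F)" "psd_le (s - t) (A - B)"
      using limit by blast
    have AB: "B + (A - B) = A" by simp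
    have "E (nphi3 (B + (A - B)) F) = E (nphi3 B F) + E (nphi3 (A - B) F)"
      unfolding nphi3_add_left by (rule E_add[OF laurent3_nphi3[OF limit(2)] laurent3_nphi3[OF limit(2)]])
    then have "E (nphi3 A F) = E (nphi3 B F) + E (nphi3 (A - B) F)"
      unfolding AB .
    then have "E (nphi3 A F) - \<Psi> A (E F) = E (nphi3 (A - B) F) - \<Psi> (A - B) (E F)"
      using B(1) by (simp add: additive.diff[OF \<Psi>_add])
    moreover have "deg2 s (E (nphi3 (A - B) F))"
      using E_deg tri_deg_nphi3[OF B(2) limit(2) t] limit(2) by simp
    moreover have "deg2 s (\<Psi> (A - B) (E F))"
      using \<Psi>_deg[OF B(2) E_deg[OF limit(2) t]] by simp
    ultimately show "deg2 s (E (nphi3 A F) - \<Psi> A (E F))" by (simp add: deg2_diff)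
  qed
qed

lemma psd_le_\<delta>_pow: "psd_le u g \<Longrightarrow> psd_le (u + int j) ((\<delta> ^^ j) g)"
proof (induction j)
  case (Suc j)
  then show ?case using psd_le_up[OF d_additive, of "u + int j" "(\<delta> ^^ j) g"] by (simp add: add_ac)
qed simp

text \<open>Each factor \<lambda>+\<partial> arising from the operator raises the degree in
  \<lambda> by at most one and costs one power of the outer variable, so total degree is controlled
  although the separate degrees are not.\<close>

lemma deg2_phi3:
  assumes A: "psd_le s A" and G: "deg2 t G"
  shows "deg2 (t + s) (phi3 A G)"
  unfolding deg2_row
proof
  fix q
  let ?s = "psd_order G"
  have hat: "psd_le s (hat A)" using A by (simp add: psd_le_def)
  have "psd_le (t + s - q) (psd_coeff (hat A) m * of_int (int_binomial m j) * (\<delta> ^^ j) (psd_coeff G (q - m + int j)))"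
    if "m \<le> s" for m j
  proof -
    have "psd_le (t - (q - m + int j) + int j) ((\<delta> ^^ j) (psd_coeff G (q - m + int j)))"
      using G by (intro psd_le_\<delta>_pow) (simp add: deg2_row)
    then have "psd_le (t + s - q) ((\<delta> ^^ j) (psd_coeff G (q - m + int j)))"
      by (rule psd_le_mono) (use that in simp)
    then show ?thesis by (simp add: psd_le_def mult.assoc)
  qed
  then show "psd_le (t + s - q) (psd_coeff (phi3 A G) q)"
    unfolding phi3_def
    by (subst psd_coeff_mult_box[OF \<delta>_additive hat psd_le_order[of G] order_refl, of q "nat (?s - q + s)"])
       (auto intro!: psd_le_sum)
qed

lemma psd_map_\<delta>: "psd_map \<delta> G = psd_map (\<lambda>g. fls_X_inv * g) G + psd_map D G"
  unfolding psd_up_def by (rule psd_map_plus) auto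

lemma uminus_additive_\<delta>: "additive (\<lambda>x. - \<delta> x)"
  by (rule additive_uminus) simp

lemma adj_additive [simp]: "additive adj"
  by (rule psd_adjoint_additive) simp

lemma adj\<delta>_additive [simp]: "additive (psd_adjoint \<delta>)"
  by (rule psd_adjoint_additive) simp

lemma mult_left_additive [simp]: "additive (\<lambda>g. psd_mult d g P)"
  by (rule psd_mult_additive_left) simp

lemma mult_right_additive [simp]: "additive (psd_mult d P)"
  by (rule psd_mult_additive_right) simp

lemma E1_nphi3: "F \<in> laurent3 \<Longrightarrow> E1 (nphi3 A F) = phi3 A (E1 F)"
proof (rule nphi3_transport)
  fix a :: 'v and F :: "int \<Rightarrow> int \<Rightarrow> int \<Rightarrow> 'v" assume F: "F \<in> laurent3"
  \<comment> \<open>Multiplication by a constant acts on each coefficient separately, and the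
    expansion commutes with such maps.\<close>
  have "(\<lambda>A. fls_const a * A) = psd_map (\<lambda>x. a * x)" by (intro ext psd_eqI) simp
  then have "E1 (nu_map (\<lambda>A. fls_const a * A) F) = psd_map (psd_map (\<lambda>x. a * x)) (E1 F)"
    using E1_nu_psd_map[OF additive_mult(1) F] by simp
  also have "\<dots> = phi3 (fls_const a) (E1 F)"
    by (rule psd_eqI2) (simp add: phi3_def psd_map_additive)
  finally show "E1 (nu_map (\<lambda>A. fls_const a * A) F) = phi3 (fls_const a) (E1 F)" .
next
  fix A and F :: "int \<Rightarrow> int \<Rightarrow> int \<Rightarrow> 'v" assume "F \<in> laurent3"
  then show "phi3 (fls_X_inv * A) (E1 F) = phi3 A (E1 (nu_map \<delta> F))"
    by (simp add: phi3_def hat_X_inv psd_mult_X_inv_left E1_\<delta>)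
next
  show "additive (\<lambda>A. phi3 A G)" for G
    unfolding phi3_def by (rule additive_comp[of "\<lambda>A. psd_mult \<delta> A G"]) (simp_all add: psd_mult_additive_left)
qed (rule E1_add E1_deg deg2_phi3; assumption)+

lemma psd_bounded_mult_le: "psd_le k A \<Longrightarrow> psd_bounded k (psd_mult d A)"
  unfolding psd_bounded_def using psd_mult_le[OF d_additive, of k A]
  by (simp add: additive.zero[OF mult_right_additive] add.commute)

lemma E3_nphi3: "F \<in> laurent3 \<Longrightarrow> E3 (nphi3 A F) = psd_map (psd_mult d A) (E3 F)"
proof (rule nphi3_transport)
  fix a :: 'v and F :: "int \<Rightarrow> int \<Rightarrow> int \<Rightarrow> 'v" assume F: "F \<in> laurent3"
  have "(\<lambda>A. fls_const a * A) = psd_map (\<lambda>x. a * x)" by (intro ext psd_eqI) simp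
  then have "E3 (nu_map (\<lambda>A. fls_const a * A) F) = psd_map (psd_map (\<lambda>x. a * x)) (E3 F)"
    using E3_nu_psd_map[OF additive_mult(1) F] by simp
  also have "\<dots> = psd_map (psd_mult d (fls_const a)) (E3 F)"
    by (rule psd_eqI2) (simp add: psd_map_additive)
  finally show "E3 (nu_map (\<lambda>A. fls_const a * A) F) = psd_map (psd_mult d (fls_const a)) (E3 F)" .
next
  fix A and F :: "int \<Rightarrow> int \<Rightarrow> int \<Rightarrow> 'v" assume "F \<in> laurent3"
  then show "psd_map (psd_mult d (fls_X_inv * A)) (E3 F) = psd_map (psd_mult d A) (E3 (nu_map \<delta> F))"
    by (intro psd_eqI) (simp add: E3_\<delta> psd_mult_X_inv_left)
next
  show "additive (\<lambda>A. psd_map (psd_mult d A) G)" for G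
    by unfold_locales (auto intro!: psd_eqI simp: additive.add[OF mult_left_additive])
next
  show "deg2 (t + s) (psd_map (psd_mult d A) G)" if "psd_le s A" "deg2 t G" for A G s t
    by (rule deg2_psd_map[OF psd_bounded_mult_le that(2)]) (rule that(1))
qed (rule E3_add E3_deg; assumption)+

section \<open>The substitution \<open>theta\<close> in the expansions\<close>

lemma deg2_adj\<delta>:
  assumes "deg2 t G" shows "deg2 t (psd_adjoint \<delta> G)"
  unfolding deg2_row
proof
  fix q
  have "psd_le (t - q) (neg_one_power (q + int j) * of_int (int_binomial (q + int j) j) * (\<delta> ^^ j) (psd_coeff G (q + int j)))" for j
  proof -
    have "psd_le (t - (q + int j) + int j) ((\<delta> ^^ j) (psd_coeff G (q + int j)))"
      using assms by (intro psd_le_\<delta>_pow) (simp add: deg2_row)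
    then show ?thesis by (auto simp: psd_le_def mult.assoc neg_one_power_def)
  qed
  then show "psd_le (t - q) (psd_coeff (psd_adjoint \<delta> G) q)"
    unfolding psd_coeff_adjoint by (intro psd_le_sum) auto
qed

lemma adj\<delta>_X: "psd_adjoint \<delta> (psd_map (\<lambda>g. fls_X_inv * g) G) = psd_map (\<lambda>g. fls_X_inv * g) (psd_adjoint \<delta> G)"
proof (rule psd_adjoint_map[symmetric])
  show "fls_X_inv * \<delta> x = \<delta> (fls_X_inv * x)" for x
    by (rule psd_eqI) (simp add: psd_up_def)
qed auto

lemma theta_shift_mu: "F \<in> laurent3 \<Longrightarrow> theta (tri_shift 0 1 0 F) = - nu_map \<delta> (theta F)"
  by (simp only: theta_shift(2) nu_\<delta> laurent3_theta)

lemma laurent3_\<delta>: "F \<in> laurent3 \<Longrightarrow> nu_map \<delta> F \<in> laurent3"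
  by (simp add: nu_\<delta> laurent3_add laurent3_shift)

lemma psd_up_\<delta>: "psd_up \<delta> G = psd_up D G + psd_map (\<lambda>g. fls_X_inv * g) G"
  by (simp add: psd_up_def[of \<delta>] psd_up_def[of D] psd_map_\<delta>)

text \<open>With \<nu> = \<lambda>+\<mu>, the substitution \<mu> \<mapsto> -\<nu>-\<partial> reads
  \<mu> \<mapsto> -\<mu>-(\<lambda>+\<partial>), which is the adjoint in the outer variable for
  \<open>\<delta>\<close>.\<close>

lemma E1_theta: "F \<in> laurent3 \<Longrightarrow> E1 (theta F) = psd_adjoint \<delta> (E1 F)"
proof (rule laurent3_ext[of "\<lambda>F. E1 (theta F)" "\<lambda>F. psd_adjoint \<delta> (E1 F)"])
  fix F :: "int \<Rightarrow> int \<Rightarrow> int \<Rightarrow> 'v" assume F: "F \<in> laurent3"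
  let ?L = "E1 (theta F)" let ?R = "psd_adjoint \<delta> (E1 F)"
  have "E1 (theta (tri_shift 1 0 0 F)) = psd_map (\<lambda>g. fls_X_inv * g) ?L"
    "psd_adjoint \<delta> (E1 (tri_shift 1 0 0 F)) = psd_map (\<lambda>g. fls_X_inv * g) ?R"
    using F by (simp_all add: theta_shift E1_shift adj\<delta>_X)
  \<comment> \<open>Each shift becomes one and the same injective map on both sides, here
    multiplication by \<lambda>.\<close>
  then show "E1 (theta (tri_shift 1 0 0 F)) = psd_adjoint \<delta> (E1 (tri_shift 1 0 0 F)) \<longleftrightarrow> ?L = ?R"
    by (simp add: psd_map_inject X_inv_inject)
  have "E1 (theta (tri_shift 0 1 0 F)) = - psd_up \<delta> ?L"
    "psd_adjoint \<delta> (E1 (tri_shift 0 1 0 F)) = - psd_up \<delta> ?R"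
    using F by (simp_all add: theta_shift_mu E1_uminus laurent3_\<delta> E1_\<delta> E1_shift psd_adjoint_X_inv)
  then show "E1 (theta (tri_shift 0 1 0 F)) = psd_adjoint \<delta> (E1 (tri_shift 0 1 0 F)) \<longleftrightarrow> ?L = ?R"
    by (simp add: psd_up_inject)
  have "E1 (theta (tri_shift 0 0 1 F)) = - (fls_X_inv * ?L + psd_map D ?L)"
    using F by (simp only: theta_shift E1_uminus E1_add E1_shift E1_nu_psd_map laurent3_add laurent3_shift laurent3_theta laurent3_D d_additive)
  then have "E1 (theta (tri_shift 0 0 1 F)) = - psd_up D ?L"
    by (simp only: psd_up_def[of D])
  moreover have "psd_adjoint \<delta> (E1 (tri_shift 0 0 1 F)) = - psd_up D ?R"
    using F by (simp add: E1_shift additive.add[OF adj\<delta>_additive] psd_adjoint_X_inv adj\<delta>_X psd_up_\<delta>)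
  ultimately show "E1 (theta (tri_shift 0 0 1 F)) = psd_adjoint \<delta> (E1 (tri_shift 0 0 1 F)) \<longleftrightarrow> ?L = ?R"
    by (simp add: psd_up_inject)
qed (simp_all add: theta_add E1_add additive.add[OF adj\<delta>_additive] E1_deg tri_deg_theta deg2_adj\<delta> theta_const E1_const)

lemma psd_map_adj_\<delta>: "psd_map adj (psd_map (\<lambda>g. fls_X_inv * g) G) = - psd_map \<delta> (psd_map adj G)"
  by (rule psd_eqI) (simp add: psd_adjoint_X_inv)

text \<open>The second expansion has \<mu> and the third has \<nu> as inner variable, both with
  \<lambda> outside, so \<open>theta\<close> reduces to the adjoint in the inner variable.\<close>

lemma E3_theta: "F \<in> laurent3 \<Longrightarrow> E3 (theta F) = psd_map adj (E2 F)"
proof (rule laurent3_ext[of "\<lambda>F. E3 (theta F)" "\<lambda>F. psd_map adj (E2 F)"])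
  fix F :: "int \<Rightarrow> int \<Rightarrow> int \<Rightarrow> 'v" assume F: "F \<in> laurent3"
  let ?L = "E3 (theta F)" let ?R = "psd_map adj (E2 F)"
  have "E3 (theta (tri_shift 1 0 0 F)) = fls_X_inv * ?L"
    "psd_map adj (E2 (tri_shift 1 0 0 F)) = fls_X_inv * ?R"
    using F by (simp_all add: theta_shift E3_shift E2_shift psd_map_X_inv_right)
  then show "E3 (theta (tri_shift 1 0 0 F)) = psd_map adj (E2 (tri_shift 1 0 0 F)) \<longleftrightarrow> ?L = ?R"
    by (simp add: X_inv_inject)
  have "E3 (theta (tri_shift 0 1 0 F)) = - psd_map \<delta> ?L"
    "psd_map adj (E2 (tri_shift 0 1 0 F)) = - psd_map \<delta> ?R"
    using F by (simp_all add: theta_shift_mu E3_uminus laurent3_\<delta> E3_\<delta> E2_shift psd_map_adj_\<delta>)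
  then show "E3 (theta (tri_shift 0 1 0 F)) = psd_map adj (E2 (tri_shift 0 1 0 F)) \<longleftrightarrow> ?L = ?R"
    by (simp add: psd_map_inject psd_up_inject)
  \<comment> \<open>The last shift turns into \<lambda>-(\<nu>+\<partial>). Seen as
    \<open>psd_up\<close> for the additive map \<open>- \<delta>\<close>, it is injective
    too.\<close>
  have neg: "psd_up (\<lambda>x. - \<delta> x) G = fls_X_inv * G - psd_map \<delta> G" for G
    using uminus_additive_\<delta> by (intro psd_eqI) (simp add: psd_up_def[of "\<lambda>x. - \<delta> x"])
  have "E3 (theta (tri_shift 0 0 1 F)) = - (psd_map (\<lambda>g. fls_X_inv * g) ?L - fls_X_inv * ?L + psd_map D ?L)"
    using F by (simp only: theta_shift E3_uminus E3_add E3_shift E3_nu_psd_map laurent3_add laurent3_shift laurent3_theta laurent3_D d_additive)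
  then have "E3 (theta (tri_shift 0 0 1 F)) = psd_up (\<lambda>x. - \<delta> x) ?L"
    by (simp add: neg psd_map_\<delta>)
  moreover have "psd_map adj (E2 (tri_shift 0 0 1 F)) = psd_up (\<lambda>x. - \<delta> x) ?R"
    using F by (simp add: neg E2_shift additive.add[OF psd_map_additive] psd_map_X_inv_right psd_map_adj_\<delta>)
  ultimately show "E3 (theta (tri_shift 0 0 1 F)) = psd_map adj (E2 (tri_shift 0 0 1 F)) \<longleftrightarrow> ?L = ?R"
    by (simp add: psd_up_inject uminus_additive_\<delta>)
next
  fix F :: "int \<Rightarrow> int \<Rightarrow> int \<Rightarrow> 'v" and s assume F: "F \<in> laurent3" "tri_deg s F"
  then have "deg2 s (E2 F)" by (simp add: E2_conv E1_deg laurent3_swap tri_deg_swap)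
  then show "deg2 s (psd_map adj (E2 F))" using deg2_psd_map[OF psd_bounded_adj] by simp
next
  have "psd_map adj (fls_const (fls_const f)) = fls_const (fls_const f)" for f
    by (rule psd_eqI) (simp add: additive.zero)
  then show "E3 (theta (tri_const f)) = psd_map adj (E2 (tri_const f))" for f
    by (simp add: theta_const E3_const E2_conv swap_const E1_const)
qed (simp_all add: theta_add E3_add E2_add additive.add[OF psd_map_additive] E3_deg tri_deg_theta)

lemma psd_map_adj_adj [simp]: "psd_map adj (psd_map adj G) = G"
  by (rule psd_eqI) simp

lemma E2_theta: "F \<in> laurent3 \<Longrightarrow> E2 (theta F) = psd_map adj (E3 F)"
  using E3_theta[of "theta F"] by simp

lemma E1_swap: "E1 (swap_lm F) = E2 F" "E2 (swap_lm F) = E1 F"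
  by (simp_all add: E2_conv)

section \<open>The three actions in the expansions and their commutation\<close>

lemma adj\<delta>_phi3: "psd_adjoint \<delta> (phi3 A G) = phi2 (adj A) (psd_adjoint \<delta> G)"
  unfolding phi2_def phi3_def hat_adj by (rule psd_adjoint_mult) (auto simp: \<delta>_mult)

lemma adj\<delta>_phi2: "psd_adjoint \<delta> (phi2 A G) = phi3 (adj A) (psd_adjoint \<delta> G)"
  using adj\<delta>_phi3[of "adj A" "psd_adjoint \<delta> G"] by (metis psd_adjoint_adjoint \<delta>_additive d_additive)

lemma adj_psd_mult: "adj (psd_mult d A B) = psd_mult d (adj B) (adj A)"
  by (rule psd_adjoint_mult) (auto simp: d_mult)

lemma E1_nphi2: "F \<in> laurent3 \<Longrightarrow> E1 (nphi2 Q F) = phi2 Q (E1 F)"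
  by (simp add: nphi2_def E1_theta E1_nphi3 adj\<delta>_phi3)

text \<open>In the second expansion \<mu> is inside and \<lambda> outside, so \<open>phi1\<close>
  and \<open>phi2\<close> exchange their roles.\<close>

lemma E2_nphi2: "F \<in> laurent3 \<Longrightarrow> E2 (nphi2 P F) = phi1 P (E2 F)"
  by (rule psd_eqI) (simp add: nphi2_def E2_theta E3_theta E3_nphi3 phi1_def adj_psd_mult)

lemma E1_nphi1: "F \<in> laurent3 \<Longrightarrow> E1 (nphi1 P F) = phi1 P (E1 F)"
  by (simp add: nphi1_def E1_swap E2_nphi2 laurent3_swap)

lemma E2_nphi1: "F \<in> laurent3 \<Longrightarrow> E2 (nphi1 P F) = phi2 P (E2 F)"
  by (simp add: nphi1_def E1_swap E1_nphi2 laurent3_swap)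

lemma E2_nphi3: "F \<in> laurent3 \<Longrightarrow> E2 (nphi3 A F) = phi3 A (E2 F)"
  unfolding E2_conv by (simp add: nphi3_def nu_map_swap_lm[symmetric] laurent3_swap flip: E1_nphi3)

lemma phi_additive [simp]: "additive (phi1 P)" "additive (phi2 P)" "additive (phi3 P)"
  unfolding phi1_def phi2_def phi3_def
  by (simp_all add: psd_map_additive psd_mult_additive_left psd_mult_additive_right)

lemma phi_additive_left: "additive (\<lambda>P. phi1 P G)" "additive (\<lambda>P. phi2 P G)" "additive (\<lambda>P. phi3 P G)"
proof -
  show "additive (\<lambda>P. phi1 P G)"
    unfolding phi1_def by unfold_locales
      (simp only: additive.add[OF mult_right_additive] psd_map_plus[OF mult_left_additive mult_left_additive])
  show "additive (\<lambda>P. phi2 P G)"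
    unfolding phi2_def by (rule additive_comp[of "psd_mult D G" hat]) (simp_all add: psd_mult_additive_right)
  show "additive (\<lambda>P. phi3 P G)"
    unfolding phi3_def by (rule additive_comp[of "\<lambda>A. psd_mult \<delta> A G" hat]) (simp_all add: psd_mult_additive_left)
qed

text \<open>\<open>A\<close> stands to the left and \<open>Q\<close> to the right of
  \<open>G\<close>, so this is associativity, with \<lambda>+\<partial> acting on \<open>G\<close>
  and the coefficientwise derivation on \<open>hat Q\<close>.\<close>

lemma phi3_phi2: "phi3 A (phi2 Q G) = phi2 Q (phi3 A G)"
  unfolding phi3_def phi2_def by (rule psd_mult_assoc) (auto simp: \<delta>_mult(2))

lemma \<delta>_psd_mult: "\<delta> (psd_mult d A B) = psd_mult d (\<delta> A) B"
  by (rule psd_up_mult) (auto simp: d_mult)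

text \<open>\<lambda>+\<partial> composes with \<partial> from the left and thus commutes with
  composing with \<open>P\<close> on the right.\<close>

lemma phi3_phi1: "phi3 A (phi1 P G) = phi1 P (phi3 A G)"
  unfolding phi3_def phi1_def
  by (rule psd_mult_map_right) (auto simp: \<delta>_psd_mult psd_mult_const_mult additive.zero[OF mult_left_additive])

lemma psd_mult_const_right: "psd_mult d (g * fls_const q) P = psd_mult d g P * fls_const q"
  using psd_mult_const_mult[OF d_additive, of q g P] by (simp add: mult.commute)

lemma D_pow_const: "(D ^^ j) (fls_const a) = fls_const ((d ^^ j) a)"
  by (induction j) auto

text \<open>The coefficients of \<open>hat Q\<close> are constant in \<lambda> and multiply as
  scalars, which pass through right composition with \<open>P\<close>.\<close>

lemma phi1_phi2: "phi1 P (phi2 Q G) = phi2 Q (phi1 P G)"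
proof (rule psd_eqI)
  fix n
  let ?f = "\<lambda>g. psd_mult d g P"
  let ?K = "nat (psd_order (hat Q) - n + psd_order G)"
  have *: "?f (x * of_int k * fls_const y) = ?f x * of_int k * fls_const y" for x k y
  proof -
    have "x * of_int k * fls_const y = of_int k * (x * fls_const y)" by (simp add: mult_ac)
    then show ?thesis
      by (simp only: additive_of_int[OF mult_left_additive] psd_mult_const_right) (simp add: mult_ac)
  qed
  show "psd_coeff (phi1 P (phi2 Q G)) n = psd_coeff (phi2 Q (phi1 P G)) n"
    unfolding phi1_def phi2_def
    by (simp add: psd_coeff_mult_box[OF D_additive psd_le_order[of G] psd_le_order[of "hat Q"] order_refl, of n ?K]
        psd_coeff_mult_box[OF D_additive psd_le_map[OF mult_left_additive psd_le_order[of G]] psd_le_order[of "hat Q"] order_refl, of n ?K]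
        additive.sum[OF mult_left_additive] * D_pow_const)
qed

lemma phi3_comp: "phi3 A (phi3 B G) = phi3 (psd_mult d A B) G"
  unfolding phi3_def hat_mult by (rule psd_mult_assoc) (auto simp: \<delta>_mult)

lemma d_psd_mult_assoc: "psd_mult d A (psd_mult d B C) = psd_mult d (psd_mult d A B) C"
  by (rule psd_mult_assoc) (auto simp: d_mult)

lemma phi1_comp: "phi1 P (phi1 R G) = phi1 (psd_mult d R P) G"
  by (rule psd_eqI) (simp add: phi1_def, simp add: d_psd_mult_assoc)

lemma adj\<delta>_phi1: "psd_adjoint \<delta> (phi1 P G) = phi1 P (psd_adjoint \<delta> G)"
  unfolding phi1_def by (rule psd_adjoint_map[symmetric]) (auto simp: \<delta>_psd_mult)

lemma d_one [simp]: "d 1 = 0"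
  using d_mult[of 1 1] by simp

lemma psd_mult_one_right [simp]: "psd_mult d A 1 = A"
proof (induction A rule: psd_induct)
  case (add A B)
  then show ?case by (simp add: additive.add[OF mult_left_additive])
next
  have up1: "psd_up d 1 = fls_X_inv * 1"
    by (rule psd_eqI) (simp add: psd_up_def additive.zero)
  case (up A)
  then show ?case by (simp add: psd_mult_X_inv_left up1 psd_mult_X_inv_right del: mult_1_right)
next
  have up1: "psd_up d 1 = fls_X_inv * 1"
    by (rule psd_eqI) (simp add: psd_up_def additive.zero)
  case (down A)
  have "fls_X_inv * psd_mult d (fls_X * A) 1 = psd_mult d (fls_X_inv * (fls_X * A)) 1"
    by (simp add: psd_mult_X_inv_left up1 psd_mult_X_inv_right del: mult_1_right)
  then show ?case using down by (metis fls_X_inv_mult_fls_X)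
next
  case (limit A)
  have "psd_le s A \<Longrightarrow> psd_le (s + 0) (psd_mult d A 1)" for s A
    by (rule psd_mult_le) (simp_all add: psd_le_def)
  then show ?case
    by (intro psd_eq_limit_additive[where A = A and L = "\<lambda>A. psd_mult d A 1" and R = "\<lambda>A. A" and c = 0])
       (use limit in \<open>auto intro: additive.intro\<close>)
qed simp

section \<open>Inverse matrices of operators\<close>

lemma psd_mat_mult_eq_1:
  fixes A B :: "'v fls ^ 'i ^ 'i::finite"
  assumes "psd_mat_mult d A B = mat 1"
  shows "(\<Sum>k\<in>UNIV. psd_mult d (A $ i $ k) (B $ k $ j)) = (if i = j then 1 else 0)"
proof -
  have "psd_mat_mult d A B $ i $ j = mat 1 $ i $ j" by (simp only: assms)
  then show ?thesis by (simp add: psd_mat_mult_def mat_def)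
qed

text \<open>Taking adjoints in \<open>H\<close> \<open>S\<close> = 1 and using skewness of
  \<open>S\<close> shows that minus the adjoint of \<open>H\<close> is a right inverse of
  \<open>S\<close>; composing with \<open>H\<close> on the left identifies it with
  \<open>H\<close>.\<close>

lemma psd_mat_inverse_skew:
  fixes S H :: "'v fls ^ 'i ^ 'i::finite"
  assumes S: "\<And>i j. adj (S $ i $ j) = - (S $ j $ i)"
    and SH: "psd_mat_mult d S H = mat 1" and HS: "psd_mat_mult d H S = mat 1"
  shows "adj (H $ i $ j) = - (H $ j $ i)"
proof -
  note 0 = additive.zero[OF mult_left_additive] additive.zero[OF mult_right_additive]
  have delta: "psd_mult d (if b then 1 else 0) X = (if b then X else 0)"
    "psd_mult d X (if b then 1 else 0) = (if b then X else 0)" for b X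
    by (simp_all add: 0)
  have one: "adj 1 = 1" using psd_adjoint_const[OF d_additive, of 1] by simp
  have star: "(\<Sum>k\<in>UNIV. psd_mult d (S $ m $ k) (- adj (H $ i $ k))) = (if m = i then 1 else 0)" for m
  proof -
    have "adj (\<Sum>k\<in>UNIV. psd_mult d (H $ i $ k) (S $ k $ m)) = adj (if i = m then 1 else 0)"
      by (simp only: psd_mat_mult_eq_1[OF HS])
    then show ?thesis
      by (simp add: additive.sum[OF adj_additive] adj_psd_mult S one additive.zero[OF adj_additive]
          additive.minus[OF mult_left_additive] additive.minus[OF mult_right_additive] split: if_splits)
  qed
  have "- adj (H $ i $ j) = (\<Sum>k\<in>UNIV. psd_mult d (if j = k then 1 else 0) (- adj (H $ i $ k)))"
    by (simp only: delta) simp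
  also have "\<dots> = (\<Sum>k\<in>UNIV. \<Sum>m\<in>UNIV. psd_mult d (psd_mult d (H $ j $ m) (S $ m $ k)) (- adj (H $ i $ k)))"
    by (simp only: psd_mat_mult_eq_1[OF HS, symmetric] additive.sum[OF mult_left_additive])
  also have "\<dots> = (\<Sum>m\<in>UNIV. \<Sum>k\<in>UNIV. psd_mult d (H $ j $ m) (psd_mult d (S $ m $ k) (- adj (H $ i $ k))))"
    by (subst sum.swap) (simp only: d_psd_mult_assoc)
  also have "\<dots> = (\<Sum>m\<in>UNIV. psd_mult d (H $ j $ m) (if m = i then 1 else 0))"
    by (simp only: additive.sum[OF mult_right_additive, symmetric] star)
  also have "\<dots> = H $ j $ i"
    by (simp only: delta) simp
  finally show ?thesis by (metis minus_minus)
qed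

section \<open>Transport of the Jacobi identity\<close>

text \<open>A single tensor supplies all three terms, so one transport theorem covers both the
  symplectic and the Hamiltonian identity.\<close>

definition Jacobi :: "('i \<Rightarrow> 'i \<Rightarrow> 'i \<Rightarrow> 'v fls fls) \<Rightarrow> bool" where
  "Jacobi t \<longleftrightarrow> (\<forall>i j k. vlm_identity (t i j k) (t j i k) (psd_map adj (t k i j)))"

text \<open>On \<open>Y\<close> the lifted actions apply directly. \<open>Z\<close> represents an
  adjoint, so \<open>theta\<close> first carries it to the second expansion, where the indices show
  which factor of \<open>A\<close> acts on which slot, and carries the result back. Skewness of
  \<open>A\<close> makes both results fit in the first expansion.\<close>

theorem Jacobi_transform:
  fixes A :: "'v fls ^ 'i ^ 'i::finite"
  assumes skew: "\<And>i j. adj (A $ i $ j) = - (A $ j $ i)"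
    and t': "\<And>i j k. t' i j k = - (\<Sum>l\<in>UNIV. \<Sum>q\<in>UNIV. \<Sum>p\<in>UNIV.
        phi1 (A $ l $ i) (phi3 (A $ k $ p) (phi2 (A $ q $ j) (t l q p))))"
    and J: "Jacobi t"
  shows "Jacobi t'"
proof -
  have "\<forall>l q p. \<exists>Y. \<exists>Z. Y \<in> laurent3 \<and> Z \<in> laurent3 \<and> E2 Y = t q l p \<and> E3 Z = psd_map adj (t p l q) \<and> E1 Y - E1 Z = t l q p"
    using J unfolding Jacobi_def vlm_identity_iff by blast
  then obtain Y Z where Y [simp]: "Y l q p \<in> laurent3" and Z [simp]: "Z l q p \<in> laurent3"
    and E2Y: "E2 (Y l q p) = t q l p" and E3Z: "E3 (Z l q p) = psd_map adj (t p l q)"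
    and E1YZ: "E1 (Y l q p) - E1 (Z l q p) = t l q p" for l q p
    by metis
  have E2Z: "E2 (theta (Z l q p)) = t p l q" for l q p
    using E2_theta[OF Z, of l q p] by (simp add: E3Z)
  define fY where "fY i j k l q p = nphi1 (A $ l $ i) (nphi3 (A $ k $ p) (nphi2 (A $ q $ j) (Y l q p)))" for i j k l q p
  \<comment> \<open>By \<open>E2Z\<close> the transformed \<open>Z\<close> expands to
    \<open>t p l q\<close>: its index \<open>p\<close> belongs to the \<mu>-slot, \<open>l\<close>
    to the \<lambda>-slot and \<open>q\<close> to the \<nu>-slot.\<close>
  define fZ where "fZ i j k l q p =
      theta (nphi2 (A $ p $ k) (nphi3 (A $ j $ q) (nphi1 (A $ l $ i) (theta (Z l q p)))))" for i j k l q p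
  have f [simp]: "fY i j k l q p \<in> laurent3" "fZ i j k l q p \<in> laurent3" for i j k l q p
    by (simp_all add: fY_def fZ_def)
  define Y' where "Y' i j k = - (\<Sum>l\<in>UNIV. \<Sum>q\<in>UNIV. \<Sum>p\<in>UNIV. fY i j k l q p)" for i j k
  define Z' where "Z' i j k = - (\<Sum>l\<in>UNIV. \<Sum>q\<in>UNIV. \<Sum>p\<in>UNIV. fZ i j k l q p)" for i j k
  have L: "Y' i j k \<in> laurent3" "Z' i j k \<in> laurent3" for i j k
    unfolding Y'_def Z'_def by (intro laurent3_uminus laurent3_sum f)+
  have E2f: "E2 (fY i j k l q p) = phi1 (A $ q $ j) (phi3 (A $ k $ p) (phi2 (A $ l $ i) (t q l p)))" for i j k l q p
    by (simp add: fY_def E2_nphi1 E2_nphi2 E2_nphi3 E2Y phi1_phi2 phi3_phi1 phi3_phi2)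
  have E2Y': "E2 (Y' i j k) = t' j i k" for i j k
    unfolding Y'_def t' E2_sum3[OF f(1)] E2f
      sum3_swap(1)[of "\<lambda>q l p. phi1 (A $ q $ j) (phi3 (A $ k $ p) (phi2 (A $ l $ i) (t q l p)))"] ..
  have E3f: "E3 (fZ i j k l q p) = psd_map adj (phi1 (A $ p $ k) (phi3 (A $ j $ q) (phi2 (A $ l $ i) (t p l q))))" for i j k l q p
    by (simp add: fZ_def E3_theta E2_nphi1 E2_nphi2 E2_nphi3 E2Z)
  have E3Z': "E3 (Z' i j k) = psd_map adj (t' k i j)" for i j k
    unfolding Z'_def t' E3_sum3[OF f(2)] E3f
      additive.minus[OF psd_map_additive[OF adj_additive]] additive.sum[OF psd_map_additive[OF adj_additive]]
      sum3_swap(2)[of "\<lambda>p l q. psd_map adj (phi1 (A $ p $ k) (phi3 (A $ j $ q) (phi2 (A $ l $ i) (t p l q))))"] ..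
  have E1f: "E1 (fY i j k l q p) - E1 (fZ i j k l q p) = phi1 (A $ l $ i) (phi3 (A $ k $ p) (phi2 (A $ q $ j) (t l q p)))" for i j k l q p
  proof -
    \<comment> \<open>The adjoint makes the \<mu>- and \<nu>-actions trade places and replaces their
      factors of \<open>A\<close> by adjoints; the two signs from skewness cancel.\<close>
    have "E1 (fZ i j k l q p) = phi3 (- (A $ k $ p)) (phi2 (- (A $ q $ j)) (phi1 (A $ l $ i) (E1 (Z l q p))))"
      by (simp add: fZ_def E1_theta E1_nphi1 E1_nphi2 E1_nphi3 adj\<delta>_phi1 adj\<delta>_phi2 adj\<delta>_phi3 skew)
    also have "\<dots> = phi1 (A $ l $ i) (phi3 (A $ k $ p) (phi2 (A $ q $ j) (E1 (Z l q p))))"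
      by (simp add: additive.minus[OF phi_additive_left(2)] additive.minus[OF phi_additive_left(3)]
          phi_additive[THEN additive.minus] phi1_phi2 phi3_phi1 phi3_phi2)
    finally show ?thesis
      by (simp add: fY_def E1_nphi1 E1_nphi2 E1_nphi3 additive.diff[OF phi_additive(1), symmetric]
          additive.diff[OF phi_additive(2), symmetric] additive.diff[OF phi_additive(3), symmetric] E1YZ)
  qed
  have "E1 (Y' i j k) - E1 (Z' i j k) = t' i j k" for i j k
    unfolding Y'_def Z'_def t' E1_sum3[OF f(1)]
      E1_sum3[OF f(2)] E1f[symmetric] sum_subtractf
    by (rule minus_diff_minus)
  then show ?thesis
    unfolding Jacobi_def vlm_identity_iff using L E2Y' E3Z' by blast
qed

end

section \<open>The brackets as tensors\<close>

context diff_functions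
begin

section \<open>Frechet derivatives of differential functions\<close>

lemma d_add: "d (f + g) = d f + d g" and d_leibniz: "d (f * g) = d f * g + f * d g"
  using d_derivation by (auto simp: derivation_over_def)

lemma pd_add: "pd i n (f + g) = pd i n f + pd i n g" and pd_leibniz: "pd i n (f * g) = pd i n f * g + f * pd i n g"
  using pd_derivation by (auto simp: derivation_over_def)

sublocale derivation_ring d
  by unfold_locales (simp_all add: d_add d_leibniz)

abbreviation "u \<equiv> \<lambda>i. \<iota> (dp_var i 0)"

lemma pd_additive [simp]: "additive (pd i n)"
  by unfold_locales (simp add: pd_add)

lemma pd_one [simp]: "pd i n 1 = 0"
  using pd_leibniz[of i n 1 1] by simp

lemma pd_finite_order: "finite {n. pd i n f \<noteq> 0}"
proof -
  have "{n. pd i n f \<noteq> 0} = Pair i -` {(i, n). pd i n f \<noteq> 0}" by auto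
  then show ?thesis using finite_vimageI[OF pd_finite, of "Pair i"] by (simp add: inj_on_def)
qed

text \<open>The Frechet derivative in the direction of \<open>u i\<close>, as a differential
  operator. All brackets in the two structures are built from it.\<close>

definition lpd :: "'i \<Rightarrow> 'v \<Rightarrow> 'v fls" where
  "lpd i f = (\<Sum>n\<in>{n. pd i n f \<noteq> 0}. fls_const (pd i n f) * psd_D n)"

lemma psd_coeff_D [simp]: "psd_coeff (psd_D n :: 'a::comm_ring_1 fls) k = (if k = int n then 1 else 0)"
  by (auto simp: psd_coeff_def psd_D_def)

lemma psd_coeff_lpd: "psd_coeff (lpd i f) k = (if k \<ge> 0 then pd i (nat k) f else 0)"
proof -
  have "psd_coeff (lpd i f) k = (\<Sum>n\<in>{n. pd i n f \<noteq> 0}. if k = int n then pd i n f else 0)"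
    unfolding lpd_def psd_coeff_sum by (rule sum.cong) auto
  also have "\<dots> = (\<Sum>n\<in>{n. pd i n f \<noteq> 0}. if n = nat k then if k \<ge> 0 then pd i n f else 0 else 0)"
    by (rule sum.cong) auto
  also have "\<dots> = (if k \<ge> 0 then pd i (nat k) f else 0)"
    by (subst sum.delta[OF pd_finite_order]) auto
  finally show ?thesis .
qed

lemma lpd_additive [simp]: "additive (lpd i)"
  by unfold_locales (auto intro!: psd_eqI simp: psd_coeff_lpd pd_add)

lemma lpd_mult: "lpd i (f * g) = lpd i f * fls_const g + fls_const f * lpd i g"
  by (rule psd_eqI) (auto simp: psd_coeff_lpd pd_leibniz mult.commute[of _ "fls_const _"])

text \<open>On symbols, the commutator of \<open>pd i n\<close> with \<open>d\<close> turns
  \<partial> into \<lambda>+\<partial>. This is where the map \<open>\<delta>\<close> of the actions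
  comes from.\<close>

lemma lpd_d: "lpd i (d f) = \<delta> (lpd i f)"
proof (rule psd_eqI)
  fix k :: int
  have "pd i n (d f) = d (pd i n f) + (case n of 0 \<Rightarrow> 0 | Suc m \<Rightarrow> pd i m f)" for n
    using pd_d_commutator[of i n f] by (simp add: algebra_simps)
  then show "psd_coeff (lpd i (d f)) k = psd_coeff (\<delta> (lpd i f)) k"
    by (cases k rule: int_cases4) (auto simp: psd_up_def psd_coeff_lpd additive.zero split: nat.split)
qed

lemma lpd_u: "lpd i (u j) = (if i = j then 1 else 0)"
  by (rule psd_eqI) (auto simp: psd_coeff_lpd pd_var)

lemma lpd_one: "lpd i 1 = 0"
  by (rule psd_eqI) (simp add: psd_coeff_lpd)

lemma pd_u_support: "{m. pd i m (u j) \<noteq> 0} = (if i = j then {0} else {})"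
  by (auto simp: pd_var)

lemma adj_psd_D: "adj (psd_D m) = (- 1) ^ m * psd_D m"
proof (induction m)
  case 0
  then show ?case using psd_adjoint_const[OF d_additive, of 1] by (simp add: psd_D_def)
next
  case (Suc m)
  have "psd_coeff ((- 1) ^ m * psd_D m) k = (if k = int m then (- 1) ^ m else 0)" for k
    by (cases "even m") auto
  then have "D ((- 1) ^ m * psd_D m) = 0"
    by (intro psd_eqI) (cases "even m"; simp add: additive.zero additive.minus)
  moreover have "psd_D (Suc m) = fls_X_inv * (psd_D m :: 'v fls)" by (simp add: psd_D_def)
  ultimately show ?case
    using Suc by (simp add: psd_adjoint_X_inv psd_up_def mult.left_commute)
qed

lemma adj_lpd: "adj (lpd i f) = (\<Sum>m\<in>{m. pd i m f \<noteq> 0}. psd_mult d ((- 1) ^ m * psd_D m) (fls_const (pd i m f)))"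
proof -
  have "adj (fls_const a * psd_D m) = psd_mult d ((- 1) ^ m * psd_D m) (fls_const a)" for a m
    using adj_psd_mult[of "fls_const a" "psd_D m"] by (simp add: adj_psd_D)
  then show ?thesis by (simp add: lpd_def additive.sum[OF adj_additive])
qed

lemma psd_mult_lpd: "psd_mult d (lpd i f) A = (\<Sum>n\<in>{n. pd i n f \<noteq> 0}. fls_const (pd i n f) * psd_mult d (psd_D n) A)"
  by (simp add: lpd_def additive.sum[OF mult_left_additive] psd_mult_const_mult)

lemma psd_D_0 [simp]: "psd_D 0 = 1"
  by (simp add: psd_D_def)

section \<open>Brackets with a generator\<close>

lemma lambda_bracket_u_left: "lambda_bracket d pd H (u i) g = (\<Sum>l\<in>UNIV. psd_mult d (lpd l g) (H $ l $ i))"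
proof -
  have "lambda_bracket d pd H (u i) g = (\<Sum>i'\<in>UNIV. if i' = i then \<Sum>j\<in>UNIV. psd_mult d (lpd j g) (H $ j $ i) else 0)"
    unfolding lambda_bracket_def
    by (rule sum.cong) (auto simp: pd_u_support pd_var psd_mult_lpd)
  then show ?thesis by simp
qed

text \<open>The derivatives of \<open>f\<close> enter at the right end of the operator product with
  alternating signs, which is the adjoint of the Frechet derivative.\<close>

lemma lambda_bracket_u_right: "lambda_bracket d pd H f (u k) = (\<Sum>p\<in>UNIV. psd_mult d (H $ k $ p) (adj (lpd p f)))"
proof -
  have "lambda_bracket d pd H f (u k) = (\<Sum>i\<in>UNIV. \<Sum>j\<in>UNIV. if j = k then psd_mult d (H $ k $ i) (adj (lpd i f)) else 0)"
    unfolding lambda_bracket_def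
    by (intro sum.cong refl)
       (auto simp: pd_u_support pd_var adj_lpd additive.sum[OF mult_right_additive])
  then show ?thesis by simp
qed

lemma lambda_bracket_u: "lambda_bracket d pd H (u i) (u k) = H $ k $ i"
proof -
  have "lambda_bracket d pd H (u i) (u k) = (\<Sum>l\<in>UNIV. if l = k then H $ k $ i else 0)"
    unfolding lambda_bracket_u_left
    by (rule sum.cong) (auto simp: lpd_u additive.zero[OF mult_left_additive])
  then show ?thesis by simp
qed

lemma beltrami_bracket_u_left: "beltrami_bracket d pd (u i) g = lpd i g"
proof -
  have "beltrami_bracket d pd (u i) g = (\<Sum>i'\<in>UNIV. if i' = i then lpd i g else 0)"
    unfolding beltrami_bracket_def
    by (rule sum.cong) (auto simp: pd_u_support pd_var lpd_def)
  then show ?thesis by simp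
qed

lemma beltrami_bracket_u_right: "beltrami_bracket d pd f (u k) = adj (lpd k f)"
proof -
  have "(- 1) ^ m * psd_mult d (psd_D m) A = psd_mult d ((- 1) ^ m * psd_D m) A" for m A
    by (cases "even m") (simp_all add: additive.minus[OF mult_left_additive])
  then have "beltrami_bracket d pd f (u k) = (\<Sum>i\<in>UNIV. if i = k then adj (lpd k f) else 0)"
    unfolding beltrami_bracket_def
    by (intro sum.cong refl) (auto simp: pd_u_support pd_var adj_lpd)
  then show ?thesis by simp
qed

text \<open>Differentiating the left factor leaves \<open>B\<close> acting on the \<mu>-slot. In the
  right factor \<open>lpd_d\<close> turns derivatives into powers of \<lambda>+\<partial>, so
  \<open>A\<close> acts through \<lambda>+\<mu>+\<partial>.\<close>

lemma psd_map_lpd_mult: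
  "psd_map (lpd l) (psd_mult d A B) = phi2 B (psd_map (lpd l) A) + phi3 A (psd_map (lpd l) B)"
proof (rule psd_eqI)
  fix n
  let ?K = "nat (psd_order B - n + psd_order A)" let ?I = "{n - psd_order B..psd_order A}"
  let ?b = "\<lambda>m j. psd_coeff B (n - m + int j)" let ?a = "psd_coeff A"
  have hat: "psd_le (psd_order C) (hat C)" for C
    by (simp add: psd_le_def psd_coeff_above_order)
  have pow: "lpd l ((d ^^ j) x) = (\<delta> ^^ j) (lpd l x)" for j x
    by (induction j) (simp_all add: lpd_d)
  have "lpd l (a * of_int k * b) = lpd l a * of_int k * fls_const b + fls_const a * of_int k * lpd l b" for a k b
    by (simp add: mult.assoc lpd_mult[of l a] additive_of_int[OF lpd_additive] additive_of_int[OF additive_fls_const])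
  then have "psd_coeff (psd_map (lpd l) (psd_mult d A B)) n =
     (\<Sum>m\<in>?I. \<Sum>j\<le>?K. lpd l (?a m) * of_int (int_binomial m j) * fls_const ((d ^^ j) (?b m j))
       + fls_const (?a m) * of_int (int_binomial m j) * (\<delta> ^^ j) (lpd l (?b m j)))"
    by (simp add: psd_coeff_mult_box[OF d_additive psd_le_order[of A] psd_le_order[of B] order_refl, of n ?K]
        additive.sum[OF lpd_additive] pow)
  also have "\<dots> = psd_coeff (phi2 B (psd_map (lpd l) A)) n + psd_coeff (phi3 A (psd_map (lpd l) B)) n"
    unfolding phi2_def phi3_def
    by (simp add: sum.distrib D_pow_const
        psd_coeff_mult_box[OF D_additive psd_le_map[OF lpd_additive psd_le_order[of A]] hat[of B] order_refl, of n ?K]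
        psd_coeff_mult_box[OF \<delta>_additive hat[of A] psd_le_map[OF lpd_additive psd_le_order[of B]] order_refl, of n ?K])
  finally show "psd_coeff (psd_map (lpd l) (psd_mult d A B)) n
      = psd_coeff (phi2 B (psd_map (lpd l) A) + phi3 A (psd_map (lpd l) B)) n" by simp
qed

section \<open>The tensors of the two identities and their transformation\<close>

definition sym_tensor :: "'v fls ^ 'i ^ 'i \<Rightarrow> 'i \<Rightarrow> 'i \<Rightarrow> 'i \<Rightarrow> 'v fls fls" where
  "sym_tensor S l q p = psd_map (lpd l) (S $ p $ q)"

text \<open>The first term of the Jacobi identity for \<open>H\<close>: its outer bracket puts
  \<open>H\<close> on the \<lambda>-slot, whereas a Beltrami bracket leaves that slot alone.\<close>

definition ham_tensor :: "'v fls ^ 'i ^ 'i \<Rightarrow> 'i \<Rightarrow> 'i \<Rightarrow> 'i \<Rightarrow> 'v fls fls" where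
  "ham_tensor H i j k = (\<Sum>l\<in>UNIV. phi1 (H $ l $ i) (sym_tensor H l j k))"

text \<open>Differentiating \<open>S \<circ> H = 1\<close>.\<close>

lemma sym_tensor_inverse:
  assumes SH: "psd_mat_mult d S H = mat 1" and HS: "psd_mat_mult d H S = mat 1"
  shows "sym_tensor H l j k =
    - (\<Sum>q\<in>UNIV. \<Sum>p\<in>UNIV. phi3 (H $ k $ p) (phi2 (H $ q $ j) (sym_tensor S l q p)))"
proof -
  have eq: "(\<Sum>q\<in>UNIV. phi3 (S $ p $ q) (sym_tensor H l j q)) = - (\<Sum>q\<in>UNIV. phi2 (H $ q $ j) (sym_tensor S l q p))" for p
  proof -
    have "psd_map (lpd l) (\<Sum>q\<in>UNIV. psd_mult d (S $ p $ q) (H $ q $ j)) = psd_map (lpd l) (if p = j then 1 else 0)"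
      by (simp only: psd_mat_mult_eq_1[OF SH])
    also have "\<dots> = 0" by (rule psd_eqI) (auto simp: lpd_one additive.zero)
    finally show ?thesis
      by (simp add: additive.sum[OF psd_map_additive] psd_map_lpd_mult sum.distrib sym_tensor_def eq_neg_iff_add_eq_0 add.commute)
  qed
  \<comment> \<open>The identity is inserted in the \<nu>-slot in order to be written as the product
    of \<open>H\<close> and \<open>S\<close>, after which \<open>eq\<close> applies to the sum over
    \<open>q\<close>.\<close>
  have "sym_tensor H l j k = (\<Sum>q\<in>UNIV. phi3 (if k = q then 1 else 0) (sym_tensor H l j q))"
  proof -
    have "phi3 (if k = q then 1 else 0) G = (if k = q then G else 0)" for q G
      using psd_eqI[of "hat 1" 1] by (auto simp: phi3_def additive.zero[OF hat_additive] additive.zero[OF psd_mult_additive_left])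
    then show ?thesis by simp
  qed
  also have "\<dots> = (\<Sum>q\<in>UNIV. \<Sum>p\<in>UNIV. phi3 (H $ k $ p) (phi3 (S $ p $ q) (sym_tensor H l j q)))"
    by (simp only: psd_mat_mult_eq_1[OF HS, symmetric] additive.sum[OF phi_additive_left(3)] phi3_comp)
  also have "\<dots> = (\<Sum>p\<in>UNIV. phi3 (H $ k $ p) (\<Sum>q\<in>UNIV. phi3 (S $ p $ q) (sym_tensor H l j q)))"
    by (subst sum.swap) (simp only: additive.sum[OF phi_additive(3)])
  also have "\<dots> = - (\<Sum>p\<in>UNIV. \<Sum>q\<in>UNIV. phi3 (H $ k $ p) (phi2 (H $ q $ j) (sym_tensor S l q p)))"
    by (simp only: eq additive.minus[OF phi_additive(3)] additive.sum[OF phi_additive(3)] sum_negf)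
  also have "\<dots> = - (\<Sum>q\<in>UNIV. \<Sum>p\<in>UNIV. phi3 (H $ k $ p) (phi2 (H $ q $ j) (sym_tensor S l q p)))"
    by (subst sum.swap) (rule refl)
  finally show ?thesis .
qed

lemma ham_tensor_eq:
  assumes "psd_mat_mult d S H = mat 1" "psd_mat_mult d H S = mat 1"
  shows "ham_tensor H i j k = - (\<Sum>l\<in>UNIV. \<Sum>q\<in>UNIV. \<Sum>p\<in>UNIV.
    phi1 (H $ l $ i) (phi3 (H $ k $ p) (phi2 (H $ q $ j) (sym_tensor S l q p))))"
  unfolding ham_tensor_def sym_tensor_inverse[OF assms]
  by (simp only: additive.minus[OF phi_additive(1)] additive.sum[OF phi_additive(1)] sum_negf)

text \<open>\<open>phi1_comp\<close> reverses the order of the factors, so undoing \<open>H\<close>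
  on the \<lambda>-slot by \<open>S\<close> produces the product of \<open>H\<close> and
  \<open>S\<close>.\<close>

lemma sym_tensor_ham_tensor:
  assumes "psd_mat_mult d H S = mat 1"
  shows "sym_tensor H l j k = (\<Sum>i\<in>UNIV. phi1 (S $ i $ l) (ham_tensor H i j k))"
proof -
  have "sym_tensor H l j k = (\<Sum>m\<in>UNIV. phi1 (if m = l then 1 else 0) (sym_tensor H m j k))"
  proof -
    have "phi1 (if m = l then 1 else 0) G = (if m = l then G else 0)" for m G
      by (rule psd_eqI) (auto simp: phi1_def additive.zero[OF mult_right_additive])
    then show ?thesis by simp
  qed
  also have "\<dots> = (\<Sum>m\<in>UNIV. \<Sum>i\<in>UNIV. phi1 (S $ i $ l) (phi1 (H $ m $ i) (sym_tensor H m j k)))"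
    by (simp only: psd_mat_mult_eq_1[OF assms, symmetric] additive.sum[OF phi_additive_left(1)] phi1_comp)
  also have "\<dots> = (\<Sum>i\<in>UNIV. phi1 (S $ i $ l) (ham_tensor H i j k))"
    unfolding ham_tensor_def by (subst sum.swap) (simp only: additive.sum[OF phi_additive(1)])
  finally show ?thesis .
qed

text \<open>\<open>sym_tensor_inverse\<close> with \<open>S\<close> and \<open>H\<close> exchanged
  treats two slots, and \<open>sym_tensor_ham_tensor\<close> the third. The result has the shape of
  \<open>ham_tensor_eq\<close>, so the same transport works backwards.\<close>

lemma sym_tensor_eq:
  assumes SH: "psd_mat_mult d S H = mat 1" and HS: "psd_mat_mult d H S = mat 1"
  shows "sym_tensor S l q p = - (\<Sum>i\<in>UNIV. \<Sum>j\<in>UNIV. \<Sum>k\<in>UNIV.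
    phi1 (S $ i $ l) (phi3 (S $ p $ k) (phi2 (S $ j $ q) (ham_tensor H i j k))))"
proof -
  have "sym_tensor S l q p = - (\<Sum>j\<in>UNIV. \<Sum>k\<in>UNIV. phi3 (S $ p $ k) (phi2 (S $ j $ q) (sym_tensor H l j k)))"
    by (rule sym_tensor_inverse[OF HS SH])
  also have "\<dots> = - (\<Sum>j\<in>UNIV. \<Sum>k\<in>UNIV. \<Sum>i\<in>UNIV. phi1 (S $ i $ l) (phi3 (S $ p $ k) (phi2 (S $ j $ q) (ham_tensor H i j k))))"
    by (simp only: sym_tensor_ham_tensor[OF HS] additive.sum[OF phi_additive(2)] additive.sum[OF phi_additive(3)]
        phi1_phi2[symmetric] phi3_phi1)
  also have "\<dots> = - (\<Sum>j\<in>UNIV. \<Sum>i\<in>UNIV. \<Sum>k\<in>UNIV. phi1 (S $ i $ l) (phi3 (S $ p $ k) (phi2 (S $ j $ q) (ham_tensor H i j k))))"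
    by (intro arg_cong[of _ _ uminus] sum.cong refl sum.swap)
  also have "\<dots> = - (\<Sum>i\<in>UNIV. \<Sum>j\<in>UNIV. \<Sum>k\<in>UNIV. phi1 (S $ i $ l) (phi3 (S $ p $ k) (phi2 (S $ j $ q) (ham_tensor H i j k))))"
    by (intro arg_cong[of _ _ uminus] sum.swap)
  finally show ?thesis .
qed

lemma skew_iff: "psd_mat_skewadjoint d A \<longleftrightarrow> (\<forall>i j. adj (A $ i $ j) = - (A $ j $ i))" for A :: "'v fls ^ 'i ^ 'i"
  unfolding psd_mat_skewadjoint_def psd_mat_adjoint_def by (auto simp: vec_eq_iff)

end

section \<open>Both structures as instances of \<open>Jacobi\<close>, and the equivalence\<close>

locale diff_functions_domain = diff_functions \<iota> d pd
  for \<iota> :: "('f::field_char_0, 'i::finite) diff_poly \<Rightarrow> 'v::idom" and d pd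
begin

lemma nonlocal_symplectic_iff:
  "nonlocal_symplectic d pd u S \<longleftrightarrow>
     S \<in> rational_psd_mat d \<and> psd_mat_skewadjoint d S \<and> Jacobi (sym_tensor S)"
proof -
  have "psd_map (\<lambda>f. adj (lpd k f)) (S $ i $ j) = psd_map adj (sym_tensor S k j i)" for i j k
    by (simp add: sym_tensor_def psd_map_psd_map)
  then show ?thesis
    unfolding nonlocal_symplectic_def Jacobi_def lambda_bracket_u beltrami_bracket_u_left beltrami_bracket_u_right
    by (auto simp: sym_tensor_def)
qed

lemma nonlocal_hamiltonian_iff:
  assumes skew: "\<And>i j. adj ((H :: 'v fls ^ 'i ^ 'i) $ i $ j) = - (H $ j $ i)"
  shows "nonlocal_hamiltonian d pd u H \<longleftrightarrow>
     H \<in> rational_psd_mat d \<and> psd_mat_skewadjoint d H \<and> Jacobi (ham_tensor H)"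
proof -
  have add1: "additive (\<lambda>g. psd_mult d (lpd l g) A)" for l A
    by (rule additive_comp[of "\<lambda>g. psd_mult d g A"]) auto
  have add2: "additive (\<lambda>g. psd_mult d A (adj (lpd l g)))" for l A
    by (rule additive_comp[of "\<lambda>g. psd_mult d A (adj g)"]) (auto intro: additive_comp[of "psd_mult d A"])
  have left: "psd_map (\<lambda>g. \<Sum>l\<in>UNIV. psd_mult d (lpd l g) (H $ l $ i)) (H $ k $ j) = ham_tensor H i j k" for i j k
    by (simp add: psd_map_sum add1 ham_tensor_def sym_tensor_def phi1_def psd_map_psd_map)
  \<comment> \<open>Skewness turns the minus sign and the entry \<open>H $ k $ p\<close> into the
    adjoint of \<open>H $ p $ k\<close>, so each summand is the adjoint of a composition.\<close>
  have right: "- psd_map (\<lambda>f. \<Sum>p\<in>UNIV. psd_mult d (H $ k $ p) (adj (lpd p f))) (H $ j $ i)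
      = psd_map adj (ham_tensor H k i j)" for i j k
    by (rule psd_eqI)
       (simp add: psd_map_sum add2 ham_tensor_def sym_tensor_def phi1_def psd_coeff_sum
         additive.sum[OF adj_additive] adj_psd_mult skew additive.minus[OF mult_left_additive] sum_negf)
  have lb: "lambda_bracket d pd H (u i) = (\<lambda>g. \<Sum>l\<in>UNIV. psd_mult d (lpd l g) (H $ l $ i))" for i
    by (rule ext) (rule lambda_bracket_u_left)
  show ?thesis
    unfolding nonlocal_hamiltonian_def Jacobi_def lambda_bracket_u
    by (simp only: lb lambda_bracket_u_right left right)
qed

end

theorem theorem6p2:
  fixes \<iota> :: "('f::field_char_0, 'i::finite) diff_poly \<Rightarrow> 'v::idom"
    and d :: "'v \<Rightarrow> 'v"
    and pd :: "'i \<Rightarrow> nat \<Rightarrow> 'v \<Rightarrow> 'v"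
    and S :: "'v fls ^ 'i ^ 'i"
  assumes "diff_functions \<iota> d pd"
    and "S \<in> rational_psd_mat d"
    and "psd_mat_skewadjoint d S"
    and "rational_mat_invertible d S"
  shows "nonlocal_symplectic d pd (\<lambda>i. \<iota> (dp_var i 0)) S \<longleftrightarrow>
         nonlocal_hamiltonian d pd (\<lambda>i. \<iota> (dp_var i 0)) (rational_mat_inverse d S)"
proof -
  interpret diff_functions_domain \<iota> d pd
    using assms(1) by (rule diff_functions_domain.intro)
  let ?H = "rational_mat_inverse d S"
  have "rational_mat_is_inverse d S ?H"
    using assms(4) unfolding rational_mat_invertible_def rational_mat_inverse_def by (rule someI_ex)
  then have H: "?H \<in> rational_psd_mat d" and SH: "psd_mat_mult d S ?H = mat 1" and HS: "psd_mat_mult d ?H S = mat 1"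
    by (simp_all add: rational_mat_is_inverse_def)
  have skewS: "adj (S $ i $ j) = - (S $ j $ i)" for i j
    using assms(3) by (simp add: skew_iff)
  have skewH: "adj (?H $ i $ j) = - (?H $ j $ i)" for i j
    by (rule psd_mat_inverse_skew[OF skewS SH HS])
  \<comment> \<open>Transport by the inverse matrix gives one implication, transport by
    \<open>S\<close> the other.\<close>
  have "Jacobi (sym_tensor S) \<longleftrightarrow> Jacobi (ham_tensor ?H)"
    using Jacobi_transform[OF skewH ham_tensor_eq[OF SH HS]] Jacobi_transform[OF skewS sym_tensor_eq[OF SH HS]]
    by blast
  then show ?thesis
    using assms(2,3) H skewH by (simp add: nonlocal_symplectic_iff nonlocal_hamiltonian_iff[OF skewH] skew_iff)
qed

end
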